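(* Let $a,b>0$. For each $N$, let $\widetilde H_N$ be the linear interpolation of the steady state height function of the open TASEP on $\{1,\dots,N\}$ with parameters $\alpha=\frac1{1+a}$, $\beta=\frac1{1+b}$. Then the sequence $\{\frac1N\widetilde H_N\}$ of $C[0,1]$-valued random variables satisfies the large deviation principle with the rate function $$\mathcal I(f)=\inf_{g\in\mathcal{AC}_0}\Bigl\{\int_0^1\bigl(h(f'(x))+h(g'(x))\bigr)dx+\log(ab)\min_{0\le x\le1}(f(x)-g(x))-\log(b)\,(f(1)-g(1))\Bigr\}-\log\bigl(\bar\rho(1-\bar\rho)\bigr)$$ if $f\in\mathcal{AC}_0$, and $\mathcal I(f)=\infty$ otherwise.
   Context: Open TASEP: for $\alpha,\beta\in(0,1)$, the totally asymmetric simple exclusion process with open boundaries on $\{1,\dots,N\}$ is the continuous-time Markov chain on $\{0,1\}^N$ (with $\tau_j=1$ iff site $j$ is occupied) with the following transitions: a particle at site $j$ ($1\le j\le N-1$) jumps to site $j+1$ at rate $1$ if site $j+1$ is empty; if site $1$ is empty, a particle is inserted there at rate $\alpha$; if site $N$ is occupied, its particle is removed at rate $\beta$. It has a unique stationary distribution. The steady state height function is $H_N(k)=\tau_1+\dots+\tau_k$, $k=0,\dots,N$, with $(\tau_1,\dots,\tau_N)$ distributed according to the stationary distribution; $\widetilde H_N\in C[0,1]$ is the piecewise linear function interpolating the points $(k/N,H_N(k))$, $k=0,\dots,N$. Notation: $h(x)=x\log x+(1-x)\log(1-x)$ for $0\le x\le1$ (with $0\log0=0$) and $h(x)=\infty$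 for $x<0$ or $x>1$. $\mathcal{AC}_0$ is the set of absolutely continuous functions $f\in C[0,1]$ with $f(0)=0$. The number $\bar\rho=\bar\rho(a,b)$ is $$\bar\rho=\begin{cases}\frac{1}{1+a}& a>1,\ a>b,\\ \frac12 & a\le1,\ b\le1,\\ \frac{b}{1+b}& b>1,\ b>a;\end{cases}$$ for $a=b>1$ either $\frac1{1+a}$ or $\frac{b}{1+b}$ may be used, as both give the same value of $\bar\rho(1-\bar\rho)$. Large deviation principle (speed $N$): a sequence $\{Y_N\}$ of random variables with values in a complete separable metric space $\mathbb X$ satisfies the LDP with rate function $I:\mathbb X\to[0,\infty]$ if $I$ is lower semicontinuous with compact level sets $I^{-1}[0,w]$, $w\ge0$, and for every bounded continuous $\Phi:\mathbb X\to\mathbb R$, $\lim_{N\to\infty}\frac1N\log\mathbb E[\exp(N\Phi(Y_N))]=\sup_{x\in\mathbb X}\{\Phi(x)-I(x)\}$. Here $\mathbb X=C[0,1]$ with the supremum norm. *)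

theory Defs
  imports "HOL-Probability.Probability"
begin

section \<open>Continuous-time Markov chains on a finite state space\<close>

text \<open>A chain on the finite set \<open>S\<close> is given by its jump rates \<open>r x y\<close> for \<open>x \<noteq> y\<close>.
  Its transition function is the matrix exponential \<open>P\<^sub>t = exp (t Q)\<close> of the generator \<open>Q\<close>.\<close>

definition generator :: "'s set \<Rightarrow> ('s \<Rightarrow> 's \<Rightarrow> real) \<Rightarrow> 's \<Rightarrow> 's \<Rightarrow> real" where
  "generator S r x y = (if x = y then - (\<Sum>z\<in>S - {x}. r x z) else r x y)"

primrec matrix_power_on :: "'s set \<Rightarrow> ('s \<Rightarrow> 's \<Rightarrow> real) \<Rightarrow> nat \<Rightarrow> 's \<Rightarrow> 's \<Rightarrow> real" where
  "matrix_power_on S Q 0 = (\<lambda>x y. if x = y then 1 else 0)"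
| "matrix_power_on S Q (Suc n) = (\<lambda>x y. \<Sum>z\<in>S. Q x z * matrix_power_on S Q n z y)"

definition transition_prob ::
  "'s set \<Rightarrow> ('s \<Rightarrow> 's \<Rightarrow> real) \<Rightarrow> real \<Rightarrow> 's \<Rightarrow> 's \<Rightarrow> real" where
  "transition_prob S r t x y =
     (\<Sum>n. t ^ n / fact n * matrix_power_on S (generator S r) n x y)"

definition is_stationary :: "'s set \<Rightarrow> ('s \<Rightarrow> 's \<Rightarrow> real) \<Rightarrow> 's pmf \<Rightarrow> bool" where
  "is_stationary S r p \<longleftrightarrow>
     set_pmf p \<subseteq> S \<and>
     (\<forall>t\<ge>0. \<forall>y\<in>S. (\<Sum>x\<in>S. pmf p x * transition_prob S r t x y) = pmf p y)"

text \<open>Meaningful only for chains with exactly one stationary distribution.\<close>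

definition stationary_pmf :: "'s set \<Rightarrow> ('s \<Rightarrow> 's \<Rightarrow> real) \<Rightarrow> 's pmf" where
  "stationary_pmf S r = (THE p. is_stationary S r p)"


section \<open>Open TASEP\<close>

definition configs :: "nat \<Rightarrow> (nat \<Rightarrow> nat) set" where
  "configs N = ({1..N} \<rightarrow>\<^sub>E {0, 1})"

text \<open>Distinct transitions out of \<open>\<tau>\<close> lead to distinct configurations \<open>\<sigma> \<noteq> \<tau>\<close>, so at most one
  summand is nonzero.\<close>

definition tasep_rate :: "real \<Rightarrow> real \<Rightarrow> nat \<Rightarrow> (nat \<Rightarrow> nat) \<Rightarrow> (nat \<Rightarrow> nat) \<Rightarrow> real" where
  "tasep_rate \<alpha> \<beta> N \<tau> \<sigma> =
     (\<Sum>j\<in>{1..<N}. if \<tau> j = 1 \<and> \<tau> (j + 1) = 0 \<and> \<sigma> = \<tau>(j := 0, j + 1 := 1) then 1 else 0)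
     + (if \<tau> 1 = 0 \<and> \<sigma> = \<tau>(1 := 1) then \<alpha> else 0)
     + (if \<tau> N = 1 \<and> \<sigma> = \<tau>(N := 0) then \<beta> else 0)"

definition tasep_stationary :: "real \<Rightarrow> real \<Rightarrow> nat \<Rightarrow> (nat \<Rightarrow> nat) pmf" where
  "tasep_stationary \<alpha> \<beta> N = stationary_pmf (configs N) (tasep_rate \<alpha> \<beta> N)"

definition height :: "(nat \<Rightarrow> nat) \<Rightarrow> nat \<Rightarrow> real" where
  "height \<tau> k = (\<Sum>j=1..k. real (\<tau> j))"

text \<open>The space \<open>C[0,1]\<close> with the supremum metric.  Its elements are functions on the reals that
  are \<open>undefined\<close> outside the unit interval.\<close>

definition C01 :: "(real \<Rightarrow> real) metric" where
  "C01 = cfunspace (top_of_set {0..1}) euclidean_metric"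

text \<open>Piecewise linear interpolation of the points \<open>(k/N, H k)\<close>, \<open>k = 0, \<dots>, N\<close>.  At \<open>x = 1\<close> one
  has \<open>k = N\<close>, and the term containing \<open>H (N + 1)\<close> is multiplied by zero.\<close>

definition interpolate :: "nat \<Rightarrow> (nat \<Rightarrow> real) \<Rightarrow> real \<Rightarrow> real" where
  "interpolate N H =
     (\<lambda>x\<in>{0..1}. let k = nat \<lfloor>real N * x\<rfloor> in H k + (real N * x - real k) * (H (k + 1) - H k))"

definition scaled_height :: "nat \<Rightarrow> (nat \<Rightarrow> nat) \<Rightarrow> real \<Rightarrow> real" where
  "scaled_height N \<tau> = (\<lambda>x\<in>{0..1}. 1 / real N * interpolate N (height \<tau>) x)"


section \<open>Large deviation principle\<close>

definition lower_semicontinuous_map :: "'x topology \<Rightarrow> ('x \<Rightarrow> ereal) \<Rightarrow> bool" where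
  "lower_semicontinuous_map X I \<longleftrightarrow>
     (\<forall>x\<in>topspace X. \<forall>c < I x. \<exists>U. openin X U \<and> x \<in> U \<and> (\<forall>y\<in>U. c < I y))"

definition borel_metric :: "'x metric \<Rightarrow> 'x measure" where
  "borel_metric X = sigma (mspace X) {U. openin (mtopology_of X) U}"

text \<open>Large deviation principle with speed \<open>N\<close> for the random variables \<open>Y N\<close>, \<open>N \<ge> 1\<close>, defined
  on the probability spaces \<open>M N\<close> and with values in the metric space \<open>X\<close>, in the form of the
  Laplace principle.  The intended \<open>X\<close> are complete and separable.\<close>

definition LDP ::
  "'x metric \<Rightarrow> (nat \<Rightarrow> 'w measure) \<Rightarrow> (nat \<Rightarrow> 'w \<Rightarrow> 'x) \<Rightarrow> ('x \<Rightarrow> ereal) \<Rightarrow> bool" where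
  "LDP X M Y I \<longleftrightarrow>
     (\<forall>N\<ge>1. prob_space (M N) \<and> Y N \<in> measurable (M N) (borel_metric X)) \<and>
     (\<forall>x\<in>mspace X. 0 \<le> I x) \<and>
     lower_semicontinuous_map (mtopology_of X) I \<and>
     (\<forall>w::real. 0 \<le> w \<longrightarrow> compactin (mtopology_of X) {x \<in> mspace X. I x \<le> ereal w}) \<and>
     (\<forall>\<Phi>. continuous_map (mtopology_of X) euclideanreal \<Phi> \<and> bounded (\<Phi> ` mspace X) \<longrightarrow>
        (\<lambda>N. ereal (1 / real N * ln (\<integral>\<omega>. exp (real N * \<Phi> (Y N \<omega>)) \<partial>M N)))
          \<longlonglongrightarrow> (SUP x\<in>mspace X. ereal (\<Phi> x) - I x))"


section \<open>The rate function\<close>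

text \<open>The convention \<open>0 log 0 = 0\<close> is built in, since \<open>ln 0 = 0\<close>.\<close>

definition h :: "real \<Rightarrow> ereal" where
  "h x = (if 0 \<le> x \<and> x \<le> 1 then ereal (x * ln x + (1 - x) * ln (1 - x)) else \<infinity>)"

definition rho_bar :: "real \<Rightarrow> real \<Rightarrow> real" where
  "rho_bar a b =
     (if a > 1 \<and> a \<ge> b then 1 / (1 + a)
      else if a \<le> 1 \<and> b \<le> 1 then 1 / 2
      else b / (1 + b))"

definition abs_continuous_on :: "real \<Rightarrow> real \<Rightarrow> (real \<Rightarrow> real) \<Rightarrow> bool" where
  "abs_continuous_on c d f \<longleftrightarrow>
     (\<forall>\<epsilon>>0. \<exists>\<delta>>0. \<forall>(n::nat) u v.
        (\<forall>i<n. c \<le> u i \<and> u i \<le> v i \<and> v i \<le> d) \<and>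
        disjoint_family_on (\<lambda>i. {u i<..<v i}) {..<n} \<and>
        (\<Sum>i<n. v i - u i) < \<delta> \<longrightarrow>
        (\<Sum>i<n. \<bar>f (v i) - f (u i)\<bar>) < \<epsilon>)"

definition AC0 :: "(real \<Rightarrow> real) set" where
  "AC0 = {f \<in> mspace C01. abs_continuous_on 0 1 f \<and> f 0 = 0}"

text \<open>Integral of an extended-real function whose negative part has finite integral.\<close>

definition ereal_integral :: "'w measure \<Rightarrow> ('w \<Rightarrow> ereal) \<Rightarrow> ereal" where
  "ereal_integral M F =
     enn2ereal (\<integral>\<^sup>+x. e2ennreal (F x) \<partial>M) - enn2ereal (\<integral>\<^sup>+x. e2ennreal (- F x) \<partial>M)"

text \<open>\<open>deriv f x\<close> is arbitrary where \<open>f\<close> is not differentiable; for absolutely continuous \<open>f\<close>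
  this happens on a null set only.\<close>

definition rate :: "real \<Rightarrow> real \<Rightarrow> (real \<Rightarrow> real) \<Rightarrow> ereal" where
  "rate a b f =
     (if f \<in> AC0 then
        (INF g\<in>AC0.
           ereal_integral (lebesgue_on {0..1}) (\<lambda>x. h (deriv f x) + h (deriv g x))
           + ereal (ln (a * b) * (INF x\<in>{0..1}. f x - g x))
           - ereal (ln b * (f 1 - g 1)))
        - ereal (ln (rho_bar a b * (1 - rho_bar a b)))
      else \<infinity>)"

end

theory Submission
  imports Defs "HOL-Complex_Analysis.Great_Picard" "HOL-Real_Asymp.Real_Asymp"
begin

text \<open>
  The stationary law is the first marginal of an explicit Gibbs measure on pairs of
  configurations, so the theorem reduces to a Laplace principle for two independent layers of fair
  coin flips with a continuous interaction.

  Give a pair \<open>(\<tau>, \<sigma>)\<close> of configurations the weight \<open>(ab)\<^sup>-\<^sup>m b\<^sup>d\<close>, where \<open>m\<close> is the minimum and \<open>d\<close>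
  the end point of the walk with steps \<open>\<tau> j - \<sigma> j\<close>.  Pairing up the possible bottom
  layers step by step shows that the sum of these weights over \<open>\<sigma>\<close>, as a function of \<open>\<tau>\<close>, gains
  a factor \<open>1 + a\<close> from a hole in front and a factor \<open>1 + b\<close> from a particle at the end, and that
  its value at a configuration with a particle followed by a hole is the sum of the two values
  obtained by deleting one of them (\<open>top_weight_exchange\<close>).  These are the relations of the matrix
  product ansatz of Derrida, Evans, Hakim and Pasquier.  They turn the net flux through each bond
  into a difference of two terms, so that the fluxes cancel by telescoping
  (\<open>top_weight_stationary\<close>), and irreducibility makes the normalised weights the only stationary
  distribution.  In terms of rescaled heights the weight of a pair is the exponential of \<open>N\<close> times
  the functional \<open>interaction\<close>, exactly and for every \<open>N\<close>.

  All rescaled heights lie in the set \<open>admissible\<close> of nondecreasing one-Lipschitz paths, which is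
  compact by the theorem of Arzela and Ascoli, so exponential tightness is automatic.  For a
  continuous functional \<open>\<Psi>\<close> of two paths the exponential growth rate of the sum of
  \<open>exp (N \<Psi>)\<close> over all pairs is the supremum of \<open>\<Psi> f g - path_cost f - path_cost g\<close>, where the
  cost of a path is the integral of \<open>h\<close> along its slope (\<open>Laplace_limit\<close>).  The lower bound is the
  Gibbs variational inequality for the product measure whose densities are the increments of the
  path, together with Chebyshev's inequality at finitely many nodes.  For the upper bound a
  configuration is replaced by its averages \<open>p\<close> over long blocks.  The number
  \<open>exp (\<Sum>\<^sub>j h (p j))\<close> is the probability of the configuration under the product measure with densities
  \<open>p\<close>, and since only polynomially many vectors \<open>p\<close> of block averages occur, these probabilities
  sum to at most a polynomial in \<open>N\<close> (\<open>sum_exp_eta_block_average_le\<close>).  Applied with and without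
  the test function \<open>\<Phi>\<close>, this gives the Laplace principle up to the growth rate of the
  normalising constants; that rate is a supremum over pairs of paths which Legendre duality, applied
  separately before and after the point where \<open>f - g\<close> is smallest, evaluates as
  \<open>- log (rho_bar (1 - rho_bar))\<close>.

  It remains to see that \<open>rate\<close>, written with absolutely continuous functions and derivatives that
  exist almost everywhere, is the function found in this way.  This rests on two facts about an
  absolutely continuous \<open>f\<close>, both consequences of the Vitali covering theorem: it is differentiable
  almost everywhere (\<open>AC_differentiable_ae\<close>), and it is nondecreasing if its derivative is
  nonnegative almost everywhere (\<open>abs_continuous_on_mono\<close>).  Hence the paths of finite cost are
  the admissible ones.  Finally, the cost of a path is the limit of the costs of its piecewise linear
  interpolations and at least each of them, hence lower semicontinuous; compactness then makes the
  level sets of \<open>rate\<close> compact.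
\<close>

section \<open>Stationary distributions of finite chains\<close>

lemma matrix_power_on_bound:
  assumes "finite S" "x \<in> S"
  shows "\<bar>matrix_power_on S Q n x y\<bar> \<le> (\<Sum>x\<in>S. \<Sum>z\<in>S. \<bar>Q x z\<bar>) ^ n"
  using assms(2)
proof (induction n arbitrary: x)
  case 0
  then show ?case by simp
next
  case (Suc n)
  let ?C = "\<Sum>x\<in>S. \<Sum>z\<in>S. \<bar>Q x z\<bar>"
  have "\<bar>matrix_power_on S Q (Suc n) x y\<bar> \<le> (\<Sum>z\<in>S. \<bar>Q x z\<bar> * \<bar>matrix_power_on S Q n z y\<bar>)"
    by (auto intro!: order_trans[OF sum_abs] sum_mono simp: abs_mult)
  also have "\<dots> \<le> (\<Sum>z\<in>S. \<bar>Q x z\<bar> * ?C ^ n)"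
    by (intro sum_mono mult_left_mono Suc.IH) auto
  also have "\<dots> = (\<Sum>z\<in>S. \<bar>Q x z\<bar>) * ?C ^ n"
    by (simp add: sum_distrib_right)
  also have "\<dots> \<le> ?C * ?C ^ n"
    using member_le_sum[OF Suc.prems, of "\<lambda>x. \<Sum>z\<in>S. \<bar>Q x z\<bar>"] assms(1)
    by (intro mult_right_mono) (auto intro!: sum_nonneg zero_le_power)
  finally show ?case by simp
qed

lemma exp_series_summable:
  assumes "finite S" "x \<in> S"
  shows "summable (\<lambda>n. t ^ n / fact n * matrix_power_on S Q n x y)"
proof (rule summable_comparison_test')
  let ?C = "\<Sum>x\<in>S. \<Sum>z\<in>S. \<bar>Q x z\<bar>"
  show "summable (\<lambda>n. (\<bar>t\<bar> * ?C) ^ n /\<^sub>R fact n)"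
    by (rule summable_exp_generic)
  fix n :: nat assume "0 \<le> n"
  have "\<bar>t\<bar> ^ n / fact n * \<bar>matrix_power_on S Q n x y\<bar> \<le> \<bar>t\<bar> ^ n / fact n * ?C ^ n"
    by (intro mult_left_mono matrix_power_on_bound[OF assms]) auto
  then show "norm (t ^ n / fact n * matrix_power_on S Q n x y) \<le> (\<bar>t\<bar> * ?C) ^ n /\<^sub>R fact n"
    by (simp add: abs_mult power_abs power_mult_distrib divide_inverse mult_ac)
qed

text \<open>The row vector \<open>p P\<^sub>t\<close> is a power series in \<open>t\<close> whose linear coefficient is \<open>p Q\<close> and whose higher
  coefficients are images of \<open>p Q\<close>.  If the series is constant for \<open>t \<ge> 0\<close>, its derivative at \<open>0\<close>
  vanishes; conversely \<open>p Q = 0\<close> removes every term but the first.\<close>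

lemma stationary_iff_null_vector:
  assumes "finite S"
  shows "is_stationary S r p \<longleftrightarrow>
    set_pmf p \<subseteq> S \<and> (\<forall>y\<in>S. (\<Sum>x\<in>S. pmf p x * generator S r x y) = 0)"
proof -
  define Q where "Q = generator S r"
  define v where "v n y = (\<Sum>x\<in>S. pmf p x * matrix_power_on S Q n x y)" for n y
  have v0: "v 0 y = pmf p y" if "y \<in> S" for y
  proof -
    have "v 0 y = (\<Sum>x\<in>S. if x = y then pmf p x else 0)"
      unfolding v_def by (intro sum.cong) auto
    then show ?thesis using that assms by simp
  qed
  have v1: "v 1 y = (\<Sum>x\<in>S. pmf p x * generator S r x y)" if "y \<in> S" for y
  proof -
    have "matrix_power_on S Q 1 x y = Q x y" for x
    proof -
      have "matrix_power_on S Q 1 x y = (\<Sum>z\<in>S. if z = y then Q x z else 0)"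
        by (auto intro!: sum.cong)
      then show ?thesis using that assms by simp
    qed
    then show ?thesis unfolding v_def Q_def by simp
  qed
  have series: "(\<lambda>n. t ^ n / fact n * v n y) sums (\<Sum>x\<in>S. pmf p x * transition_prob S r t x y)" for t y
  proof -
    have "(\<lambda>n. pmf p x * (t ^ n / fact n * matrix_power_on S Q n x y)) sums
          (pmf p x * transition_prob S r t x y)" if "x \<in> S" for x
      unfolding transition_prob_def Q_def
      by (intro sums_mult summable_sums exp_series_summable assms that)
    then have "(\<lambda>n. \<Sum>x\<in>S. pmf p x * (t ^ n / fact n * matrix_power_on S Q n x y)) sums
          (\<Sum>x\<in>S. pmf p x * transition_prob S r t x y)"
      by (rule sums_sum)
    then show ?thesis unfolding v_def
      by (simp add: sum_distrib_left mult_ac)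
  qed
  have "(\<forall>t\<ge>0. (\<Sum>x\<in>S. pmf p x * transition_prob S r t x y) = pmf p y) \<Longrightarrow> v 1 y = 0"
    if y: "y \<in> S" for y
  proof -
    assume const: "\<forall>t\<ge>0. (\<Sum>x\<in>S. pmf p x * transition_prob S r t x y) = pmf p y"
    define c where "c n = v n y / fact n" for n
    define g where "g t = (\<Sum>n. c n * t ^ n)" for t
    have ser: "(\<lambda>n. c n * t ^ n) sums (\<Sum>x\<in>S. pmf p x * transition_prob S r t x y)" for t
      using series[of t y] by (simp add: c_def mult_ac)
    have g: "g t = (\<Sum>x\<in>S. pmf p x * transition_prob S r t x y)" for t
      unfolding g_def using ser by (rule sums_unique[symmetric])
    have "(g has_field_derivative (\<Sum>n. diffs c n * 0 ^ n)) (at 0)"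
      unfolding g_def using ser sums_summable by (intro termdiffs_strong_converges_everywhere) blast
    then have "(g has_field_derivative c 1) (at 0)"
      by (simp add: diffs_def)
    then have lim: "((\<lambda>h. (g (0 + h) - g 0) / h) \<longlongrightarrow> c 1) (at 0)"
      by (simp add: DERIV_def)
    \<comment> \<open>Along \<open>t = 1 / (n + 1) > 0\<close> the difference quotients at \<open>0\<close> are all zero.\<close>
    have "filterlim (\<lambda>n. 1 / real (Suc n)) (at 0) sequentially"
      unfolding filterlim_at using LIMSEQ_inverse_real_of_nat
      by (auto simp: inverse_eq_divide)
    from filterlim_compose[OF lim this]
    have "(\<lambda>n. (g (0 + 1 / real (Suc n)) - g 0) / (1 / real (Suc n))) \<longlonglongrightarrow> c 1" .
    then have "(\<lambda>n::nat. 0) \<longlonglongrightarrow> c 1"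
      using const g by simp
    then show "v 1 y = 0"
      using LIMSEQ_unique[OF _ tendsto_const] by (fastforce simp: c_def)
  qed
  moreover have "(\<Sum>x\<in>S. pmf p x * transition_prob S r t x y) = pmf p y"
    if "\<forall>z\<in>S. v 1 z = 0" and y: "y \<in> S" for t y
  proof -
    have "v (Suc n) y = 0" for n
    proof -
      have "v (Suc n) y = (\<Sum>x\<in>S. \<Sum>z\<in>S. pmf p x * Q x z * matrix_power_on S Q n z y)"
        by (simp add: v_def sum_distrib_left mult_ac)
      also have "\<dots> = (\<Sum>z\<in>S. (\<Sum>x\<in>S. pmf p x * Q x z) * matrix_power_on S Q n z y)"
        by (subst sum.swap) (simp add: sum_distrib_right)
      also have "\<dots> = 0"
        using that(1) v1 by (intro sum.neutral) (auto simp: Q_def)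
      finally show ?thesis .
    qed
    then have "(\<lambda>n. t ^ n / fact n * v n y) = (\<lambda>n. if n = 0 then pmf p y else 0)"
      using v0[OF y] by (auto simp: fun_eq_iff gr0_conv_Suc)
    with series[of t y] have "(\<lambda>n. if n = 0 then pmf p y else 0) sums (\<Sum>x\<in>S. pmf p x * transition_prob S r t x y)"
      by simp
    then show ?thesis
      using sums_single[of 0 "\<lambda>_. pmf p y"] sums_unique2 by blast
  qed
  ultimately have "(\<forall>t\<ge>0. \<forall>y\<in>S. (\<Sum>x\<in>S. pmf p x * transition_prob S r t x y) = pmf p y)
      \<longleftrightarrow> (\<forall>y\<in>S. v 1 y = 0)"
    by blast
  also have "\<dots> \<longleftrightarrow> (\<forall>y\<in>S. (\<Sum>x\<in>S. pmf p x * generator S r x y) = 0)"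
    using v1 by simp
  finally show ?thesis
    unfolding is_stationary_def by simp
qed

lemma sum_generator:
  assumes "finite S" "y \<in> S"
  shows "(\<Sum>x\<in>S. v x * generator S r x y) =
    (\<Sum>x\<in>S - {y}. v x * r x y) - v y * (\<Sum>z\<in>S - {y}. r y z)"
proof -
  have "(\<Sum>x\<in>S. v x * generator S r x y)
      = v y * generator S r y y + (\<Sum>x\<in>S - {y}. v x * generator S r x y)"
    using assms by (simp add: sum.remove)
  also have "(\<Sum>x\<in>S - {y}. v x * generator S r x y) = (\<Sum>x\<in>S - {y}. v x * r x y)"
    by (intro sum.cong) (auto simp: generator_def)
  finally show ?thesis by (simp add: generator_def)
qed

text \<open>Subtract from \<open>p\<close> the largest multiple of \<open>f\<close> that leaves a nonnegative vector.  The difference is a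
  nonnegative null vector with a zero, and stationarity at a zero forces all states that can jump
  there to be zeros as well, so by irreducibility it vanishes identically.  Irreducibility is
  used in the form that a nonempty set of states closed under predecessors is everything.\<close>

lemma null_vector_proportional:
  fixes f p :: "'s \<Rightarrow> real"
  assumes S: "finite S" "S \<noteq> {}"
    and r: "\<And>x y. r x y \<ge> 0"
    and f: "\<And>x. x \<in> S \<Longrightarrow> f x > 0" "\<And>y. y \<in> S \<Longrightarrow> (\<Sum>x\<in>S. f x * generator S r x y) = 0"
    and p: "\<And>y. y \<in> S \<Longrightarrow> (\<Sum>x\<in>S. p x * generator S r x y) = 0"
    and irreducible: "\<And>A. A \<subseteq> S \<Longrightarrow> A \<noteq> {} \<Longrightarrow> (\<And>x y. y \<in> A \<Longrightarrow> x \<in> S \<Longrightarrow> r x y > 0 \<Longrightarrow> x \<in> A) \<Longrightarrow> A = S"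
  obtains c where "\<And>x. x \<in> S \<Longrightarrow> p x = c * f x"
proof -
  define c where "c = Min ((\<lambda>x. p x / f x) ` S)"
  define v where "v x = p x - c * f x" for x
  have c_le: "c \<le> p x / f x" if "x \<in> S" for x
    unfolding c_def using S that by (intro Min_le) auto
  have v_nonneg: "v x \<ge> 0" if "x \<in> S" for x
    using c_le[OF that] f(1)[OF that] by (simp add: v_def pos_le_divide_eq)
  have v_null: "(\<Sum>x\<in>S. v x * generator S r x y) = 0" if "y \<in> S" for y
  proof -
    have "(\<Sum>x\<in>S. v x * generator S r x y)
       = (\<Sum>x\<in>S. p x * generator S r x y) - c * (\<Sum>x\<in>S. f x * generator S r x y)"
      by (simp add: v_def algebra_simps sum_subtractf sum_distrib_left)
    then show ?thesis using f(2) p that by simp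
  qed
  have "c \<in> (\<lambda>x. p x / f x) ` S"
    unfolding c_def using S by (intro Min_in) auto
  then obtain x0 where x0: "x0 \<in> S" "c = p x0 / f x0" by auto
  then have "v x0 = 0" using f(1)[of x0] by (simp add: v_def)
  have "{x\<in>S. v x = 0} = S"
  proof (rule irreducible)
    show "{x\<in>S. v x = 0} \<noteq> {}" using x0 \<open>v x0 = 0\<close> by auto
    fix x y assume y: "y \<in> {x\<in>S. v x = 0}" and x: "x \<in> S" and rxy: "r x y > 0"
    show "x \<in> {x\<in>S. v x = 0}"
    proof (cases "x = y")
      case False
      have "(\<Sum>x\<in>S - {y}. v x * r x y) = 0"
        using v_null[of y] y S by (simp add: sum_generator)
      then have "v x * r x y = 0"
        using x False S v_nonneg r by (subst (asm) sum_nonneg_eq_0_iff) auto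
      then show ?thesis using rxy x by simp
    qed (use y in auto)
  qed auto
  then have "p x = c * f x" if "x \<in> S" for x
    using that by (auto simp: v_def)
  then show ?thesis using that by blast
qed

lemma pmf_stationary_pmf:
  fixes f :: "'s \<Rightarrow> real"
  assumes S: "finite S" "S \<noteq> {}"
    and r: "\<And>x y. r x y \<ge> 0"
    and f: "\<And>x. x \<in> S \<Longrightarrow> f x > 0" "\<And>y. y \<in> S \<Longrightarrow> (\<Sum>x\<in>S. f x * generator S r x y) = 0"
    and irreducible: "\<And>A. A \<subseteq> S \<Longrightarrow> A \<noteq> {} \<Longrightarrow> (\<And>x y. y \<in> A \<Longrightarrow> x \<in> S \<Longrightarrow> r x y > 0 \<Longrightarrow> x \<in> A) \<Longrightarrow> A = S"
  shows "pmf (stationary_pmf S r) x = (if x \<in> S then f x / sum f S else 0)"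
proof -
  define \<phi> where "\<phi> x = (if x \<in> S then f x / sum f S else 0)" for x
  have Z: "sum f S > 0" using S f(1) by (intro sum_pos) auto
  have \<phi>_nonneg: "\<phi> x \<ge> 0" for x using Z f(1)[of x] by (auto simp: \<phi>_def less_imp_le)
  have sum\<phi>: "sum \<phi> S = 1"
    using Z by (simp add: \<phi>_def flip: sum_divide_distrib)
  have "(\<integral>\<^sup>+x. ennreal (\<phi> x) \<partial>count_space UNIV) = (\<integral>\<^sup>+x. ennreal (\<phi> x) * indicator S x \<partial>count_space UNIV)"
    by (intro nn_integral_cong) (auto simp: \<phi>_def)
  also have "\<dots> = (\<Sum>x\<in>S. ennreal (\<phi> x))"
    using S by (simp add: nn_integral_count_space_indicator[symmetric] nn_integral_count_space_finite)
  also have "\<dots> = 1"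
    using sum\<phi> \<phi>_nonneg by (simp add: sum_ennreal)
  finally have int: "(\<integral>\<^sup>+x. ennreal (\<phi> x) \<partial>count_space UNIV) = 1" .
  define P where "P = embed_pmf \<phi>"
  have P: "pmf P x = \<phi> x" for x
    unfolding P_def by (rule pmf_embed_pmf[OF \<phi>_nonneg int])
  have "is_stationary S r P"
  proof (subst stationary_iff_null_vector[OF S(1)], intro conjI ballI)
    show "set_pmf P \<subseteq> S" by (auto simp: set_pmf_eq P \<phi>_def)
    fix y assume "y \<in> S"
    have "(\<Sum>x\<in>S. pmf P x * generator S r x y) = (\<Sum>x\<in>S. f x * generator S r x y) / sum f S"
      by (simp add: P \<phi>_def sum_divide_distrib)
    then show "(\<Sum>x\<in>S. pmf P x * generator S r x y) = 0" using f(2) \<open>y \<in> S\<close> by simp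
  qed
  moreover have "q = P" if "is_stationary S r q" for q
  proof (rule pmf_eqI)
    fix x
    have q: "set_pmf q \<subseteq> S" "\<And>y. y \<in> S \<Longrightarrow> (\<Sum>x\<in>S. pmf q x * generator S r x y) = 0"
      using that stationary_iff_null_vector[OF S(1)] by blast+
    obtain c where c: "\<And>x. x \<in> S \<Longrightarrow> pmf q x = c * f x"
      using null_vector_proportional[OF S r f q(2) irreducible] by blast
    have "1 = sum (pmf q) S" using q(1) S by (simp add: sum_pmf_eq_1)
    also have "\<dots> = c * sum f S" by (simp add: c sum_distrib_left)
    finally have "c = 1 / sum f S" using Z by (simp add: field_simps)
    then show "pmf q x = pmf P x"
      using c q(1) by (auto simp: P \<phi>_def pmf_eq_0_set_pmf)
  qed
  ultimately have "stationary_pmf S r = P"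
    unfolding stationary_pmf_def by (rule the_equality)
  then show ?thesis by (simp add: P \<phi>_def)
qed

section \<open>The two-layer weights\<close>

text \<open>The minimum, including the starting point \<open>0\<close>, of the walk with the given steps.\<close>

fun path_min :: "real list \<Rightarrow> real" where
  "path_min [] = 0"
| "path_min (d # ds) = min 0 (d + path_min ds)"

text \<open>The weight of a pair of layers depends on the walk of their differences only.\<close>

definition path_weight :: "real \<Rightarrow> real \<Rightarrow> real list \<Rightarrow> real" where
  "path_weight a b ds = (a * b) powr (- path_min ds) * b powr sum_list ds"

text \<open>Sum of \<open>F\<close> over all bottom layers below the top layer \<open>ts\<close>, where \<open>F\<close> receives the list of
  differences.  Recursion over lists allows sites to be inserted and deleted freely.\<close>

fun layer_sum :: "nat list \<Rightarrow> (real list \<Rightarrow> real) \<Rightarrow> real" where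
  "layer_sum [] F = F []"
| "layer_sum (t # ts) F =
     layer_sum ts (\<lambda>ds. F (real t # ds)) + layer_sum ts (\<lambda>ds. F ((real t - 1) # ds))"

definition top_weight :: "real \<Rightarrow> real \<Rightarrow> nat list \<Rightarrow> real" where
  "top_weight a b ts = layer_sum ts (path_weight a b)"

lemma layer_sum_append:
  "layer_sum (xs @ ys) F = layer_sum xs (\<lambda>ds. layer_sum ys (\<lambda>es. F (ds @ es)))"
  by (induction xs arbitrary: F) auto

lemma layer_sum_add: "layer_sum xs (\<lambda>ds. F ds + G ds) = layer_sum xs F + layer_sum xs G"
  by (induction xs arbitrary: F G) auto

lemma layer_sum_cmult: "layer_sum xs (\<lambda>ds. c * F ds) = c * layer_sum xs F"
  by (induction xs arbitrary: F) (auto simp: distrib_left)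

lemma layer_sum_pos: "(\<And>ds. F ds > 0) \<Longrightarrow> layer_sum xs F > 0"
  by (induction xs arbitrary: F) (auto intro: add_pos_pos)

lemma path_min_nonpos: "path_min ds \<le> 0"
  by (cases ds) auto

lemma path_min_snoc: "d \<ge> 0 \<Longrightarrow> path_min (ds @ [d]) = path_min ds"
  by (induction ds) auto

lemma path_min_append_cong: "path_min es = path_min es' \<Longrightarrow> path_min (ds @ es) = path_min (ds @ es')"
  by (induction ds) auto

context
  fixes a b :: real
  assumes a: "a > 0" and b: "b > 0"
begin

lemma top_weight_pos: "top_weight a b ts > 0"
  unfolding top_weight_def path_weight_def using a b by (intro layer_sum_pos) auto

text \<open>Below a leading hole, an empty site leaves the walk unchanged.  A particle lowers its
  minimum and its end point by one, which multiplies the weight by \<open>ab / b = a\<close>.\<close>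

lemma top_weight_Cons_0: "top_weight a b (0 # ts) = (1 + a) * top_weight a b ts"
proof -
  have "path_weight a b (0 # ds) = path_weight a b ds" for ds
    using path_min_nonpos[of ds] by (simp add: path_weight_def)
  moreover have "path_weight a b (- 1 # ds) = a * path_weight a b ds" for ds
  proof -
    have "path_min (- 1 # ds) = path_min ds - 1" using path_min_nonpos[of ds] by simp
    then show ?thesis
      using a b by (simp add: path_weight_def powr_diff powr_add powr_minus field_simps)
  qed
  ultimately show ?thesis
    by (simp add: top_weight_def layer_sum_cmult algebra_simps)
qed

text \<open>Below a final particle, a particle leaves the walk unchanged.  An empty site raises
  the end point by one without affecting the minimum, which multiplies the weight by \<open>b\<close>.\<close>

lemma top_weight_snoc_1: "top_weight a b (ts @ [1]) = (1 + b) * top_weight a b ts"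
proof -
  have "path_weight a b (ds @ [0]) = path_weight a b ds" for ds
    by (simp add: path_weight_def path_min_snoc)
  moreover have "path_weight a b (ds @ [1]) = b * path_weight a b ds" for ds
    using b by (simp add: path_weight_def path_min_snoc powr_add)
  ultimately show ?thesis
    by (simp add: top_weight_def layer_sum_append layer_sum_add layer_sum_cmult algebra_simps)
qed

text \<open>The four bottom layers below a particle and a hole give the step pairs \<open>(1, 0)\<close>, \<open>(0, -1)\<close>,
  \<open>(0, 0)\<close> and \<open>(1, -1)\<close>.  The last one returns to its starting level from above, so it can be
  replaced by a single step \<open>0\<close> without changing the minimum.  After contraction the four pairs
  become the single steps \<open>1\<close> and \<open>0\<close> below a particle and \<open>0\<close> and \<open>-1\<close> below a hole.\<close>

lemma top_weight_exchange:
  "top_weight a b (xs @ 1 # 0 # ys) = top_weight a b (xs @ 1 # ys) + top_weight a b (xs @ 0 # ys)"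
proof -
  have w: "path_weight a b (ds @ es) = path_weight a b (ds @ es')"
    if "path_min es = path_min es'" "sum_list es = sum_list es'" for ds es es'
    using that path_min_append_cong[of es es' ds] by (simp add: path_weight_def)
  have min_es: "min 0 (path_min es) = path_min es"
    "min 0 (1 + min 0 (path_min es - 1)) = path_min es" for es
    using path_min_nonpos[of es] by auto
  have "path_weight a b (ds @ 1 # 0 # es) = path_weight a b (ds @ 1 # es)"
    "path_weight a b (ds @ 1 # (- 1) # es) = path_weight a b (ds @ 0 # es)"
    "path_weight a b (ds @ 0 # 0 # es) = path_weight a b (ds @ 0 # es)"
    "path_weight a b (ds @ 0 # (- 1) # es) = path_weight a b (ds @ (- 1) # es)" for ds es
    using min_es by (auto intro!: w)
  then show ?thesis
    by (simp add: top_weight_def layer_sum_append layer_sum_add layer_sum_cmult algebra_simps)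
qed

end

section \<open>The stationary distribution of the open TASEP\<close>

lemma finite_configs: "finite (configs N)"
  unfolding configs_def by (intro finite_PiE) auto

lemma configs_nonempty: "configs N \<noteq> {}"
  by (simp add: configs_def PiE_eq_empty_iff)

lemma configs_01: "\<tau> \<in> configs N \<Longrightarrow> j \<in> {1..N} \<Longrightarrow> \<tau> j = 0 \<or> \<tau> j = 1"
  using PiE_mem[of \<tau> "{1..N}" "\<lambda>_. {0, 1}" j] by (simp add: configs_def)

lemma configs_upd: "\<tau> \<in> configs N \<Longrightarrow> j \<in> {1..N} \<Longrightarrow> t = 0 \<or> t = 1 \<Longrightarrow> \<tau>(j := t) \<in> configs N"
  unfolding configs_def by (auto simp: PiE_iff extensional_def)

lemma sum_configs_Suc:
  "(\<Sum>\<sigma>\<in>configs (Suc N). G \<sigma>) = (\<Sum>\<sigma>\<in>configs N. G (\<sigma>(Suc N := 0)) + G (\<sigma>(Suc N := 1)))"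
proof -
  have eq: "{1..Suc N} = insert (Suc N) {1..N}" by auto
  have "(\<Sum>\<sigma>\<in>configs (Suc N). G \<sigma>)
      = (\<Sum>(t, \<sigma>)\<in>{0, 1} \<times> configs N. G (\<sigma>(Suc N := t)))"
    unfolding configs_def eq PiE_insert_eq
    by (subst sum.reindex[OF inj_combinator]) (auto simp: case_prod_unfold)
  also have "\<dots> = (\<Sum>\<sigma>\<in>configs N. \<Sum>t\<in>{0, 1}. G (\<sigma>(Suc N := t)))"
    by (subst sum.swap) (simp add: sum.cartesian_product)
  finally show ?thesis by simp
qed

lemma configs_0: "configs 0 = {\<lambda>_. undefined}"
  by (simp add: configs_def)

text \<open>The bridge from lists, on which sites can be deleted, to configurations, which are functions on
  \<open>{1..N}\<close>.\<close>

lemma layer_sum_configs: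
  "layer_sum (map \<tau> [1..<Suc N]) F =
     (\<Sum>\<sigma>\<in>configs N. F (map (\<lambda>j. real (\<tau> j) - real (\<sigma> j)) [1..<Suc N]))"
proof (induction N arbitrary: F)
  case 0
  then show ?case by (simp add: configs_0)
next
  case (Suc N)
  have upd: "map (\<lambda>j. real (\<tau> j) - real ((\<sigma>(Suc N := t)) j)) [1..<Suc (Suc N)]
      = map (\<lambda>j. real (\<tau> j) - real (\<sigma> j)) [1..<Suc N] @ [real (\<tau> (Suc N)) - real t]" for \<sigma> t
  proof -
    have "map (\<lambda>j. real (\<tau> j) - real ((\<sigma>(Suc N := t)) j)) [1..<Suc N]
      = map (\<lambda>j. real (\<tau> j) - real (\<sigma> j)) [1..<Suc N]"
      by (intro map_cong) auto
    then show ?thesis by (subst upt_Suc_append) (auto simp del: upt_Suc)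
  qed
  have "layer_sum (map \<tau> [1..<Suc (Suc N)]) F
    = layer_sum (map \<tau> [1..<Suc N] @ [\<tau> (Suc N)]) F" by simp
  also have "\<dots> = layer_sum (map \<tau> [1..<Suc N])
      (\<lambda>ds. F (ds @ [real (\<tau> (Suc N)) - 0]) + F (ds @ [real (\<tau> (Suc N)) - 1]))"
    unfolding layer_sum_append by simp
  also have "\<dots> = (\<Sum>\<sigma>\<in>configs (Suc N). F (map (\<lambda>j. real (\<tau> j) - real (\<sigma> j)) [1..<Suc (Suc N)]))"
    unfolding Suc.IH sum_configs_Suc upd by simp
  finally show ?case .
qed

lemma weighted_sum_upd:
  fixes c :: "nat \<Rightarrow> int"
  assumes "j \<in> {1..N}"
  shows "(\<Sum>i=1..N. c i * int ((y(j := t)) i)) = (\<Sum>i=1..N. c i * int (y i)) + c j * (int t - int (y j))"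
proof -
  have "(\<Sum>i=1..N. c i * int ((y(j := t)) i)) = c j * int t + (\<Sum>i\<in>{1..N} - {j}. c i * int (y i))"
    using assms by (subst sum.remove[of _ j]) (auto intro!: sum.cong)
  moreover have "(\<Sum>i=1..N. c i * int (y i)) = c j * int (y j) + (\<Sum>i\<in>{1..N} - {j}. c i * int (y i))"
    using assms by (subst sum.remove[of _ j]) auto
  ultimately show ?thesis by (simp add: algebra_simps)
qed

lemma maximal_element:
  fixes \<Phi> :: "'x \<Rightarrow> int"
  assumes "finite A" "A \<noteq> {}"
  obtains y where "y \<in> A" "\<And>z. z \<in> A \<Longrightarrow> \<Phi> z \<le> \<Phi> y"
proof -
  have "Max (\<Phi> ` A) \<in> \<Phi> ` A" using assms by (intro Max_in) auto
  then obtain y where "y \<in> A" "\<Phi> y = Max (\<Phi> ` A)" by auto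
  then show ?thesis using that[of y] assms by auto
qed

context
  fixes \<alpha> \<beta> :: real
  assumes \<alpha>: "\<alpha> > 0" and \<beta>: "\<beta> > 0"
begin

lemma tasep_rate_nonneg: "tasep_rate \<alpha> \<beta> N \<tau> \<sigma> \<ge> 0"
  unfolding tasep_rate_def using \<alpha> \<beta> by (auto intro!: add_nonneg_nonneg sum_nonneg)

lemma tasep_rate_bulk_pos:
  assumes "j \<in> {1..<N}" "\<tau> j = 1" "\<tau> (j + 1) = 0"
  shows "tasep_rate \<alpha> \<beta> N \<tau> (\<tau>(j := 0, j + 1 := 1)) > 0"
  unfolding tasep_rate_def using assms \<alpha> \<beta>
  by (intro add_pos_nonneg sum_pos2[of _ j]) auto

lemma tasep_rate_in_pos:
  assumes "\<tau> 1 = 0"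
  shows "tasep_rate \<alpha> \<beta> N \<tau> (\<tau>(1 := 1)) > 0"
  unfolding tasep_rate_def using assms \<alpha> \<beta>
  by (intro add_pos_nonneg add_nonneg_pos sum_nonneg) auto

lemma tasep_rate_out_pos:
  assumes "\<tau> N = 1"
  shows "tasep_rate \<alpha> \<beta> N \<tau> (\<tau>(N := 0)) > 0"
  unfolding tasep_rate_def using assms \<alpha> \<beta>
  by (intro add_nonneg_pos add_nonneg_nonneg sum_nonneg) auto

text \<open>Every configuration can be filled up by insertions and jumps to the right, and the full
  configuration can be turned into any other one by jumps and removals.  Both processes
  are monotone in a weighted particle number: a configuration of \<open>A\<close> that maximises \<open>\<Phi>\<close> must be
  full, and a configuration outside \<open>A\<close> that maximises \<open>\<Psi>\<close> would have to be full as well.\<close>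

lemma tasep_irreducible:
  assumes N: "N \<ge> 1" and A: "A \<subseteq> configs N" "A \<noteq> {}"
    and closed: "\<And>x y. y \<in> A \<Longrightarrow> x \<in> configs N \<Longrightarrow> tasep_rate \<alpha> \<beta> N x y > 0 \<Longrightarrow> x \<in> A"
  shows "A = configs N"
proof -
  have fin: "finite A" using A finite_configs finite_subset by blast
  define full where "full = (\<lambda>i\<in>{1..N}. 1::nat)"
  have not_full: "\<exists>i\<in>{1..N}. y i = 0" if "y \<in> configs N" "y \<noteq> full" for y
  proof (rule ccontr)
    assume "\<not> ?thesis"
    then have "y i = 1" if "i \<in> {1..N}" for i
      using configs_01[OF \<open>y \<in> configs N\<close> that] that by blast
    then have "y = full" using \<open>y \<in> configs N\<close>
      by (auto simp: full_def configs_def fun_eq_iff PiE_iff extensional_def)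
    then show False using that by simp
  qed
  define \<Phi> where "\<Phi> y = (\<Sum>i=1..N. (int N + 1 - int i) * int (y i))" for y :: "nat \<Rightarrow> nat"
  define \<Psi> where "\<Psi> y = (\<Sum>i=1..N. int i * int (y i))" for y :: "nat \<Rightarrow> nat"
  obtain y where y: "y \<in> A" and max: "\<And>z. z \<in> A \<Longrightarrow> \<Phi> z \<le> \<Phi> y"
    using maximal_element[OF fin A(2)] by blast
  have yC: "y \<in> configs N" using y A by blast
  have "full \<in> A"
  proof (cases "y = full")
    case False
    have "y N = 1"
    proof (rule ccontr)
      assume "y N \<noteq> 1"
      then have yN: "y N = 0" using configs_01[OF yC, of N] N by auto
      let ?x = "y(N := 1)"
      have "?x \<in> configs N" using yC N by (intro configs_upd) auto
      moreover have "tasep_rate \<alpha> \<beta> N ?x y > 0"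
        using tasep_rate_out_pos[of ?x N] yN by (simp add: fun_upd_idem)
      ultimately have "\<Phi> ?x \<le> \<Phi> y" using closed y max by blast
      then show False
        using N yN unfolding \<Phi>_def by (subst (asm) weighted_sum_upd) auto
    qed
    define j where "j = Max {i\<in>{1..N}. y i = 0}"
    have "j \<in> {i\<in>{1..N}. y i = 0}"
      unfolding j_def using not_full[OF yC False] by (intro Max_in) auto
    then have j: "j \<in> {1..N}" "y j = 0" by auto
    then have "j \<noteq> N" using \<open>y N = 1\<close> by auto
    then have jN: "j \<in> {1..<N}" using j by auto
    have "y (j + 1) \<noteq> 0"
    proof
      assume "y (j + 1) = 0"
      then have "j + 1 \<in> {i\<in>{1..N}. y i = 0}" using jN by auto
      then have "j + 1 \<le> Max {i\<in>{1..N}. y i = 0}" by (intro Max_ge) simp_all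
      then show False using j_def by linarith
    qed
    then have j1: "y (j + 1) = 1" using configs_01[OF yC, of "j + 1"] jN by auto
    let ?x = "y(j := 1, j + 1 := 0)"
    have "?x \<in> configs N" using yC jN by (intro configs_upd) auto
    moreover have "tasep_rate \<alpha> \<beta> N ?x y > 0"
    proof -
      have "?x(j := 0, j + 1 := 1) = y" using j j1 by (auto simp: fun_eq_iff)
      then show ?thesis using tasep_rate_bulk_pos[of j N ?x] jN by simp
    qed
    ultimately have "\<Phi> ?x \<le> \<Phi> y" using closed y max by blast
    moreover have "\<Phi> ?x = \<Phi> (y(j := 1)) + (int N + 1 - int (j + 1)) * (int 0 - int ((y(j := 1)) (j + 1)))"
      unfolding \<Phi>_def using jN by (intro weighted_sum_upd) auto
    moreover have "\<Phi> (y(j := 1)) = \<Phi> y + (int N + 1 - int j) * (int 1 - int (y j))"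
      unfolding \<Phi>_def using jN by (intro weighted_sum_upd) auto
    ultimately show ?thesis using j j1 by simp
  qed (use y in simp)
  show ?thesis
  proof (rule ccontr)
    assume "A \<noteq> configs N"
    then have "configs N - A \<noteq> {}" "finite (configs N - A)" using A finite_configs by auto
    then obtain x where x: "x \<in> configs N - A" and max: "\<And>z. z \<in> configs N - A \<Longrightarrow> \<Psi> z \<le> \<Psi> x"
      using maximal_element by metis
    have xC: "x \<in> configs N" and "x \<noteq> full" using x \<open>full \<in> A\<close> by auto
    have step: "\<Psi> z \<le> \<Psi> x" if "z \<in> configs N" "tasep_rate \<alpha> \<beta> N x z > 0" for z
      using max[of z] closed[of z x] x that by blast
    have "x 1 = 1"
    proof (rule ccontr)
      assume "x 1 \<noteq> 1"
      then have x1: "x 1 = 0" using configs_01[OF xC, of 1] N by auto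
      have "\<Psi> (x(1 := 1)) \<le> \<Psi> x"
        using x1 xC N by (intro step tasep_rate_in_pos configs_upd) auto
      moreover have "\<Psi> (x(1 := 1)) = \<Psi> x + int 1 * (int 1 - int (x 1))"
        unfolding \<Psi>_def using N by (intro weighted_sum_upd) auto
      ultimately show False using x1 by simp
    qed
    define k where "k = Min {i\<in>{1..N}. x i = 0}"
    have "k \<in> {i\<in>{1..N}. x i = 0}"
      unfolding k_def using not_full[OF xC \<open>x \<noteq> full\<close>] by (intro Min_in) auto
    then have k: "k \<in> {1..N}" "x k = 0" by auto
    then have "k \<noteq> 1" using \<open>x 1 = 1\<close> by auto
    then obtain j where kj: "k = j + 1" and j: "j \<in> {1..<N}"
      using k by (cases k) auto
    have "x j \<noteq> 0"
    proof
      assume "x j = 0"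
      then have "j \<in> {i\<in>{1..N}. x i = 0}" using j by auto
      then have "Min {i\<in>{1..N}. x i = 0} \<le> j" by (intro Min_le) simp_all
      then show False using k_def kj by linarith
    qed
    then have xj: "x j = 1" using configs_01[OF xC, of j] j by auto
    let ?z = "x(j := 0, j + 1 := 1)"
    have "\<Psi> ?z \<le> \<Psi> x"
      using xC xj k j unfolding kj by (intro step tasep_rate_bulk_pos configs_upd) auto
    moreover have "\<Psi> ?z = \<Psi> (x(j := 0)) + int (j + 1) * (int 1 - int ((x(j := 0)) (j + 1)))"
      unfolding \<Psi>_def using j by (intro weighted_sum_upd) auto
    moreover have "\<Psi> (x(j := 0)) = \<Psi> x + int j * (int 0 - int (x j))"
      unfolding \<Psi>_def using j by (intro weighted_sum_upd) auto
    ultimately show False using xj k kj by simp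
  qed
qed

text \<open>A transition into \<open>\<tau>\<close> is determined by the move that made it, since each move can be undone, so
  every sum over predecessors has at most one nonzero term.\<close>

lemma sum_tasep_influx:
  assumes \<tau>: "\<tau> \<in> configs N" and N: "N \<ge> 1"
  shows "(\<Sum>\<sigma>\<in>configs N. f \<sigma> * tasep_rate \<alpha> \<beta> N \<sigma> \<tau>) =
    (\<Sum>j\<in>{1..<N}. if \<tau> j = 0 \<and> \<tau> (j + 1) = 1 then f (\<tau>(j := 1, j + 1 := 0)) else 0)
    + (if \<tau> 1 = 1 then \<alpha> * f (\<tau>(1 := 0)) else 0)
    + (if \<tau> N = 0 then \<beta> * f (\<tau>(N := 1)) else 0)"
proof -
  have bulk: "(\<Sum>\<sigma>\<in>configs N. f \<sigma> * (if \<sigma> j = 1 \<and> \<sigma> (j + 1) = 0 \<and> \<tau> = \<sigma>(j := 0, j + 1 := 1) then 1 else 0))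
     = (if \<tau> j = 0 \<and> \<tau> (j + 1) = 1 then f (\<tau>(j := 1, j + 1 := 0)) else 0)" if "j \<in> {1..<N}" for j
  proof -
    have e: "\<sigma> j = 1 \<and> \<sigma> (j + 1) = 0 \<and> \<tau> = \<sigma>(j := 0, j + 1 := 1)
       \<longleftrightarrow> \<sigma> = \<tau>(j := 1, j + 1 := 0) \<and> \<tau> j = 0 \<and> \<tau> (j + 1) = 1" for \<sigma>
    proof (intro iffI; elim conjE)
      assume "\<sigma> j = 1" "\<sigma> (j + 1) = 0" and eq: "\<tau> = \<sigma>(j := 0, j + 1 := 1)"
      then show "\<sigma> = \<tau>(j := 1, j + 1 := 0) \<and> \<tau> j = 0 \<and> \<tau> (j + 1) = 1"
        unfolding eq by (simp add: fun_eq_iff)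
    next
      assume "\<tau> j = 0" "\<tau> (j + 1) = 1" and eq: "\<sigma> = \<tau>(j := 1, j + 1 := 0)"
      then show "\<sigma> j = 1 \<and> \<sigma> (j + 1) = 0 \<and> \<tau> = \<sigma>(j := 0, j + 1 := 1)"
        unfolding eq by (simp add: fun_eq_iff)
    qed
    have "(\<Sum>\<sigma>\<in>configs N. f \<sigma> * (if \<sigma> j = 1 \<and> \<sigma> (j + 1) = 0 \<and> \<tau> = \<sigma>(j := 0, j + 1 := 1) then 1 else 0))
      = (\<Sum>\<sigma>\<in>configs N. if \<sigma> = \<tau>(j := 1, j + 1 := 0) then (if \<tau> j = 0 \<and> \<tau> (j + 1) = 1 then f \<sigma> else 0) else 0)"
      unfolding e by (intro sum.cong) (auto simp del: fun_upd_apply)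
    also have "\<dots> = (if \<tau> j = 0 \<and> \<tau> (j + 1) = 1 then f (\<tau>(j := 1, j + 1 := 0)) else 0)"
      using configs_upd[OF configs_upd[OF \<tau>, of j 1], of "j + 1" 0] that
      by (subst sum.delta) (auto simp: finite_configs)
    finally show ?thesis .
  qed
  have edge: "(\<Sum>\<sigma>\<in>configs N. f \<sigma> * (if \<sigma> j = s \<and> \<tau> = \<sigma>(j := t) then c else 0))
     = (if \<tau> j = t then c * f (\<tau>(j := s)) else 0)"
    if "j \<in> {1..N}" and "s = 0 \<or> s = 1" for j s t and c :: real
  proof -
    have e: "\<sigma> j = s \<and> \<tau> = \<sigma>(j := t) \<longleftrightarrow> \<sigma> = \<tau>(j := s) \<and> \<tau> j = t" for \<sigma>
    proof (intro iffI; elim conjE)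
      assume "\<sigma> j = s" and eq: "\<tau> = \<sigma>(j := t)"
      then show "\<sigma> = \<tau>(j := s) \<and> \<tau> j = t"
        unfolding eq by (simp add: fun_eq_iff)
    next
      assume "\<tau> j = t" and eq: "\<sigma> = \<tau>(j := s)"
      then show "\<sigma> j = s \<and> \<tau> = \<sigma>(j := t)"
        unfolding eq by (simp add: fun_eq_iff)
    qed
    have "(\<Sum>\<sigma>\<in>configs N. f \<sigma> * (if \<sigma> j = s \<and> \<tau> = \<sigma>(j := t) then c else 0))
      = (\<Sum>\<sigma>\<in>configs N. if \<sigma> = \<tau>(j := s) then (if \<tau> j = t then c * f \<sigma> else 0) else 0)"
      unfolding e by (intro sum.cong) (auto simp del: fun_upd_apply)
    also have "\<dots> = (if \<tau> j = t then c * f (\<tau>(j := s)) else 0)"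
      using configs_upd[OF \<tau>, of j s] that by (subst sum.delta) (auto simp: finite_configs)
    finally show ?thesis .
  qed
  have "(\<Sum>\<sigma>\<in>configs N. f \<sigma> * tasep_rate \<alpha> \<beta> N \<sigma> \<tau>) =
     (\<Sum>j\<in>{1..<N}. \<Sum>\<sigma>\<in>configs N. f \<sigma> * (if \<sigma> j = 1 \<and> \<sigma> (j + 1) = 0 \<and> \<tau> = \<sigma>(j := 0, j + 1 := 1) then 1 else 0))
     + (\<Sum>\<sigma>\<in>configs N. f \<sigma> * (if \<sigma> 1 = 0 \<and> \<tau> = \<sigma>(1 := 1) then \<alpha> else 0))
     + (\<Sum>\<sigma>\<in>configs N. f \<sigma> * (if \<sigma> N = 1 \<and> \<tau> = \<sigma>(N := 0) then \<beta> else 0))"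
    unfolding tasep_rate_def distrib_left sum.distrib sum_distrib_left
    by (subst sum.swap) (rule refl)
  also have "(\<Sum>j\<in>{1..<N}. \<Sum>\<sigma>\<in>configs N. f \<sigma> * (if \<sigma> j = 1 \<and> \<sigma> (j + 1) = 0 \<and> \<tau> = \<sigma>(j := 0, j + 1 := 1) then 1 else 0))
     = (\<Sum>j\<in>{1..<N}. if \<tau> j = 0 \<and> \<tau> (j + 1) = 1 then f (\<tau>(j := 1, j + 1 := 0)) else 0)"
    by (rule sum.cong[OF refl bulk])
  also have "(\<Sum>\<sigma>\<in>configs N. f \<sigma> * (if \<sigma> 1 = 0 \<and> \<tau> = \<sigma>(1 := 1) then \<alpha> else 0))
    = (if \<tau> 1 = 1 then \<alpha> * f (\<tau>(1 := 0)) else 0)"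
    using N by (intro edge) auto
  also have "(\<Sum>\<sigma>\<in>configs N. f \<sigma> * (if \<sigma> N = 1 \<and> \<tau> = \<sigma>(N := 0) then \<beta> else 0))
    = (if \<tau> N = 0 then \<beta> * f (\<tau>(N := 1)) else 0)"
    using N by (intro edge) auto
  finally show ?thesis .
qed

lemma sum_tasep_outflux:
  assumes \<tau>: "\<tau> \<in> configs N" and N: "N \<ge> 1"
  shows "(\<Sum>\<sigma>\<in>configs N. tasep_rate \<alpha> \<beta> N \<tau> \<sigma>) =
    (\<Sum>j\<in>{1..<N}. if \<tau> j = 1 \<and> \<tau> (j + 1) = 0 then 1 else 0)
    + (if \<tau> 1 = 0 then \<alpha> else 0) + (if \<tau> N = 1 then \<beta> else 0)"
proof -
  have point: "(\<Sum>\<sigma>\<in>configs N. if P \<and> \<sigma> = \<rho> then c else 0) = (if P then c else 0)"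
    if "\<rho> \<in> configs N" for P \<rho> and c :: real
    using that finite_configs[of N] by (cases P) auto
  have pt2: "(\<Sum>\<sigma>\<in>configs N. if P \<and> Q \<and> \<sigma> = \<rho> then c else 0) = (if P \<and> Q then c else 0)"
    if "\<rho> \<in> configs N" for P Q \<rho> and c :: real
    using point[OF that, of "P \<and> Q" c] by (simp add: conj_assoc)
  have "(\<Sum>\<sigma>\<in>configs N. tasep_rate \<alpha> \<beta> N \<tau> \<sigma>) =
     (\<Sum>j\<in>{1..<N}. \<Sum>\<sigma>\<in>configs N. if \<tau> j = 1 \<and> \<tau> (j + 1) = 0 \<and> \<sigma> = \<tau>(j := 0, j + 1 := 1) then 1 else 0)
     + (\<Sum>\<sigma>\<in>configs N. if \<tau> 1 = 0 \<and> \<sigma> = \<tau>(1 := 1) then \<alpha> else 0)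
     + (\<Sum>\<sigma>\<in>configs N. if \<tau> N = 1 \<and> \<sigma> = \<tau>(N := 0) then \<beta> else 0)"
    unfolding tasep_rate_def sum.distrib by (subst sum.swap) (rule refl)
  also have "(\<Sum>j\<in>{1..<N}. \<Sum>\<sigma>\<in>configs N. if \<tau> j = 1 \<and> \<tau> (j + 1) = 0 \<and> \<sigma> = \<tau>(j := 0, j + 1 := 1) then 1 else 0)
     = (\<Sum>j\<in>{1..<N}. if \<tau> j = 1 \<and> \<tau> (j + 1) = 0 then 1 else (0::real))"
    using configs_upd[OF \<tau>] by (intro sum.cong pt2 configs_upd \<tau>) auto
  also have "(\<Sum>\<sigma>\<in>configs N. if \<tau> 1 = 0 \<and> \<sigma> = \<tau>(1 := 1) then \<alpha> else 0) = (if \<tau> 1 = 0 then \<alpha> else 0)"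
    using N by (intro point configs_upd \<tau>) auto
  also have "(\<Sum>\<sigma>\<in>configs N. if \<tau> N = 1 \<and> \<sigma> = \<tau>(N := 0) then \<beta> else 0) = (if \<tau> N = 1 then \<beta> else 0)"
    using N by (intro point configs_upd \<tau>) auto
  finally show ?thesis .
qed

lemma tasep_rate_self: "tasep_rate \<alpha> \<beta> N \<tau> \<tau> = 0"
proof -
  have "\<not> (\<tau> j = 1 \<and> \<tau> (j + 1) = 0 \<and> \<tau> = \<tau>(j := 0, j + 1 := 1))" for j
    by (metis fun_upd_same zero_neq_one)
  moreover have "\<not> (\<tau> 1 = 0 \<and> \<tau> = \<tau>(1 := 1))" "\<not> (\<tau> N = 1 \<and> \<tau> = \<tau>(N := 0))"
    by (metis fun_upd_same zero_neq_one)+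
  ultimately show ?thesis unfolding tasep_rate_def
    by (simp only: if_False sum.neutral_const add_0_right)
qed

end

text \<open>With \<open>D j\<close> the weight after deletion of site \<open>j\<close> and \<open>\<theta>\<close> equal to \<open>-1\<close> on particles and \<open>1\<close> on
  holes, the net flux through the bond between \<open>j\<close> and \<open>j + 1\<close> is the difference of the values of
  \<open>\<theta> D\<close> at \<open>j\<close> and at \<open>j + 1\<close>, and the two reservoirs cancel the end terms that remain after
  summation.\<close>

lemma top_weight_stationary:
  assumes a: "a > 0" and b: "b > 0" and N: "N \<ge> 1" and \<tau>: "\<tau> \<in> configs N"
  shows "(\<Sum>\<sigma>\<in>configs N. top_weight a b (map \<sigma> [1..<Suc N])
     * generator (configs N) (tasep_rate (1 / (1 + a)) (1 / (1 + b)) N) \<sigma> \<tau>) = 0"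
proof -
  define \<alpha> where "\<alpha> = 1 / (1 + a)"
  define \<beta> where "\<beta> = 1 / (1 + b)"
  have \<alpha>: "\<alpha> > 0" and \<beta>: "\<beta> > 0" using a b by (auto simp: \<alpha>_def \<beta>_def)
  define f where "f \<sigma> = top_weight a b (map \<sigma> [1..<Suc N])" for \<sigma>
  define D where "D j = top_weight a b (map \<tau> [1..<j] @ map \<tau> [Suc j..<Suc N])" for j
  define \<theta> where "\<theta> t = (if t = 1 then - 1 else 1::real)" for t :: nat
  have split: "map \<sigma> [1..<Suc N] = map \<sigma> [1..<j] @ \<sigma> j # \<sigma> (j + 1) # map \<sigma> [Suc (Suc j)..<Suc N]"
    if "j \<in> {1..<N}" for j and \<sigma> :: "nat \<Rightarrow> nat"
  proof -
    have "[1..<Suc N] = [1..<j] @ [j..<Suc N]" using that upt_add_eq_append[of 1 j "Suc N - j"] by auto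
    also have "[j..<Suc N] = j # (j + 1) # [Suc (Suc j)..<Suc N]"
      using that by (simp add: upt_conv_Cons)
    finally show ?thesis by simp
  qed
  have bond: "(if \<tau> j = 0 \<and> \<tau> (j + 1) = 1 then f (\<tau>(j := 1, j + 1 := 0)) else 0)
      - f \<tau> * (if \<tau> j = 1 \<and> \<tau> (j + 1) = 0 then 1 else 0)
      = - (\<theta> (\<tau> (Suc j)) * D (Suc j) - \<theta> (\<tau> j) * D j)" if j: "j \<in> {1..<N}" for j
  proof -
    let ?xs = "map \<tau> [1..<j]" and ?ys = "map \<tau> [Suc (Suc j)..<Suc N]"
    have Dj: "D j = top_weight a b (?xs @ \<tau> (j + 1) # ?ys)"
      unfolding D_def using j by (simp add: upt_conv_Cons del: upt_Suc)
    have DSj: "D (Suc j) = top_weight a b (?xs @ \<tau> j # ?ys)"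
      unfolding D_def using j by simp
    have f\<tau>: "f \<tau> = top_weight a b (?xs @ \<tau> j # \<tau> (j + 1) # ?ys)"
      unfolding f_def split[OF j] ..
    have "f (\<tau>(j := 1, j + 1 := 0)) = top_weight a b (?xs @ 1 # 0 # ?ys)"
    proof -
      have "map (\<tau>(j := 1, j + 1 := 0)) [1..<j] = ?xs" "map (\<tau>(j := 1, j + 1 := 0)) [Suc (Suc j)..<Suc N] = ?ys"
        by (auto intro!: map_cong simp del: upt_Suc)
      then show ?thesis unfolding f_def split[OF j] by simp
    qed
    then show ?thesis
      using configs_01[OF \<tau>, of j] configs_01[OF \<tau>, of "j + 1"] j
        top_weight_exchange[OF a b, of ?xs ?ys]
      by (auto simp: Dj DSj f\<tau> \<theta>_def)
  qed
  have left: "(if \<tau> 1 = 1 then \<alpha> * f (\<tau>(1 := 0)) else 0) - f \<tau> * (if \<tau> 1 = 0 then \<alpha> else 0) = - \<theta> (\<tau> 1) * D 1"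
  proof -
    have "[1..<Suc N] = 1 # [Suc 1..<Suc N]" using N by (intro upt_conv_Cons) auto
    then have cons: "map \<sigma> [1..<Suc N] = \<sigma> 1 # map \<sigma> [Suc 1..<Suc N]" for \<sigma> :: "nat \<Rightarrow> nat" by simp
    have "map (\<tau>(1 := 0)) [Suc 1..<Suc N] = map \<tau> [Suc 1..<Suc N]" by (intro map_cong) auto
    then have "f (\<tau>(1 := 0)) = (1 + a) * D 1"
      unfolding f_def D_def cons using top_weight_Cons_0[OF a b] by simp
    moreover have "f \<tau> = (1 + a) * D 1" if "\<tau> 1 = 0"
      unfolding f_def D_def cons using that top_weight_Cons_0[OF a b] by simp
    ultimately show ?thesis
      using configs_01[OF \<tau>, of 1] N a by (auto simp: \<theta>_def \<alpha>_def)
  qed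
  have right: "(if \<tau> N = 0 then \<beta> * f (\<tau>(N := 1)) else 0) - f \<tau> * (if \<tau> N = 1 then \<beta> else 0) = \<theta> (\<tau> N) * D N"
  proof -
    have snoc: "map \<sigma> [1..<Suc N] = map \<sigma> [1..<N] @ [\<sigma> N]" for \<sigma> :: "nat \<Rightarrow> nat"
      using N by simp
    have "map (\<tau>(N := 1)) [1..<N] = map \<tau> [1..<N]" by (intro map_cong) auto
    then have "f (\<tau>(N := 1)) = (1 + b) * D N"
      unfolding f_def D_def snoc using top_weight_snoc_1[OF a b] by simp
    moreover have "f \<tau> = (1 + b) * D N" if "\<tau> N = 1"
      unfolding f_def D_def snoc using that top_weight_snoc_1[OF a b] by simp
    ultimately show ?thesis
      using configs_01[OF \<tau>, of N] N b by (auto simp: \<theta>_def \<beta>_def)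
  qed
  have self: "(\<Sum>\<sigma>\<in>configs N - {\<tau>}. f \<sigma> * tasep_rate \<alpha> \<beta> N \<sigma> \<tau>) = (\<Sum>\<sigma>\<in>configs N. f \<sigma> * tasep_rate \<alpha> \<beta> N \<sigma> \<tau>)"
    "(\<Sum>\<sigma>\<in>configs N - {\<tau>}. tasep_rate \<alpha> \<beta> N \<tau> \<sigma>) = (\<Sum>\<sigma>\<in>configs N. tasep_rate \<alpha> \<beta> N \<tau> \<sigma>)"
    using tasep_rate_self[OF \<alpha> \<beta>, of N \<tau>] \<tau> by (auto simp: sum.remove[OF finite_configs \<tau>])
  have "(\<Sum>\<sigma>\<in>configs N. f \<sigma> * generator (configs N) (tasep_rate \<alpha> \<beta> N) \<sigma> \<tau>)
     = (\<Sum>j\<in>{1..<N}. (if \<tau> j = 0 \<and> \<tau> (j + 1) = 1 then f (\<tau>(j := 1, j + 1 := 0)) else 0)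
          - f \<tau> * (if \<tau> j = 1 \<and> \<tau> (j + 1) = 0 then 1 else 0))
      + ((if \<tau> 1 = 1 then \<alpha> * f (\<tau>(1 := 0)) else 0) - f \<tau> * (if \<tau> 1 = 0 then \<alpha> else 0))
      + ((if \<tau> N = 0 then \<beta> * f (\<tau>(N := 1)) else 0) - f \<tau> * (if \<tau> N = 1 then \<beta> else 0))"
    unfolding sum_generator[OF finite_configs \<tau>] self sum_tasep_influx[OF \<alpha> \<beta> \<tau> N]
      sum_tasep_outflux[OF \<alpha> \<beta> \<tau> N] sum_subtractf
    by (simp only: distrib_left sum_distrib_left)
  also have "\<dots> = (\<Sum>j\<in>{1..<N}. - (\<theta> (\<tau> (Suc j)) * D (Suc j) - \<theta> (\<tau> j) * D j)) - \<theta> (\<tau> 1) * D 1 + \<theta> (\<tau> N) * D N"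
    by (simp only: left right sum.cong[OF refl bond])
  also have "\<dots> = 0"
    unfolding sum_negf using sum_Suc_diff'[of 1 N "\<lambda>j. \<theta> (\<tau> j) * D j"] N by linarith
  finally show ?thesis unfolding f_def \<alpha>_def \<beta>_def .
qed

definition pair_weight :: "real \<Rightarrow> real \<Rightarrow> nat \<Rightarrow> (nat \<Rightarrow> nat) \<Rightarrow> (nat \<Rightarrow> nat) \<Rightarrow> real" where
  "pair_weight a b N \<tau> \<sigma> = path_weight a b (map (\<lambda>j. real (\<tau> j) - real (\<sigma> j)) [1..<Suc N])"

text \<open>The stationary law as the marginal of the two-layer Gibbs measure on the top layer.\<close>

lemma pmf_tasep_stationary:
  assumes a: "a > 0" and b: "b > 0" and N: "N \<ge> 1"
  shows "pmf (tasep_stationary (1 / (1 + a)) (1 / (1 + b)) N) \<tau> =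
    (if \<tau> \<in> configs N then (\<Sum>\<sigma>\<in>configs N. pair_weight a b N \<tau> \<sigma>)
        / (\<Sum>\<tau>\<in>configs N. \<Sum>\<sigma>\<in>configs N. pair_weight a b N \<tau> \<sigma>) else 0)"
proof -
  have pos: "1 / (1 + a) > 0" "1 / (1 + b) > 0" using a b by auto
  show ?thesis
    unfolding tasep_stationary_def pair_weight_def layer_sum_configs[symmetric] top_weight_def[symmetric]
    by (rule pmf_stationary_pmf[OF finite_configs configs_nonempty tasep_rate_nonneg[OF pos]
          top_weight_pos[OF a b] top_weight_stationary[OF a b N] tasep_irreducible[OF pos N]])
qed

section \<open>Absolutely continuous functions and interval coverings\<close>

abbreviation ivl :: "real \<times> real \<Rightarrow> real set" where
  "ivl i \<equiv> {fst i<..<snd i}"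

abbreviation disjoint_ivls :: "(real \<times> real) set \<Rightarrow> bool" where
  "disjoint_ivls C \<equiv> pairwise (\<lambda>i j. disjnt (ivl i) (ivl j)) C"

text \<open>Absolute continuity for finite sets of intervals in place of sequences; an interval is
  represented by the pair of its end points.\<close>

lemma abs_continuous_on_ivls:
  assumes f: "abs_continuous_on c d f" and "\<epsilon> > 0"
  obtains \<delta> where "\<delta> > 0"
    "\<And>G. finite G \<Longrightarrow> (\<And>i. i \<in> G \<Longrightarrow> c \<le> fst i \<and> fst i \<le> snd i \<and> snd i \<le> d) \<Longrightarrow> disjoint_ivls G
       \<Longrightarrow> (\<Sum>i\<in>G. snd i - fst i) < \<delta> \<Longrightarrow> (\<Sum>i\<in>G. \<bar>f (snd i) - f (fst i)\<bar>) < \<epsilon>"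
proof -
  obtain \<delta> where "\<delta> > 0" and \<delta>: "\<And>(n::nat) u v. (\<forall>i<n. c \<le> u i \<and> u i \<le> v i \<and> v i \<le> d) \<Longrightarrow>
        disjoint_family_on (\<lambda>i. {u i<..<v i}) {..<n} \<Longrightarrow>
        (\<Sum>i<n. v i - u i) < \<delta> \<Longrightarrow> (\<Sum>i<n. \<bar>f (v i) - f (u i)\<bar>) < \<epsilon>"
    using f \<open>\<epsilon> > 0\<close> unfolding abs_continuous_on_def by meson
  have "(\<Sum>i\<in>G. \<bar>f (snd i) - f (fst i)\<bar>) < \<epsilon>"
    if "finite G" and in_cd: "\<And>i. i \<in> G \<Longrightarrow> c \<le> fst i \<and> fst i \<le> snd i \<and> snd i \<le> d"
      and disj: "disjoint_ivls G" and small: "(\<Sum>i\<in>G. snd i - fst i) < \<delta>" for G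
  proof -
    obtain e where e: "bij_betw e {..<card G} G"
      using ex_bij_betw_nat_finite[OF \<open>finite G\<close>] by (auto simp: lessThan_atLeast0)
    then have eG: "e i \<in> G" if "i < card G" for i using that by (auto dest: bij_betwE)
    have "disjoint_family_on (\<lambda>i. ivl (e i)) {..<card G}"
      unfolding disjoint_family_on_def
    proof (intro ballI impI)
      fix m n assume mn: "m \<in> {..<card G}" "n \<in> {..<card G}" "m \<noteq> n"
      then have "e m \<noteq> e n" using e by (auto simp: bij_betw_def inj_on_def)
      then show "ivl (e m) \<inter> ivl (e n) = {}"
        using disj eG mn unfolding pairwise_def disjnt_def by blast
    qed
    moreover have "(\<Sum>i<card G. snd (e i) - fst (e i)) < \<delta>"
      using small sum.reindex_bij_betw[OF e, of "\<lambda>i. snd i - fst i"] by simp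
    ultimately have "(\<Sum>i<card G. \<bar>f (snd (e i)) - f (fst (e i))\<bar>) < \<epsilon>"
      using \<delta>[of "card G" "fst \<circ> e" "snd \<circ> e"] in_cd eG by simp
    then show ?thesis
      using sum.reindex_bij_betw[OF e, of "\<lambda>i. \<bar>f (snd i) - f (fst i)\<bar>"] by simp
  qed
  then show ?thesis using that \<open>\<delta> > 0\<close> by blast
qed

lemma abs_continuous_on_imp_continuous_on:
  assumes "abs_continuous_on c d f"
  shows "continuous_on {c..d} f"
proof (rule continuous_onI)
  fix x e :: real assume x: "x \<in> {c..d}" and "e > 0"
  obtain \<delta> where "\<delta> > 0" and \<delta>: "\<And>G. finite G \<Longrightarrow> (\<And>i. i \<in> G \<Longrightarrow> c \<le> fst i \<and> fst i \<le> snd i \<and> snd i \<le> d) \<Longrightarrow> disjoint_ivls G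
       \<Longrightarrow> (\<Sum>i\<in>G. snd i - fst i) < \<delta> \<Longrightarrow> (\<Sum>i\<in>G. \<bar>f (snd i) - f (fst i)\<bar>) < e"
    using abs_continuous_on_ivls[OF assms \<open>e > 0\<close>] by blast
  have "dist (f y) (f x) \<le> e" if y: "y \<in> {c..d}" "dist y x < \<delta>" for y
    using \<delta>[of "{(x, y)}"] \<delta>[of "{(y, x)}"] x y abs_minus_commute[of "f x" "f y"]
    by (cases "x \<le> y") (simp_all add: dist_real_def)
  then show "\<exists>d'>0. \<forall>x'\<in>{c..d}. dist x' x < d' \<longrightarrow> dist (f x') (f x) \<le> e"
    using \<open>\<delta> > 0\<close> by blast
qed

lemma sum_ivl_lengths:
  assumes "finite C" "disjoint_ivls C" "\<And>i. i \<in> C \<Longrightarrow> fst i \<le> snd i"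
  shows "(\<Sum>i\<in>C. snd i - fst i) = measure lebesgue (\<Union>i\<in>C. ivl i)"
proof -
  have "measure lebesgue (\<Union>i\<in>C. ivl i) = (\<Sum>i\<in>C. measure lebesgue (ivl i))"
    using assms by (intro measure_negligible_finite_Union_image) (auto simp: pairwise_def disjnt_def)
  also have "\<dots> = (\<Sum>i\<in>C. snd i - fst i)"
    using assms by (intro sum.cong) auto
  finally show ?thesis by simp
qed

text \<open>The Vitali covering theorem provides countably many disjoint intervals covering \<open>E\<close> up to a null
  set; finitely many of them miss only a set of small measure.\<close>

lemma Vitali_finite:
  assumes E: "E \<in> lmeasurable"
    and R: "\<And>x d. x \<in> E \<Longrightarrow> d > 0 \<Longrightarrow> \<exists>i\<in>R. x \<in> ivl i \<and> snd i - fst i < d"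
    and "\<epsilon> > 0"
  obtains C where "finite C" "C \<subseteq> R" "disjoint_ivls C" "\<And>i. i \<in> C \<Longrightarrow> fst i < snd i"
    "measure lebesgue (E - (\<Union>i\<in>C. ivl i)) < \<epsilon>"
proof -
  let ?a = "\<lambda>i::real \<times> real. (fst i + snd i) / 2" and ?r = "\<lambda>i::real \<times> real. (snd i - fst i) / 2"
  have ball: "ball (?a i) (?r i) = ivl i" for i
    by (auto simp: ball_eq_greaterThanLessThan field_simps)
  have "\<exists>i. i \<in> {i\<in>R. fst i < snd i} \<and> x \<in> ball (?a i) (?r i) \<and> ?r i < d" if "x \<in> E" "d > 0" for x d
    unfolding ball using R[of x d] that by fastforce
  then obtain C where C: "countable C" "C \<subseteq> {i\<in>R. fst i < snd i}"
     "pairwise (\<lambda>i j. disjnt (ball (?a i) (?r i)) (ball (?a j) (?r j))) C"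
     "negligible (E - (\<Union>i \<in> C. ball (?a i) (?r i)))"
    by (rule Vitali_covering_theorem_balls)
  then have disj: "disjoint_ivls C" and neg: "negligible (E - (\<Union>i\<in>C. ivl i))"
    unfolding ball by auto
  show thesis
  proof (cases "C = {}")
    case True
    then have "negligible E" using neg by simp
    then have "measure lebesgue E = 0" by (simp add: negligible_imp_measure0)
    then show thesis using that[of "{}"] \<open>\<epsilon> > 0\<close> by simp
  next
    case False
    define A where "A n = E - (\<Union>k<n. ivl (from_nat_into C k))" for n
    have meas: "A n \<in> lmeasurable" for n
      unfolding A_def using E by (intro fmeasurable.Diff fmeasurable.finite_UN) auto
    have "(\<lambda>n. measure lebesgue (A n)) \<longlonglongrightarrow> measure lebesgue (\<Inter>n. A n)"
    proof (rule Lim_measure_decseq)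
      show "range A \<subseteq> sets lebesgue" using meas by (auto simp: fmeasurableD)
      show "decseq A" unfolding decseq_def A_def by force
      show "emeasure lebesgue (A i) \<noteq> \<infinity>" for i using fmeasurableD2[OF meas] by simp
    qed
    moreover have "(\<Inter>n. A n) \<subseteq> E - (\<Union>i\<in>C. ivl i)"
    proof
      fix x assume "x \<in> (\<Inter>n. A n)"
      then have x: "x \<in> A n" for n by blast
      have "x \<notin> ivl i" if i: "i \<in> C" for i
      proof -
        obtain k where "i = from_nat_into C k"
          using from_nat_into_surj[OF C(1) i] by metis
        then show ?thesis using x[of "Suc k"] by (auto simp: A_def)
      qed
      then show "x \<in> E - (\<Union>i\<in>C. ivl i)" using x[of 0] by (auto simp: A_def)
    qed
    then have "measure lebesgue (\<Inter>n. A n) = 0"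
      using neg negligible_subset negligible_imp_measure0 by blast
    ultimately have "eventually (\<lambda>n. measure lebesgue (A n) < \<epsilon>) sequentially"
      using \<open>\<epsilon> > 0\<close> by (intro order_tendstoD(2)) auto
    then obtain n where n: "measure lebesgue (A n) < \<epsilon>"
      by (auto simp: eventually_sequentially)
    let ?C = "from_nat_into C ` {..<n}"
    have "?C \<subseteq> C" using False from_nat_into by blast
    then show thesis
      using that[of ?C] C(2) n disj pairwise_subset[OF disj] by (auto simp: A_def subset_iff)
  qed
qed

text \<open>The gaps left by finitely many disjoint intervals in \<open>[s, t]\<close> complete them to a partition, so that
  the increments of any function add up.  The same set of gaps serves all functions \<open>F\<close>: it is
  applied to \<open>f\<close> and to the identity, which measures lengths.\<close>

lemma complementary_gaps:
  assumes "finite J" "\<And>i. i \<in> J \<Longrightarrow> s \<le> fst i \<and> fst i < snd i \<and> snd i \<le> t" "disjoint_ivls J" "s \<le> t"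
  shows "\<exists>G. finite G \<and> (\<forall>i\<in>G. s \<le> fst i \<and> fst i < snd i \<and> snd i \<le> t) \<and> disjoint_ivls G \<and>
    (\<forall>F::real \<Rightarrow> real. F t - F s = (\<Sum>i\<in>J. F (snd i) - F (fst i)) + (\<Sum>i\<in>G. F (snd i) - F (fst i)))"
  using assms
proof (induction "card J" arbitrary: J t)
  case 0
  then have "J = {}" by simp
  then show ?case
    using \<open>s \<le> t\<close> by (intro exI[of _ "if s < t then {(s, t)} else {}"]) auto
next
  case (Suc n)
  then have "J \<noteq> {}" by auto
  then have "Max (snd ` J) \<in> snd ` J" using \<open>finite J\<close> by (intro Max_in) auto
  then obtain i where i: "i \<in> J" and max: "snd i = Max (snd ` J)" by auto
  have snd_le: "snd j \<le> fst i" if "j \<in> J - {i}" for j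
  proof (rule ccontr)
    assume "\<not> snd j \<le> fst i"
    moreover have "snd j \<le> snd i" unfolding max using that \<open>finite J\<close> by auto
    moreover have "fst j < snd j" "fst i < snd i" using Suc.prems(2) i that by auto
    ultimately have "(max (fst i) (fst j) + snd j) / 2 \<in> ivl i \<inter> ivl j" by auto
    moreover have "ivl i \<inter> ivl j = {}" using Suc.prems(3) i that by (auto simp: pairwise_def disjnt_def)
    ultimately show False by blast
  qed
  have "\<exists>G. finite G \<and> (\<forall>j\<in>G. s \<le> fst j \<and> fst j < snd j \<and> snd j \<le> fst i) \<and> disjoint_ivls G \<and>
    (\<forall>F::real \<Rightarrow> real. F (fst i) - F s = (\<Sum>i\<in>J - {i}. F (snd i) - F (fst i)) + (\<Sum>i\<in>G. F (snd i) - F (fst i)))"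
  proof (rule Suc.hyps(1))
    show "n = card (J - {i})" using Suc.hyps(2) i by simp
    show "disjoint_ivls (J - {i})" using Suc.prems(3) by (rule pairwise_subset) auto
  qed (use Suc.prems i snd_le in auto)
  then obtain G where G: "finite G" "\<And>j. j \<in> G \<Longrightarrow> s \<le> fst j \<and> fst j < snd j \<and> snd j \<le> fst i" "disjoint_ivls G"
    "\<And>F::real \<Rightarrow> real. F (fst i) - F s = (\<Sum>i\<in>J - {i}. F (snd i) - F (fst i)) + (\<Sum>i\<in>G. F (snd i) - F (fst i))"
    by blast
  have i_bounds: "s \<le> fst i" "fst i < snd i" "snd i \<le> t" using Suc.prems(2) i by auto
  have sumJ: "(\<Sum>i\<in>J. F (snd i) - F (fst i)) = (F (snd i) - F (fst i)) + (\<Sum>i\<in>J - {i}. F (snd i) - F (fst i))"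
    for F :: "real \<Rightarrow> real"
    using \<open>finite J\<close> i by (rule sum.remove)
  define g where "g = (snd i, t)"
  show ?case
  proof (cases "snd i < t")
    case True
    have "g \<notin> G" using G(2)[of g] i_bounds by (auto simp: g_def)
    then have sumG: "(\<Sum>i\<in>insert g G. F (snd i) - F (fst i)) = (F t - F (snd i)) + (\<Sum>i\<in>G. F (snd i) - F (fst i))"
      for F :: "real \<Rightarrow> real"
      using G(1) by (simp add: g_def)
    show ?thesis
    proof (intro exI[of _ "insert g G"] conjI ballI allI)
      show "disjoint_ivls (insert g G)"
        using G(2,3) i_bounds by (fastforce simp: pairwise_insert disjnt_def g_def)
      show "F t - F s = (\<Sum>i\<in>J. F (snd i) - F (fst i)) + (\<Sum>i\<in>insert g G. F (snd i) - F (fst i))"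
        for F :: "real \<Rightarrow> real"
        using G(4)[of F] unfolding sumJ sumG by simp
      show "finite (insert g G)" using G(1) by simp
      fix j assume "j \<in> insert g G"
      then show "s \<le> fst j" "fst j < snd j" "snd j \<le> t"
        using G(2)[of j] i_bounds True by (auto simp: g_def)
    qed
  next
    case False
    then have "t = snd i" using i_bounds by simp
    show ?thesis
    proof (intro exI[of _ G] conjI ballI allI)
      show "F t - F s = (\<Sum>i\<in>J. F (snd i) - F (fst i)) + (\<Sum>i\<in>G. F (snd i) - F (fst i))"
        for F :: "real \<Rightarrow> real"
        using G(4)[of F] unfolding sumJ by (simp add: \<open>t = snd i\<close>)
      show "finite G" "disjoint_ivls G" by (rule G)+
      fix j assume "j \<in> G"
      then show "s \<le> fst j" "fst j < snd j" "snd j \<le> t"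
        using G(2)[of j] i_bounds by auto
    qed
  qed
qed

text \<open>Around almost every point there are short intervals on which the increment of \<open>f\<close> is at least
  \<open>-\<epsilon>\<close> times the length.  Disjoint ones cover \<open>[s, t]\<close> up to gaps of small total length, and
  absolute continuity bounds the increments over the gaps.\<close>

lemma abs_continuous_on_mono:
  assumes f: "abs_continuous_on 0 1 f" and st: "0 \<le> s" "s \<le> t" "t \<le> 1"
    and "negligible N"
    and deriv: "\<And>x. x \<in> {s<..<t} - N \<Longrightarrow> \<exists>D\<ge>0. (f has_real_derivative D) (at x)"
  shows "f s \<le> f t"
proof -
  have "f s - f t \<le> 2 * \<epsilon>" if "\<epsilon> > 0" for \<epsilon>
  proof -
    obtain \<delta> where "\<delta> > 0" and \<delta>: "\<And>G. finite G \<Longrightarrow> (\<And>i. i \<in> G \<Longrightarrow> 0 \<le> fst i \<and> fst i \<le> snd i \<and> snd i \<le> 1) \<Longrightarrow> disjoint_ivls G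
       \<Longrightarrow> (\<Sum>i\<in>G. snd i - fst i) < \<delta> \<Longrightarrow> (\<Sum>i\<in>G. \<bar>f (snd i) - f (fst i)\<bar>) < \<epsilon>"
      using abs_continuous_on_ivls[OF f \<open>\<epsilon> > 0\<close>] by blast
    define E where "E = {s<..<t} - N"
    define R where "R = {i. s \<le> fst i \<and> snd i \<le> t \<and> f (snd i) - f (fst i) \<ge> - \<epsilon> * (snd i - fst i)}"
    have E: "E \<in> lmeasurable" unfolding E_def
      using \<open>negligible N\<close> by (intro fmeasurable.Diff) (auto simp: negligible_iff_measure)
    have "\<exists>i\<in>R. x \<in> ivl i \<and> snd i - fst i < d" if x: "x \<in> E" and "d > 0" for x d
    proof -
      obtain D where D: "D \<ge> 0" "(f has_real_derivative D) (at x)"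
        using deriv x unfolding E_def by blast
      have "((\<lambda>y. (f y - f x) / (y - x)) \<longlongrightarrow> D) (at x)"
        using D(2) by (simp add: has_field_derivative_iff)
      then have "\<forall>\<^sub>F y in at x. (f y - f x) / (y - x) > - \<epsilon>"
        using D(1) \<open>\<epsilon> > 0\<close> by (intro order_tendstoD(1)) auto
      then obtain r where "r > 0" and r: "\<And>y. y \<noteq> x \<Longrightarrow> dist y x < r \<Longrightarrow> (f y - f x) / (y - x) > - \<epsilon>"
        by (auto simp: eventually_at)
      define h where "h = min (min r d) (min (x - s) (t - x)) / 3"
      have sx: "s < x" "x < t" using x by (auto simp: E_def)
      then have h: "h > 0" "3 * h \<le> r" "3 * h \<le> d" "3 * h \<le> x - s" "3 * h \<le> t - x"
        using \<open>r > 0\<close> \<open>d > 0\<close> by (auto simp: h_def)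
      have "(f (x + h) - f x) / h > - \<epsilon>" using r[of "x + h"] h by (simp add: dist_real_def)
      moreover have "(f (x - h) - f x) / (- h) > - \<epsilon>" using r[of "x - h"] h by (simp add: dist_real_def)
      ultimately have "f (x + h) - f (x - h) \<ge> - \<epsilon> * (2 * h)"
        using \<open>h > 0\<close> by (simp add: field_simps)
      then have "(x - h, x + h) \<in> R" using h by (simp add: R_def)
      then show ?thesis using h by (intro bexI[of _ "(x - h, x + h)"]) auto
    qed
    from Vitali_finite[OF E this \<open>\<delta> > 0\<close>]
    obtain C where C: "finite C" "C \<subseteq> R" "disjoint_ivls C" "\<And>i. i \<in> C \<Longrightarrow> fst i < snd i"
      "measure lebesgue (E - (\<Union>i\<in>C. ivl i)) < \<delta>" by blast
    have bounds: "s \<le> fst i \<and> fst i < snd i \<and> snd i \<le> t" if "i \<in> C" for i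
      using C(2) C(4)[OF that] that by (auto simp: R_def)
    obtain G where G: "finite G" "\<And>i. i \<in> G \<Longrightarrow> s \<le> fst i \<and> fst i < snd i \<and> snd i \<le> t" "disjoint_ivls G"
      "\<And>F::real \<Rightarrow> real. F t - F s = (\<Sum>i\<in>C. F (snd i) - F (fst i)) + (\<Sum>i\<in>G. F (snd i) - F (fst i))"
      using complementary_gaps[OF C(1) bounds C(3) st(2)] by blast
    have "measure lebesgue E = measure lebesgue {s<..<t}"
      unfolding E_def using \<open>negligible N\<close>
      by (intro measure_negligible_symdiff) (auto intro: negligible_subset)
    then have mE: "measure lebesgue E = t - s" using st by simp
    have mC: "(\<Sum>i\<in>C. snd i - fst i) = measure lebesgue (\<Union>i\<in>C. ivl i)"
      using C by (intro sum_ivl_lengths) (auto simp: less_imp_le)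
    have UC: "(\<Union>i\<in>C. ivl i) \<in> lmeasurable" using C(1) by (intro fmeasurable.finite_UN) auto
    have "measure lebesgue E \<le> measure lebesgue ((\<Union>i\<in>C. ivl i) \<union> (E - (\<Union>i\<in>C. ivl i)))"
      using E UC by (intro measure_mono_fmeasurable) auto
    also have "\<dots> \<le> measure lebesgue (\<Union>i\<in>C. ivl i) + measure lebesgue (E - (\<Union>i\<in>C. ivl i))"
      using E UC by (intro measure_Un_le) auto
    finally have "(\<Sum>i\<in>G. snd i - fst i) < \<delta>"
      using G(4)[of "\<lambda>x. x"] C(5) mE mC by simp
    then have "(\<Sum>i\<in>G. \<bar>f (snd i) - f (fst i)\<bar>) < \<epsilon>"
      using G st by (intro \<delta>) force+
    moreover have "\<bar>\<Sum>i\<in>G. f (snd i) - f (fst i)\<bar> \<le> (\<Sum>i\<in>G. \<bar>f (snd i) - f (fst i)\<bar>)"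
      by (rule sum_abs)
    moreover have "(\<Sum>i\<in>C. f (snd i) - f (fst i)) \<ge> (\<Sum>i\<in>C. - \<epsilon> * (snd i - fst i))"
      using C(2) by (intro sum_mono) (auto simp: R_def)
    moreover have "(\<Sum>i\<in>C. - \<epsilon> * (snd i - fst i)) = - \<epsilon> * (\<Sum>i\<in>C. snd i - fst i)"
      by (rule sum_distrib_left[symmetric])
    moreover have "\<epsilon> * (\<Sum>i\<in>C. snd i - fst i) \<le> \<epsilon> * 1"
    proof (intro mult_left_mono)
      have "(\<Sum>i\<in>G. snd i - fst i) \<ge> 0" using G(2) by (intro sum_nonneg) (auto simp: less_imp_le)
      then show "(\<Sum>i\<in>C. snd i - fst i) \<le> 1" using G(4)[of "\<lambda>x. x"] st by simp
    qed (use \<open>\<epsilon> > 0\<close> in simp)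
    ultimately show ?thesis using G(4)[of f] by linarith
  qed
  then have "f s - f t \<le> e" if "e > 0" for e using that[THEN half_gt_zero] by fastforce
  then have "f s - f t \<le> 0" by (rule field_le_epsilon[of _ 0, simplified])
  then show ?thesis by simp
qed

section \<open>Differentiability almost everywhere\<close>

text \<open>The points that lie in arbitrarily short intervals of mean slope greater than \<open>q\<close>.  Intervals
  containing the point in their interior, in place of difference quotients at the point, make this set
  a countable intersection of open sets and suit the covering argument.\<close>

definition steep :: "(real \<Rightarrow> real) \<Rightarrow> real \<Rightarrow> real set" where
  "steep f q = (\<Inter>n::nat. \<Union>i\<in>{i. 0 \<le> fst i \<and> snd i \<le> 1 \<and> snd i - fst i < 1 / Suc n
      \<and> f (snd i) - f (fst i) > q * (snd i - fst i)}. ivl i)"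

lemma steepD:
  assumes "x \<in> steep f q" "d > 0"
  obtains i where "0 \<le> fst i" "snd i \<le> 1" "snd i - fst i < d" "x \<in> ivl i"
    "f (snd i) - f (fst i) > q * (snd i - fst i)"
proof -
  obtain n where "1 / real (Suc n) < d" using nat_approx_posE[OF \<open>d > 0\<close>] by blast
  moreover obtain i where "0 \<le> fst i" "snd i \<le> 1" "snd i - fst i < 1 / Suc n" "x \<in> ivl i"
    "f (snd i) - f (fst i) > q * (snd i - fst i)"
    using assms(1) unfolding steep_def by blast
  ultimately show ?thesis using that[of i] by linarith
qed

lemma steep_subset: "steep f q \<subseteq> {0<..<1}"
proof
  fix x assume "x \<in> steep f q"
  then obtain i where "0 \<le> fst i" "snd i \<le> 1" "x \<in> ivl i" by (rule steepD[OF _ zero_less_one])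
  then show "x \<in> {0<..<1}" by simp
qed

lemma steep_lmeasurable: "steep f q \<in> lmeasurable"
proof (rule bounded_set_imp_lmeasurable)
  show "bounded (steep f q)" by (rule bounded_subset[OF _ steep_subset]) simp
  have "(\<Union>i\<in>S. ivl i) \<in> sets lebesgue" for S
    by (intro sets_completionI_sets) (simp add: borel_open open_UN)
  then show "steep f q \<in> sets lebesgue"
    unfolding steep_def by (intro sets.countable_INT') auto
qed

lemma not_steepD:
  assumes "x \<notin> steep f q"
  obtains n where "\<And>u v. 0 \<le> u \<Longrightarrow> u < x \<Longrightarrow> x < v \<Longrightarrow> v \<le> 1 \<Longrightarrow> v - u < 1 / Suc n \<Longrightarrow>
    f v - f u \<le> q * (v - u)"
proof -
  obtain n where n: "\<And>i. 0 \<le> fst i \<Longrightarrow> snd i \<le> 1 \<Longrightarrow> snd i - fst i < 1 / Suc n \<Longrightarrow>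
     f (snd i) - f (fst i) > q * (snd i - fst i) \<Longrightarrow> x \<notin> ivl i"
    using assms unfolding steep_def by blast
  show ?thesis
  proof (rule that)
    fix u v assume "0 \<le> u" "u < x" "x < v" "v \<le> 1" "v - u < 1 / Suc n"
    then show "f v - f u \<le> q * (v - u)" using n[of "(u, v)"] by force
  qed
qed

lemma steep_antimono: "q' \<le> q \<Longrightarrow> steep f q \<subseteq> steep f q'"
proof
  fix x assume q: "q' \<le> q" and x: "x \<in> steep f q"
  show "x \<in> steep f q'"
    unfolding steep_def
  proof (intro INT_I)
    fix n :: nat
    obtain i where i: "0 \<le> fst i" "snd i \<le> 1" "snd i - fst i < 1 / Suc n" "x \<in> ivl i"
      "f (snd i) - f (fst i) > q * (snd i - fst i)"
      using steepD[OF x, of "1 / Suc n"] by auto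
    have "q' * (snd i - fst i) \<le> q * (snd i - fst i)" using q i(4) by (intro mult_right_mono) auto
    then have "q' * (snd i - fst i) < f (snd i) - f (fst i)" using i(5) by linarith
    then show "x \<in> (\<Union>i\<in>{i. 0 \<le> fst i \<and> snd i \<le> 1 \<and> snd i - fst i < 1 / Suc n
      \<and> f (snd i) - f (fst i) > q' * (snd i - fst i)}. ivl i)"
      using i by blast
  qed
qed

lemma measure_cover_le:
  assumes "E \<in> lmeasurable" "finite C" "disjoint_ivls C" "\<And>i. i \<in> C \<Longrightarrow> fst i < snd i"
    and "measure lebesgue (E - (\<Union>i\<in>C. ivl i)) < \<epsilon>"
  shows "measure lebesgue E < (\<Sum>i\<in>C. snd i - fst i) + \<epsilon>"
proof -
  have eq: "(\<Sum>i\<in>C. snd i - fst i) = measure lebesgue (\<Union>i\<in>C. ivl i)"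
    using assms by (intro sum_ivl_lengths) (auto simp: less_imp_le)
  have UC: "(\<Union>i\<in>C. ivl i) \<in> lmeasurable" using assms(2) by (intro fmeasurable.finite_UN) auto
  have "measure lebesgue E \<le> measure lebesgue ((\<Union>i\<in>C. ivl i) \<union> (E - (\<Union>i\<in>C. ivl i)))"
    using assms(1) UC by (intro measure_mono_fmeasurable) auto
  also have "\<dots> \<le> measure lebesgue (\<Union>i\<in>C. ivl i) + measure lebesgue (E - (\<Union>i\<in>C. ivl i))"
    using assms(1) UC by (intro measure_Un_le) auto
  finally show ?thesis using assms(5) eq by linarith
qed

text \<open>On an interval of length below \<open>\<delta>\<close> the variation of \<open>f\<close> is at most \<open>1\<close>, so disjoint intervals of
  slope above \<open>k\<close> have total length at most \<open>1 / k\<close>.\<close>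

lemma negligible_steep_inf:
  assumes f: "abs_continuous_on 0 1 f"
  shows "negligible (\<Inter>k::nat. steep f (real k))"
proof -
  define E where "E = (\<Inter>k::nat. steep f (real k))"
  obtain \<delta> where "\<delta> > 0" and \<delta>: "\<And>G. finite G \<Longrightarrow> (\<And>i. i \<in> G \<Longrightarrow> 0 \<le> fst i \<and> fst i \<le> snd i \<and> snd i \<le> 1) \<Longrightarrow> disjoint_ivls G
       \<Longrightarrow> (\<Sum>i\<in>G. snd i - fst i) < \<delta> \<Longrightarrow> (\<Sum>i\<in>G. \<bar>f (snd i) - f (fst i)\<bar>) < 1"
    using abs_continuous_on_ivls[OF f zero_less_one] by blast
  have E01: "E \<subseteq> {0<..<1}" unfolding E_def using steep_subset by blast
  have Emeas: "E \<in> sets lebesgue"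
    unfolding E_def using fmeasurableD[OF steep_lmeasurable] by (intro sets.countable_INT') auto
  have piece: "negligible (E \<inter> {s<..<t})" if st: "0 \<le> s" "s < t" "t \<le> 1" "t - s < \<delta>" for s t
  proof -
    have m: "E \<inter> {s<..<t} \<in> lmeasurable"
      using Emeas E01 by (intro bounded_set_imp_lmeasurable) (auto intro: bounded_subset[of "{0<..<1}"])
    have le: "measure lebesgue (E \<inter> {s<..<t}) < 1 / Suc k + 1 / Suc k" for k
    proof -
      define R where "R = {i. s \<le> fst i \<and> snd i \<le> t \<and> f (snd i) - f (fst i) > real (Suc k) * (snd i - fst i)}"
      have R: "\<exists>i\<in>R. x \<in> ivl i \<and> snd i - fst i < d" if x: "x \<in> E \<inter> {s<..<t}" and "d > 0" for x d
      proof -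
        have "x \<in> steep f (real (Suc k))" using x unfolding E_def by blast
        then obtain i where i: "0 \<le> fst i" "snd i \<le> 1" "snd i - fst i < min d (min (x - s) (t - x))" "x \<in> ivl i"
          "f (snd i) - f (fst i) > real (Suc k) * (snd i - fst i)"
          using steepD[of x f "real (Suc k)" "min d (min (x - s) (t - x))"] x \<open>d > 0\<close> by auto
        then show ?thesis by (intro bexI[of _ i]) (auto simp: R_def)
      qed
      obtain C where C: "finite C" "C \<subseteq> R" "disjoint_ivls C" "\<And>i. i \<in> C \<Longrightarrow> fst i < snd i"
        "measure lebesgue (E \<inter> {s<..<t} - (\<Union>i\<in>C. ivl i)) < 1 / Suc k"
        using Vitali_finite[OF m R, of "1 / Suc k"] by auto
      have bounds: "s \<le> fst i \<and> fst i < snd i \<and> snd i \<le> t" if "i \<in> C" for i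
        using C(2) C(4)[OF that] that by (auto simp: R_def)
      have len: "(\<Sum>i\<in>C. snd i - fst i) = measure lebesgue (\<Union>i\<in>C. ivl i)"
        using C by (intro sum_ivl_lengths) (auto simp: less_imp_le)
      also have "\<dots> \<le> measure lebesgue {s<..<t}"
        using bounds C(1) by (intro measure_mono_fmeasurable sets.finite_UN) force+
      also have "\<dots> < \<delta>" using st by simp
      finally have "(\<Sum>i\<in>C. \<bar>f (snd i) - f (fst i)\<bar>) < 1"
        using C bounds st by (intro \<delta>) force+
      moreover have "(\<Sum>i\<in>C. real (Suc k) * (snd i - fst i)) \<le> (\<Sum>i\<in>C. \<bar>f (snd i) - f (fst i)\<bar>)"
        using C(2) by (intro sum_mono) (auto simp: R_def)
      ultimately have "real (Suc k) * (\<Sum>i\<in>C. snd i - fst i) < 1"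
        unfolding sum_distrib_left by linarith
      then have "(\<Sum>i\<in>C. snd i - fst i) < 1 / Suc k"
        by (simp only: pos_less_divide_eq of_nat_0_less_iff zero_less_Suc mult.commute)
      then show ?thesis using measure_cover_le[OF m C(1,3,4,5)] by linarith
    qed
    have "measure lebesgue (E \<inter> {s<..<t}) \<le> 0"
    proof (rule ccontr)
      assume "\<not> ?thesis"
      then obtain k where "1 / real (Suc k) < measure lebesgue (E \<inter> {s<..<t}) / 2"
        using nat_approx_posE[of "measure lebesgue (E \<inter> {s<..<t}) / 2"] by auto
      then show False using le[of k] by linarith
    qed
    then show ?thesis using m by (simp add: negligible_iff_measure measure_le_0_iff)
  qed
  obtain n0 where "1 / real (Suc n0) < \<delta>" using nat_approx_posE[OF \<open>\<delta> > 0\<close>] by blast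
  define n where "n = Suc n0"
  have n: "n > 0" "1 / real n < \<delta>" using \<open>1 / real (Suc n0) < \<delta>\<close> by (auto simp: n_def)
  let ?g = "\<lambda>i::nat. real i / n"
  have "E \<subseteq> (\<Union>i<n. E \<inter> {?g i<..<?g (Suc i)}) \<union> ?g ` {..<n}"
  proof
    fix x assume x: "x \<in> E"
    then have x01: "0 < x" "x < 1" using E01 by auto
    define i where "i = nat \<lfloor>n * x\<rfloor>"
    have i: "real i \<le> n * x" "n * x < real i + 1" using x01 n by (auto simp: i_def)
    have "n * x < n" using x01 n by simp
    then have "i < n" using i by linarith
    show "x \<in> (\<Union>i<n. E \<inter> {?g i<..<?g (Suc i)}) \<union> ?g ` {..<n}"
    proof (cases "real i = n * x")
      case True
      then have "x = ?g i" using n by simp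
      then show ?thesis using \<open>i < n\<close> by blast
    next
      case False
      then have "x \<in> {?g i<..<?g (Suc i)}" using i n by (simp add: field_simps)
      then show ?thesis using x \<open>i < n\<close> by blast
    qed
  qed
  moreover have "negligible (\<Union>i<n. E \<inter> {?g i<..<?g (Suc i)})"
  proof (rule negligible_Union)
    fix t assume "t \<in> (\<lambda>i. E \<inter> {?g i<..<?g (Suc i)}) ` {..<n}"
    then obtain i where t: "t = E \<inter> {?g i<..<?g (Suc i)}" and "i < n" by blast
    show "negligible t"
      unfolding t
    proof (rule piece)
    show "?g (Suc i) \<le> 1" using n \<open>i < n\<close> by (subst divide_le_eq_1_pos) auto
    show "0 \<le> ?g i" "?g i < ?g (Suc i)" "?g (Suc i) - ?g i < \<delta>"
      using n \<open>i < n\<close> by (simp_all add: add_divide_distrib)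
    qed
  qed simp
  moreover have "negligible (?g ` {..<n})" by (intro negligible_finite) simp
  ultimately show ?thesis unfolding E_def[symmetric] using negligible_Un negligible_subset by blast
qed

text \<open>If the upper slope exceeds \<open>q\<close> and the lower slope is below \<open>p < q\<close> on a set \<open>E\<close>, cover almost
  all of \<open>E\<close> by disjoint intervals \<open>C\<close> of slope below \<open>p\<close> of total length little more than the
  measure of \<open>E\<close>, and inside these by disjoint intervals \<open>J\<close> of slope above \<open>q\<close>.  The two
  families differ by gaps of small total length, over which \<open>f\<close> varies little by absolute
  continuity, so \<open>q\<close> times the measure of \<open>E\<close> is at most about \<open>p\<close> times this measure, which is
  impossible unless \<open>E\<close> is null.\<close>

lemma negligible_steep_both:
  assumes f: "abs_continuous_on 0 1 f" and "p < q"
  shows "negligible (steep f q \<inter> steep (\<lambda>x. - f x) (- p))"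
proof -
  define E where "E = steep f q \<inter> steep (\<lambda>x. - f x) (- p)"
  have E: "E \<in> lmeasurable" unfolding E_def by (intro fmeasurable.Int steep_lmeasurable)
  have bound: "(q - p) * (measure lebesgue E - 2 * e) \<le> (3 * \<bar>p\<bar> + 1) * e" if "e > 0" for e
  proof -
    obtain \<delta> where "\<delta> > 0" and \<delta>: "\<And>G. finite G \<Longrightarrow> (\<And>i. i \<in> G \<Longrightarrow> 0 \<le> fst i \<and> fst i \<le> snd i \<and> snd i \<le> 1) \<Longrightarrow> disjoint_ivls G
       \<Longrightarrow> (\<Sum>i\<in>G. snd i - fst i) < \<delta> \<Longrightarrow> (\<Sum>i\<in>G. \<bar>f (snd i) - f (fst i)\<bar>) < e"
      using abs_continuous_on_ivls[OF f \<open>e > 0\<close>] by blast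
    \<comment> \<open>The gaps will have total length below \<open>3 \<epsilon>\<close>: one \<open>\<epsilon>\<close> for the excess of the open hull and one for each cover.\<close>
    define \<epsilon> where "\<epsilon> = min (\<delta> / 3) e"
    have \<epsilon>: "\<epsilon> > 0" "3 * \<epsilon> \<le> \<delta>" "\<epsilon> \<le> e" using \<open>\<delta> > 0\<close> \<open>e > 0\<close> by (auto simp: \<epsilon>_def)
    obtain U where U: "open U" "E \<subseteq> U" "U - E \<in> lmeasurable" "emeasure lebesgue (U - E) < ennreal \<epsilon>"
      using sets_lebesgue_outer_open[OF fmeasurableD[OF E] \<epsilon>(1)] by blast
    have "U = E \<union> (U - E)" using U(2) by blast
    then have Um: "U \<in> lmeasurable" using fmeasurable.Un[OF E U(3)] by simp
    have "measure lebesgue U \<le> measure lebesgue E + measure lebesgue (U - E)"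
      using measure_Un_le[of E lebesgue "U - E"] E U(3) \<open>U = E \<union> (U - E)\<close> by (metis fmeasurableD)
    moreover have "measure lebesgue (U - E) < \<epsilon>"
      using U(3,4) \<epsilon>(1) by (simp add: emeasure_eq_measure2 ennreal_less_iff)
    ultimately have mU: "measure lebesgue U < measure lebesgue E + \<epsilon>" by linarith
    define R1 where "R1 = {i. 0 \<le> fst i \<and> snd i \<le> 1 \<and> ivl i \<subseteq> U \<and> f (snd i) - f (fst i) < p * (snd i - fst i)}"
    have R1: "\<exists>i\<in>R1. x \<in> ivl i \<and> snd i - fst i < d" if x: "x \<in> E" and "d > 0" for x d
    proof -
      obtain r where r: "r > 0" "ball x r \<subseteq> U" using x U(1,2) openE by blast
      have xs: "x \<in> steep (\<lambda>x. - f x) (- p)" using x unfolding E_def by blast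
      have "min d r > 0" using \<open>d > 0\<close> r by simp
      from steepD[OF xs this]
      obtain i where i: "0 \<le> fst i" "snd i \<le> 1" "snd i - fst i < min d r" "x \<in> ivl i"
          "- f (snd i) - - f (fst i) > - p * (snd i - fst i)" by blast
      have "ivl i \<subseteq> ball x r" using i(3,4) by (auto simp: dist_real_def)
      then show ?thesis using i r by (intro bexI[of _ i]) (auto simp: R1_def)
    qed
    obtain C where C: "finite C" "C \<subseteq> R1" "disjoint_ivls C" "\<And>i. i \<in> C \<Longrightarrow> fst i < snd i"
      "measure lebesgue (E - (\<Union>i\<in>C. ivl i)) < \<epsilon>"
      using Vitali_finite[OF E R1 \<epsilon>(1)] by blast
    have Cb: "0 \<le> fst i" "snd i \<le> 1" "ivl i \<subseteq> U" "f (snd i) - f (fst i) < p * (snd i - fst i)" if "i \<in> C" for i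
      using C(2) that by (auto simp: R1_def)
    define E1 where "E1 = E \<inter> (\<Union>i\<in>C. ivl i)"
    have UC: "(\<Union>i\<in>C. ivl i) \<in> lmeasurable" using C(1) by (intro fmeasurable.finite_UN) auto
    have E1: "E1 \<in> lmeasurable" unfolding E1_def using E UC by (rule fmeasurable.Int)
    have mE1: "measure lebesgue E < measure lebesgue E1 + \<epsilon>"
    proof -
      have "measure lebesgue E = measure lebesgue (E1 \<union> (E - (\<Union>i\<in>C. ivl i)))"
        by (rule arg_cong[of _ _ "measure lebesgue"]) (auto simp: E1_def)
      also have "\<dots> \<le> measure lebesgue E1 + measure lebesgue (E - (\<Union>i\<in>C. ivl i))"
        using E E1 UC by (intro measure_Un_le) auto
      finally show ?thesis using C(5) by linarith
    qed
    define R2 where "R2 = {j. \<exists>i\<in>C. fst i \<le> fst j \<and> snd j \<le> snd i \<and> f (snd j) - f (fst j) > q * (snd j - fst j)}"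
    have R2: "\<exists>j\<in>R2. x \<in> ivl j \<and> snd j - fst j < d" if x: "x \<in> E1" and "d > 0" for x d
    proof -
      obtain i where i: "i \<in> C" "x \<in> ivl i" using x unfolding E1_def by blast
      have xs: "x \<in> steep f q" using x unfolding E1_def E_def by blast
      have "min d (min (x - fst i) (snd i - x)) > 0" using \<open>d > 0\<close> i by simp
      from steepD[OF xs this]
      obtain j where j: "0 \<le> fst j" "snd j \<le> 1" "snd j - fst j < min d (min (x - fst i) (snd i - x))" "x \<in> ivl j"
          "f (snd j) - f (fst j) > q * (snd j - fst j)" by blast
      then have "fst i \<le> fst j" "snd j \<le> snd i" by auto
      then have "j \<in> R2" unfolding R2_def using i(1) j(5) by blast
      then show ?thesis using j by (intro bexI[of _ j]) auto
    qed
    obtain J where J: "finite J" "J \<subseteq> R2" "disjoint_ivls J" "\<And>i. i \<in> J \<Longrightarrow> fst i < snd i"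
      "measure lebesgue (E1 - (\<Union>i\<in>J. ivl i)) < \<epsilon>"
      using Vitali_finite[OF E1 R2 \<epsilon>(1)] by blast
    define Js where "Js i = {j\<in>J. fst i \<le> fst j \<and> snd j \<le> snd i}" for i
    have "\<forall>i\<in>C. \<exists>G. finite G \<and> (\<forall>g\<in>G. fst i \<le> fst g \<and> fst g < snd g \<and> snd g \<le> snd i) \<and> disjoint_ivls G \<and>
      (\<forall>F::real \<Rightarrow> real. F (snd i) - F (fst i) = (\<Sum>j\<in>Js i. F (snd j) - F (fst j)) + (\<Sum>j\<in>G. F (snd j) - F (fst j)))"
    proof
      fix i assume i: "i \<in> C"
      show "\<exists>G. finite G \<and> (\<forall>g\<in>G. fst i \<le> fst g \<and> fst g < snd g \<and> snd g \<le> snd i) \<and> disjoint_ivls G \<and>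
      (\<forall>F::real \<Rightarrow> real. F (snd i) - F (fst i) = (\<Sum>j\<in>Js i. F (snd j) - F (fst j)) + (\<Sum>j\<in>G. F (snd j) - F (fst j)))"
      proof (rule complementary_gaps)
        show "disjoint_ivls (Js i)" using J(3) by (rule pairwise_subset) (auto simp: Js_def)
        show "fst i \<le> snd i" using C(4)[OF i] by simp
      qed (use J(1,4) in \<open>auto simp: Js_def\<close>)
    qed
    from bchoice[OF this] obtain Gs where Gs: "\<And>i. i \<in> C \<Longrightarrow> finite (Gs i)"
      "\<And>i g. i \<in> C \<Longrightarrow> g \<in> Gs i \<Longrightarrow> fst i \<le> fst g \<and> fst g < snd g \<and> snd g \<le> snd i"
      "\<And>i. i \<in> C \<Longrightarrow> disjoint_ivls (Gs i)"
      "\<And>i (F::real \<Rightarrow> real). i \<in> C \<Longrightarrow> F (snd i) - F (fst i) = (\<Sum>j\<in>Js i. F (snd j) - F (fst j)) + (\<Sum>j\<in>Gs i. F (snd j) - F (fst j))"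
      by blast
    have sep: "ivl g \<inter> ivl g' = {}"
      if "i \<in> C" "i' \<in> C" "i \<noteq> i'" "fst i \<le> fst g" "snd g \<le> snd i" "fst i' \<le> fst g'" "snd g' \<le> snd i'" for i i' g g'
    proof -
      have "ivl g \<subseteq> ivl i" "ivl g' \<subseteq> ivl i'" using that by auto
      moreover have "ivl i \<inter> ivl i' = {}" using C(3) that unfolding pairwise_def disjnt_def by blast
      ultimately show ?thesis by blast
    qed
    have mid: "(fst g + snd g) / 2 \<in> ivl g" if "fst g < snd g" for g :: "real \<times> real"
      using that by (auto simp: field_simps)
    have JU: "J = (\<Union>i\<in>C. Js i)"
      using J(2) by (auto simp: Js_def R2_def)
    define G where "G = (\<Union>i\<in>C. Gs i)"
    have sumJ: "(\<Sum>j\<in>J. \<phi> j) = (\<Sum>i\<in>C. \<Sum>j\<in>Js i. \<phi> j)" for \<phi> :: "real \<times> real \<Rightarrow> real"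
      unfolding JU
    proof (rule sum.UNION_disjoint[OF C(1)])
      show "\<forall>i\<in>C. finite (Js i)" using J(1) by (auto simp: Js_def)
      show "\<forall>i\<in>C. \<forall>j\<in>C. i \<noteq> j \<longrightarrow> Js i \<inter> Js j = {}"
      proof (intro ballI impI equals0I)
        fix i i' g assume "i \<in> C" "i' \<in> C" "i \<noteq> i'" and g: "g \<in> Js i \<inter> Js i'"
        then have "ivl g \<inter> ivl g = {}" by (intro sep[of i i']) (auto simp: Js_def)
        then show False using mid[of g] g J(4)[of g] by (auto simp: Js_def)
      qed
    qed
    have sumG: "(\<Sum>j\<in>G. \<phi> j) = (\<Sum>i\<in>C. \<Sum>j\<in>Gs i. \<phi> j)" for \<phi> :: "real \<times> real \<Rightarrow> real"
      unfolding G_def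
    proof (rule sum.UNION_disjoint[OF C(1)])
      show "\<forall>i\<in>C. finite (Gs i)" using Gs(1) by blast
      show "\<forall>i\<in>C. \<forall>j\<in>C. i \<noteq> j \<longrightarrow> Gs i \<inter> Gs j = {}"
      proof (intro ballI impI equals0I)
        fix i i' g assume i: "i \<in> C" "i' \<in> C" "i \<noteq> i'" and g: "g \<in> Gs i \<inter> Gs i'"
        then have "ivl g \<inter> ivl g = {}" using Gs(2)[of i g] Gs(2)[of i' g] by (intro sep[of i i']) auto
        then show False using mid[of g] g Gs(2)[of i g] i by auto
      qed
    qed
    have total: "(\<Sum>i\<in>C. F (snd i) - F (fst i)) = (\<Sum>j\<in>J. F (snd j) - F (fst j)) + (\<Sum>j\<in>G. F (snd j) - F (fst j))"
      for F :: "real \<Rightarrow> real"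
      unfolding sumJ sumG sum.distrib[symmetric] using Gs(4) by (intro sum.cong) auto
    have Gdisj: "disjoint_ivls G"
      unfolding pairwise_def disjnt_def
    proof (intro ballI impI)
      fix g g' assume g: "g \<in> G" "g' \<in> G" "g \<noteq> g'"
      then obtain i i' where i: "i \<in> C" "g \<in> Gs i" "i' \<in> C" "g' \<in> Gs i'" unfolding G_def by blast
      show "ivl g \<inter> ivl g' = {}"
      proof (cases "i = i'")
        case True
        then show ?thesis using Gs(3)[of i] i g(3) unfolding pairwise_def disjnt_def by blast
      next
        case False
        then show ?thesis using Gs(2)[of i g] Gs(2)[of i' g'] i by (intro sep[of i i']) auto
      qed
    qed
    have lenC: "(\<Sum>i\<in>C. snd i - fst i) < measure lebesgue E + \<epsilon>"
    proof -
      have "(\<Sum>i\<in>C. snd i - fst i) = measure lebesgue (\<Union>i\<in>C. ivl i)"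
        using C by (intro sum_ivl_lengths) (auto simp: less_imp_le)
      also have "\<dots> \<le> measure lebesgue U"
        using Cb(3) UC Um by (intro measure_mono_fmeasurable) auto
      finally show ?thesis using mU by linarith
    qed
    have lenJ: "(\<Sum>j\<in>J. snd j - fst j) > measure lebesgue E - 2 * \<epsilon>"
      using measure_cover_le[OF E1 J(1,3,4,5)] mE1 by linarith
    have lenG: "(\<Sum>j\<in>G. snd j - fst j) = (\<Sum>i\<in>C. snd i - fst i) - (\<Sum>j\<in>J. snd j - fst j)"
      using total[of "\<lambda>x. x"] by linarith
    have "(\<Sum>j\<in>G. \<bar>f (snd j) - f (fst j)\<bar>) < e"
    proof (rule \<delta>)
      show "finite G" unfolding G_def using C(1) Gs(1) by blast
      show "(\<Sum>j\<in>G. snd j - fst j) < \<delta>" using lenG lenC lenJ \<epsilon>(2) by linarith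
      fix g assume "g \<in> G"
      then obtain i where "i \<in> C" "g \<in> Gs i" unfolding G_def by blast
      then show "0 \<le> fst g \<and> fst g \<le> snd g \<and> snd g \<le> 1" using Gs(2)[of i g] Cb(1,2)[of i] by linarith
    qed (rule Gdisj)
    moreover have "\<bar>\<Sum>j\<in>G. f (snd j) - f (fst j)\<bar> \<le> (\<Sum>j\<in>G. \<bar>f (snd j) - f (fst j)\<bar>)"
      by (rule sum_abs)
    moreover have "(\<Sum>i\<in>C. f (snd i) - f (fst i)) \<le> p * (\<Sum>i\<in>C. snd i - fst i)"
      unfolding sum_distrib_left using Cb(4) by (intro sum_mono) (auto simp: less_imp_le)
    moreover have "q * (\<Sum>i\<in>J. snd i - fst i) \<le> (\<Sum>j\<in>J. f (snd j) - f (fst j))"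
      unfolding sum_distrib_left using J(2) by (intro sum_mono) (auto simp: R2_def less_imp_le)
    ultimately have "q * (\<Sum>i\<in>J. snd i - fst i) \<le> p * (\<Sum>i\<in>C. snd i - fst i) + e"
      using total[of f] by linarith
    moreover have "(\<Sum>i\<in>C. snd i - fst i) = (\<Sum>i\<in>J. snd i - fst i) + (\<Sum>i\<in>G. snd i - fst i)"
      using lenG by linarith
    ultimately have "(q - p) * (\<Sum>i\<in>J. snd i - fst i) \<le> p * (\<Sum>i\<in>G. snd i - fst i) + e"
      by (simp add: algebra_simps)
    also have "p * (\<Sum>i\<in>G. snd i - fst i) \<le> \<bar>p\<bar> * (3 * e)"
    proof (rule order_trans[OF mult_right_mono[of p "\<bar>p\<bar>"] mult_left_mono])
      show "(\<Sum>i\<in>G. snd i - fst i) \<ge> 0"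
        using Gs(2) unfolding G_def by (intro sum_nonneg) (auto simp: less_imp_le)
      show "(\<Sum>i\<in>G. snd i - fst i) \<le> 3 * e" using lenG lenC lenJ \<epsilon>(3) by linarith
    qed auto
    finally have "(q - p) * (\<Sum>i\<in>J. snd i - fst i) \<le> (3 * \<bar>p\<bar> + 1) * e" by (simp add: algebra_simps)
    moreover have "(q - p) * (measure lebesgue E - 2 * e) \<le> (q - p) * (\<Sum>i\<in>J. snd i - fst i)"
      using lenJ \<epsilon>(3) \<open>p < q\<close> by (intro mult_left_mono) auto
    ultimately show ?thesis by linarith
  qed
  have "measure lebesgue E \<le> 0 + e" if "e > 0" for e
  proof -
    define k where "k = (3 * \<bar>p\<bar> + 1) / (q - p)"
    define c where "c = k + 2"
    have "c > 0" using \<open>p < q\<close> by (auto simp: c_def k_def intro!: add_nonneg_pos)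
    have "(q - p) * (measure lebesgue E - 2 * (e / c)) \<le> (3 * \<bar>p\<bar> + 1) * (e / c)"
      using bound[of "e / c"] \<open>e > 0\<close> \<open>c > 0\<close> by simp
    then have "measure lebesgue E - 2 * (e / c) \<le> (3 * \<bar>p\<bar> + 1) * (e / c) / (q - p)"
      using \<open>p < q\<close> by (subst pos_le_divide_eq) (auto simp: mult.commute)
    also have "\<dots> = k * (e / c)" by (simp add: k_def)
    finally have "measure lebesgue E \<le> (k + 2) * (e / c)" unfolding distrib_right by linarith
    then show ?thesis using \<open>c > 0\<close> by (simp add: c_def[symmetric])
  qed
  then have "measure lebesgue E \<le> 0" by (rule field_le_epsilon)
  then show ?thesis
    using E by (simp add: negligible_iff_measure measure_le_0_iff flip: E_def)
qed

lemma abs_continuous_on_uminus: "abs_continuous_on c d f \<Longrightarrow> abs_continuous_on c d (\<lambda>x. - f x)"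
  unfolding abs_continuous_on_def by (simp add: abs_minus_commute)

text \<open>Outside the exceptional null sets the slopes of shrinking intervals around \<open>x\<close> converge to the
  supremum \<open>L\<close> of all \<open>q\<close> with \<open>x \<in> steep f q\<close>.  Continuity of \<open>f\<close> then allows one end point of
  the interval to be moved to \<open>x\<close> itself.\<close>

lemma AC_differentiable_ae:
  assumes f: "abs_continuous_on 0 1 f"
  shows "negligible {x\<in>{0<..<1}. \<nexists>D. (f has_real_derivative D) (at x)}"
proof -
  let ?nf = "\<lambda>x. - f x"
  define N where "N = (\<Inter>k::nat. steep f (real k)) \<union> (\<Inter>k::nat. steep ?nf (real k))
     \<union> (\<Union>(p, q)\<in>{(p, q)\<in>\<rat> \<times> \<rat>. p < q}. steep f q \<inter> steep ?nf (- p))"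
  have "negligible N"
  proof -
    have "countable {(p, q)\<in>\<rat> \<times> (\<rat>::real set). p < q}"
      by (rule countable_subset[of _ "\<rat> \<times> \<rat>"]) (auto simp: countable_rat)
    then have "negligible (\<Union>(p, q)\<in>{(p, q)\<in>\<rat> \<times> \<rat>. p < q}. steep f q \<inter> steep ?nf (- p))"
      using negligible_steep_both[OF f] by (intro negligible_countable_Union) auto
    then show ?thesis
      unfolding N_def using negligible_steep_inf[OF f] negligible_steep_inf[OF abs_continuous_on_uminus[OF f]]
      by (intro negligible_Un)
  qed
  moreover have "\<exists>D. (f has_real_derivative D) (at x)" if x: "x \<in> {0<..<1}" "x \<notin> N" for x
  proof -
    obtain k1 :: nat where k1: "x \<notin> steep f (real k1)" using x(2) unfolding N_def by blast
    obtain k2 :: nat where k2: "x \<notin> steep ?nf (real k2)" using x(2) unfolding N_def by blast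
    have pq: "x \<notin> steep ?nf (- p)" if "p \<in> \<rat>" "q \<in> \<rat>" "p < q" "x \<in> steep f q" for p q
      using x(2) that unfolding N_def by blast
    define Q where "Q = {q. x \<in> steep f q}"
    have down: "q' \<in> Q" if "q \<in> Q" "q' \<le> q" for q q'
      using that steep_antimono unfolding Q_def by blast
    have bdd: "bdd_above Q"
    proof (rule bdd_aboveI)
      fix q assume "q \<in> Q"
      then show "q \<le> real k1" using down[of q "real k1"] k1 unfolding Q_def by force
    qed
    have "- real k2 - 1 \<in> Q"
    proof -
      obtain n0 where n0: "\<And>u v. 0 \<le> u \<Longrightarrow> u < x \<Longrightarrow> x < v \<Longrightarrow> v \<le> 1 \<Longrightarrow> v - u < 1 / Suc n0 \<Longrightarrow>
          - f v - - f u \<le> real k2 * (v - u)"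
        using not_steepD[OF k2] by blast
      have "x \<in> steep f (- real k2 - 1)"
        unfolding steep_def
      proof (intro INT_I)
        fix n :: nat
        \<comment> \<open>A symmetric interval around \<open>x\<close> that is short enough for both conditions and stays in \<open>[0, 1]\<close>.\<close>
        define e where "e = min (min x (1 - x)) (min (1 / Suc n0) (1 / Suc n)) / 3"
        have e: "e > 0" "3 * e \<le> x" "3 * e \<le> 1 - x" "3 * e \<le> 1 / Suc n0" "3 * e \<le> 1 / Suc n"
          using x(1) by (auto simp: e_def)
        have small: "x + e - (x - e) < 1 / Suc n0" using e by linarith
        have "- f (x + e) - - f (x - e) \<le> real k2 * (x + e - (x - e))"
          by (rule n0) (use e small in linarith)+
        then have "f (x + e) - f (x - e) > (- real k2 - 1) * (x + e - (x - e))"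
          using e(1) by (simp add: algebra_simps)
        then show "x \<in> (\<Union>i\<in>{i. 0 \<le> fst i \<and> snd i \<le> 1 \<and> snd i - fst i < 1 / Suc n
          \<and> f (snd i) - f (fst i) > (- real k2 - 1) * (snd i - fst i)}. ivl i)"
          using e by (intro UN_I[of "(x - e, x + e)"]) auto
      qed
      then show ?thesis unfolding Q_def by simp
    qed
    then have "Q \<noteq> {}" by blast
    define L where "L = Sup Q"
    have straddle: "\<exists>r>0. \<forall>u v. 0 \<le> u \<and> u < x \<and> x < v \<and> v \<le> 1 \<and> v - u < r \<longrightarrow>
        (L - e) * (v - u) \<le> f v - f u \<and> f v - f u \<le> (L + e) * (v - u)" if "e > 0" for e
    proof -
      have "x \<notin> steep f (L + e)"
      proof
        assume "x \<in> steep f (L + e)"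
        then have "L + e \<le> L" unfolding L_def Q_def[symmetric] by (intro cSup_upper bdd) (simp add: Q_def)
        then show False using \<open>e > 0\<close> by simp
      qed
      then obtain n1 where n1: "\<And>u v. 0 \<le> u \<Longrightarrow> u < x \<Longrightarrow> x < v \<Longrightarrow> v \<le> 1 \<Longrightarrow> v - u < 1 / Suc n1 \<Longrightarrow>
          f v - f u \<le> (L + e) * (v - u)"
        using not_steepD by blast
      obtain p where p: "p \<in> \<rat>" "L - e < p" "p < L" using Rats_dense_in_real[of "L - e" L] \<open>e > 0\<close> by auto
      obtain q where q: "q \<in> \<rat>" "p < q" "q < L" using Rats_dense_in_real[of p L] p by auto
      obtain q' where "q' \<in> Q" "q < q'"
        using less_cSupE[of q Q] \<open>Q \<noteq> {}\<close> q(3) unfolding L_def by blast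
      then have "x \<in> steep f q" using down[of q' q] unfolding Q_def by simp
      then have "x \<notin> steep ?nf (- p)" using pq p q by blast
      then obtain n2 where n2: "\<And>u v. 0 \<le> u \<Longrightarrow> u < x \<Longrightarrow> x < v \<Longrightarrow> v \<le> 1 \<Longrightarrow> v - u < 1 / Suc n2 \<Longrightarrow>
          - f v - - f u \<le> - p * (v - u)"
        using not_steepD by blast
      show ?thesis
      proof (intro exI[of _ "min (1 / Suc n1) (1 / Suc n2)"] conjI allI impI; (elim conjE)?)
        fix u v assume uv: "0 \<le> u" "u < x" "x < v" "v \<le> 1" "v - u < min (1 / real (Suc n1)) (1 / real (Suc n2))"
        then show "f v - f u \<le> (L + e) * (v - u)" using n1 by simp
        have "- f v - - f u \<le> - p * (v - u)" using n2 uv by simp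
        moreover have "(L - e) * (v - u) \<le> p * (v - u)" using p uv by (intro mult_right_mono) auto
        ultimately show "(L - e) * (v - u) \<le> f v - f u" by linarith
      qed simp
    qed
    have cont: "isCont f x"
      using abs_continuous_on_imp_continuous_on[OF f] x(1)
      by (intro continuous_on_interior[of "{0..1}"]) auto
    have "((\<lambda>y. (f y - f x) / (y - x)) \<longlongrightarrow> L) (at x)"
    proof (rule LIM_I)
      fix e :: real assume "e > 0"
      then obtain r where "r > 0" and r: "\<And>u v. 0 \<le> u \<Longrightarrow> u < x \<Longrightarrow> x < v \<Longrightarrow> v \<le> 1 \<Longrightarrow> v - u < r \<Longrightarrow>
        (L - e / 2) * (v - u) \<le> f v - f u \<and> f v - f u \<le> (L + e / 2) * (v - u)"
        using straddle[of "e / 2"] by auto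
      define s where "s = min r (min x (1 - x))"
      have s: "s > 0" "s \<le> r" "s \<le> x" "s \<le> 1 - x" using \<open>r > 0\<close> x(1) by (auto simp: s_def)
      have right: "(L - e / 2) * (v - x) \<le> f v - f x \<and> f v - f x \<le> (L + e / 2) * (v - x)"
        if v: "x < v" "v - x < s" for v
      proof -
        have ev: "\<forall>\<^sub>F u in at_left x. (L - e / 2) * (v - u) \<le> f v - f u \<and> f v - f u \<le> (L + e / 2) * (v - u)"
        proof -
          have "\<forall>\<^sub>F u in at_left x. u \<in> {max 0 (v - r)<..<x}"
            using v s x(1) by (intro eventually_at_left_real) auto
          then show ?thesis by eventually_elim (use r v s in auto)
        qed
        have lim: "(f \<longlongrightarrow> f x) (at_left x)" using cont by (simp add: isCont_def filterlim_at_split)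
        have lims: "((\<lambda>u. (L - e / 2) * (v - u)) \<longlongrightarrow> (L - e / 2) * (v - x)) (at_left x)"
          "((\<lambda>u. (L + e / 2) * (v - u)) \<longlongrightarrow> (L + e / 2) * (v - x)) (at_left x)"
          "((\<lambda>u. f v - f u) \<longlongrightarrow> f v - f x) (at_left x)"
          by (intro tendsto_intros lim)+
        show ?thesis
        proof
          show "(L - e / 2) * (v - x) \<le> f v - f x"
            by (rule tendsto_le[OF _ lims(3,1)]) (use ev in \<open>auto elim: eventually_mono\<close>)
          show "f v - f x \<le> (L + e / 2) * (v - x)"
            by (rule tendsto_le[OF _ lims(2,3)]) (use ev in \<open>auto elim: eventually_mono\<close>)
        qed
      qed
      have left: "(L - e / 2) * (x - u) \<le> f x - f u \<and> f x - f u \<le> (L + e / 2) * (x - u)"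
        if u: "u < x" "x - u < s" for u
      proof -
        have ev: "\<forall>\<^sub>F v in at_right x. (L - e / 2) * (v - u) \<le> f v - f u \<and> f v - f u \<le> (L + e / 2) * (v - u)"
        proof -
          have "\<forall>\<^sub>F v in at_right x. v \<in> {x<..<min 1 (u + r)}"
            using u s x(1) by (intro eventually_at_right_real) auto
          then show ?thesis by eventually_elim (use r u s in auto)
        qed
        have lim: "(f \<longlongrightarrow> f x) (at_right x)" using cont by (simp add: isCont_def filterlim_at_split)
        have lims: "((\<lambda>v. (L - e / 2) * (v - u)) \<longlongrightarrow> (L - e / 2) * (x - u)) (at_right x)"
          "((\<lambda>v. (L + e / 2) * (v - u)) \<longlongrightarrow> (L + e / 2) * (x - u)) (at_right x)"
          "((\<lambda>v. f v - f u) \<longlongrightarrow> f x - f u) (at_right x)"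
          by (intro tendsto_intros lim)+
        show ?thesis
        proof
          show "(L - e / 2) * (x - u) \<le> f x - f u"
            by (rule tendsto_le[OF _ lims(3,1)]) (use ev in \<open>auto elim: eventually_mono\<close>)
          show "f x - f u \<le> (L + e / 2) * (x - u)"
            by (rule tendsto_le[OF _ lims(2,3)]) (use ev in \<open>auto elim: eventually_mono\<close>)
        qed
      qed
      have "norm ((f y - f x) / (y - x) - L) < e" if y: "y \<noteq> x" "norm (y - x) < s" for y
      proof (cases "x < y")
        case True
        then have "L - e / 2 \<le> (f y - f x) / (y - x)" "(f y - f x) / (y - x) \<le> L + e / 2"
          using right[of y] y by (simp_all add: pos_le_divide_eq pos_divide_le_eq)
        then show ?thesis using \<open>e > 0\<close> by (auto simp: abs_less_iff)
      next
        case False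
        then have "y < x" using y by simp
        then have "L - e / 2 \<le> (f x - f y) / (x - y)" "(f x - f y) / (x - y) \<le> L + e / 2"
          using left[of y] y by (simp_all add: pos_le_divide_eq pos_divide_le_eq)
        moreover have "(f y - f x) / (y - x) = (f x - f y) / (x - y)"
          by (metis minus_diff_eq minus_divide_divide)
        ultimately show ?thesis using \<open>e > 0\<close> by (auto simp: abs_less_iff)
      qed
      then show "\<exists>s>0. \<forall>y. y \<noteq> x \<and> norm (y - x) < s \<longrightarrow> norm ((f y - f x) / (y - x) - L) < e"
        using s(1) by blast
    qed
    then show ?thesis by (auto simp: has_field_derivative_iff)
  qed
  ultimately show ?thesis by (blast intro: negligible_subset)
qed

section \<open>Nondecreasing one-Lipschitz paths\<close>

text \<open>The compact set that contains all rescaled height functions.\<close>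

definition admissible :: "(real \<Rightarrow> real) set" where
  "admissible = {f \<in> extensional {0..1}. f 0 = 0 \<and>
     (\<forall>x y. 0 \<le> x \<and> x \<le> y \<and> y \<le> 1 \<longrightarrow> 0 \<le> f y - f x \<and> f y - f x \<le> y - x)}"

lemma admissibleD:
  assumes "f \<in> admissible" "0 \<le> x" "x \<le> y" "y \<le> 1"
  shows "f x \<le> f y" "f y - f x \<le> y - x"
  using assms unfolding admissible_def by force+

lemma admissible_0: "f \<in> admissible \<Longrightarrow> f 0 = 0"
  unfolding admissible_def by simp

lemma admissible_bounds:
  assumes "f \<in> admissible" "x \<in> {0..1}" shows "0 \<le> f x" "f x \<le> x" "f x \<le> 1"
  using admissibleD[OF assms(1), of 0 x] assms by (auto simp: admissible_0)

lemma admissible_Lipschitz: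
  assumes "f \<in> admissible" "x \<in> {0..1}" "y \<in> {0..1}" shows "\<bar>f x - f y\<bar> \<le> \<bar>x - y\<bar>"
  using admissibleD[OF assms(1), of x y] admissibleD[OF assms(1), of y x] assms by (cases "x \<le> y") auto

lemma admissible_abs_continuous:
  assumes f: "f \<in> admissible"
  shows "abs_continuous_on 0 1 f"
  unfolding abs_continuous_on_def
proof (intro allI impI)
  fix \<epsilon> :: real assume "\<epsilon> > 0"
  show "\<exists>\<delta>>0. \<forall>(n::nat) u v. (\<forall>i<n. 0 \<le> u i \<and> u i \<le> v i \<and> v i \<le> 1) \<and>
       disjoint_family_on (\<lambda>i. {u i<..<v i}) {..<n} \<and> (\<Sum>i<n. v i - u i) < \<delta> \<longrightarrow>
       (\<Sum>i<n. \<bar>f (v i) - f (u i)\<bar>) < \<epsilon>"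
  proof (intro exI[of _ \<epsilon>] conjI allI impI)
    fix n :: nat and u v :: "nat \<Rightarrow> real"
    assume A: "(\<forall>i<n. 0 \<le> u i \<and> u i \<le> v i \<and> v i \<le> 1) \<and>
         disjoint_family_on (\<lambda>i. {u i<..<v i}) {..<n} \<and> (\<Sum>i<n. v i - u i) < \<epsilon>"
    then have uv: "\<forall>i<n. 0 \<le> u i \<and> u i \<le> v i \<and> v i \<le> 1" and "(\<Sum>i<n. v i - u i) < \<epsilon>"
      by blast+
    moreover have "(\<Sum>i<n. \<bar>f (v i) - f (u i)\<bar>) \<le> (\<Sum>i<n. v i - u i)"
    proof (rule sum_mono)
      fix i assume "i \<in> {..<n}"
      then show "\<bar>f (v i) - f (u i)\<bar> \<le> v i - u i" using admissibleD[OF f, of "u i" "v i"] uv by simp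
    qed
    ultimately show "(\<Sum>i<n. \<bar>f (v i) - f (u i)\<bar>) < \<epsilon>" by linarith
  qed (rule \<open>\<epsilon> > 0\<close>)
qed

text \<open>Both \<open>f\<close> and \<open>x - f x\<close> have nonnegative derivative almost everywhere.\<close>

lemma admissible_if_deriv_01:
  assumes ext: "f \<in> extensional {0..1}" and f: "abs_continuous_on 0 1 f" and "f 0 = 0"
    and deriv: "negligible {x\<in>{0<..<1}. deriv f x \<notin> {0..1}}"
  shows "f \<in> admissible"
proof -
  define N where "N = {x\<in>{0<..<1}. \<nexists>D. (f has_real_derivative D) (at x)} \<union> {x\<in>{0<..<1}. deriv f x \<notin> {0..1}}"
  have N: "negligible N" unfolding N_def using AC_differentiable_ae[OF f] deriv by (rule negligible_Un)
  have D: "(f has_real_derivative deriv f x) (at x)" "deriv f x \<in> {0..1}" if "x \<in> {0<..<1} - N" for x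
    using that DERIV_imp_deriv[of f _ x] unfolding N_def by auto
  have g: "abs_continuous_on 0 1 (\<lambda>x. x - f x)"
    unfolding abs_continuous_on_def
  proof (intro allI impI)
    fix \<epsilon> :: real assume "\<epsilon> > 0"
    then have "\<epsilon> / 2 > 0" by simp
    from f[unfolded abs_continuous_on_def, THEN spec, THEN mp, OF this]
    obtain \<delta> where "\<delta> > 0" and \<delta>: "\<forall>(n::nat) u v. (\<forall>i<n. 0 \<le> u i \<and> u i \<le> v i \<and> v i \<le> 1) \<and>
        disjoint_family_on (\<lambda>i. {u i<..<v i}) {..<n} \<and>
        (\<Sum>i<n. v i - u i) < \<delta> \<longrightarrow> (\<Sum>i<n. \<bar>f (v i) - f (u i)\<bar>) < \<epsilon> / 2"
      by (elim exE conjE)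
    show "\<exists>\<delta>>0. \<forall>(n::nat) u v. (\<forall>i<n. 0 \<le> u i \<and> u i \<le> v i \<and> v i \<le> 1) \<and>
       disjoint_family_on (\<lambda>i. {u i<..<v i}) {..<n} \<and> (\<Sum>i<n. v i - u i) < \<delta> \<longrightarrow>
       (\<Sum>i<n. \<bar>v i - f (v i) - (u i - f (u i))\<bar>) < \<epsilon>"
    proof (intro exI[of _ "min \<delta> (\<epsilon> / 2)"] conjI allI impI)
      fix n :: nat and u v :: "nat \<Rightarrow> real"
      assume A: "(\<forall>i<n. 0 \<le> u i \<and> u i \<le> v i \<and> v i \<le> 1) \<and>
         disjoint_family_on (\<lambda>i. {u i<..<v i}) {..<n} \<and> (\<Sum>i<n. v i - u i) < min \<delta> (\<epsilon> / 2)"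
      then have "(\<Sum>i<n. \<bar>f (v i) - f (u i)\<bar>) < \<epsilon> / 2"
        by (intro \<delta>[THEN spec, THEN spec, THEN spec, THEN mp]) auto
      moreover have "(\<Sum>i<n. \<bar>v i - f (v i) - (u i - f (u i))\<bar>) \<le> (\<Sum>i<n. (v i - u i) + \<bar>f (v i) - f (u i)\<bar>)"
        using A by (intro sum_mono) auto
      ultimately show "(\<Sum>i<n. \<bar>v i - f (v i) - (u i - f (u i))\<bar>) < \<epsilon>"
        using A by (simp add: sum.distrib)
    qed (use \<open>\<delta> > 0\<close> \<open>\<epsilon> > 0\<close> in auto)
  qed
  have "0 \<le> f y - f x \<and> f y - f x \<le> y - x" if xy: "0 \<le> x" "x \<le> y" "y \<le> 1" for x y
  proof -
    have "f x \<le> f y"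
    proof (rule abs_continuous_on_mono[OF f xy N])
      fix z assume "z \<in> {x<..<y} - N"
      then have "z \<in> {0<..<1} - N" using xy by auto
      from D[OF this] show "\<exists>D\<ge>0. (f has_real_derivative D) (at z)" by auto
    qed
    moreover have "x - f x \<le> y - f y"
    proof (rule abs_continuous_on_mono[OF g xy N])
      fix z assume "z \<in> {x<..<y} - N"
      then have "z \<in> {0<..<1} - N" using xy by auto
      from D[OF this] show "\<exists>D\<ge>0. ((\<lambda>x. x - f x) has_real_derivative D) (at z)"
        by (intro exI[of _ "1 - deriv f z"]) (auto intro!: derivative_eq_intros)
    qed
    ultimately show ?thesis by linarith
  qed
  then show ?thesis using assms unfolding admissible_def by simp
qed

lemma admissible_deriv_ae:
  assumes f: "f \<in> admissible"
  shows "negligible {x\<in>{0<..<1}. \<not> ((f has_real_derivative deriv f x) (at x) \<and> deriv f x \<in> {0..1})}"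
proof (rule negligible_subset[OF AC_differentiable_ae[OF admissible_abs_continuous[OF f]]])
  have "deriv f x \<in> {0..1}" if x: "x \<in> {0<..<1}" and D: "(f has_real_derivative deriv f x) (at x)" for x
  proof -
    have lim: "((\<lambda>y. (f y - f x) / (y - x)) \<longlongrightarrow> deriv f x) (at_right x)"
      using D unfolding has_field_derivative_iff by (simp add: filterlim_at_split)
    have "\<forall>\<^sub>F y in at_right x. y \<in> {x<..<1}" using x by (intro eventually_at_right_real) auto
    then have "\<forall>\<^sub>F y in at_right x. (f y - f x) / (y - x) \<in> {0..1}"
    proof eventually_elim
      case (elim y)
      then show ?case using admissibleD[OF f, of x y] x by auto
    qed
    then show ?thesis
      by (intro Lim_in_closed_set[OF closed_atLeastAtMost _ _ lim]) auto
  qed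
  then show "{x\<in>{0<..<1}. \<not> ((f has_real_derivative deriv f x) (at x) \<and> deriv f x \<in> {0..1})}
    \<subseteq> {x\<in>{0<..<1}. \<nexists>D. (f has_real_derivative D) (at x)}"
    using DERIV_imp_deriv[of f] by blast
qed

section \<open>The entropy and its integral along a path\<close>

text \<open>The finite branch of \<open>h\<close>.\<close>

definition eta :: "real \<Rightarrow> real" where
  "eta x = x * ln x + (1 - x) * ln (1 - x)"

lemma continuous_on_x_ln_x: "continuous_on {0..1} (\<lambda>x::real. x * ln x)"
proof -
  have bound: "\<bar>x * ln x\<bar> \<le> 2 * sqrt x" if x: "0 \<le> x" "x \<le> 1" for x :: real
  proof (cases "x = 0")
    case False
    then have "x > 0" using x by simp
    have "- ln x = 2 * ln (1 / sqrt x)" using \<open>x > 0\<close> by (simp add: ln_div ln_sqrt)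
    also have "\<dots> \<le> 2 * (1 / sqrt x)" using ln_le_minus_one[of "1 / sqrt x"] \<open>x > 0\<close> by simp
    finally have "x * - ln x \<le> x * (2 * (1 / sqrt x))" using \<open>x > 0\<close> by (intro mult_left_mono) auto
    also have "\<dots> = 2 * sqrt x" using \<open>x > 0\<close> by (simp add: field_simps)
    finally show ?thesis using \<open>x > 0\<close> x by (simp add: abs_mult)
  qed simp
  have "((\<lambda>x::real. x * ln x) \<longlongrightarrow> 0) (at 0 within {0..1})"
  proof (rule Lim_null_comparison)
    show "\<forall>\<^sub>F x in at 0 within {0..1}. norm (x * ln x) \<le> 2 * sqrt x"
      unfolding eventually_at_filter using bound by (intro always_eventually) auto
    have "((\<lambda>x::real. 2 * sqrt x) \<longlongrightarrow> 2 * sqrt 0) (at 0 within {0..1})"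
      by (intro tendsto_intros)
    then show "((\<lambda>x::real. 2 * sqrt x) \<longlongrightarrow> 0) (at 0 within {0..1})" by simp
  qed
  then have "continuous (at 0 within {0..1}) (\<lambda>x::real. x * ln x)"
    by (simp add: continuous_within)
  moreover have "continuous (at x within {0..1}) (\<lambda>x::real. x * ln x)" if "x > 0" for x
    using that by (intro continuous_intros) auto
  ultimately show ?thesis
    unfolding continuous_on_eq_continuous_within by (metis atLeastAtMost_iff less_eq_real_def)
qed

lemma continuous_on_eta: "continuous_on {0..1} eta"
proof -
  have "continuous_on {0..1} (\<lambda>x::real. (1 - x) * ln (1 - x))"
    by (rule continuous_on_compose2[OF continuous_on_x_ln_x]) (auto intro!: continuous_intros)
  then show ?thesis
    unfolding eta_def[abs_def] using continuous_on_x_ln_x by (intro continuous_on_add)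
qed

lemma x_ln_x_nonpos: "0 \<le> x \<Longrightarrow> x \<le> 1 \<Longrightarrow> x * ln x \<le> (0::real)"
  by (cases "x = 0") (auto simp: mult_le_0_iff)

lemma eta_nonpos: "0 \<le> x \<Longrightarrow> x \<le> 1 \<Longrightarrow> eta x \<le> 0"
  unfolding eta_def using x_ln_x_nonpos[of x] x_ln_x_nonpos[of "1 - x"] by simp

text \<open>The Legendre transform of \<open>eta\<close> is \<open>\<theta> \<mapsto> ln (1 + exp \<theta>)\<close>.  Apply \<open>ln u \<le> u - 1\<close> to the ratios of the
  probabilities \<open>exp \<theta> / Z\<close>, \<open>1 / Z\<close> to \<open>y\<close>, \<open>1 - y\<close>.\<close>

lemma eta_Fenchel:
  assumes "0 \<le> y" "y \<le> 1"
  shows "\<theta> * y - ln (1 + exp \<theta>) \<le> eta y"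
proof -
  consider "y = 0" | "y = 1" | "0 < y" "y < 1" using assms by linarith
  then show ?thesis
  proof cases
    case 2
    have "\<theta> = ln (exp \<theta>)" by simp
    also have "\<dots> \<le> ln (1 + exp \<theta>)" by (subst ln_le_cancel_iff) (auto simp: add_pos_pos)
    finally show ?thesis using 2 by (simp add: eta_def)
  next
    case 3
    define Z where "Z = 1 + exp \<theta>"
    have Z: "Z > 0" by (simp add: Z_def add_pos_pos)
    have A: "\<theta> - ln y - ln Z \<le> exp \<theta> / (y * Z) - 1"
      using ln_le_minus_one[of "exp \<theta> / (y * Z)"] 3 Z by (simp add: ln_div ln_mult)
    have B: "- ln (1 - y) - ln Z \<le> 1 / ((1 - y) * Z) - 1"
      using ln_le_minus_one[of "1 / ((1 - y) * Z)"] 3 Z by (simp add: ln_div ln_mult)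
    have "y * (\<theta> - ln y - ln Z) + (1 - y) * (- ln (1 - y) - ln Z)
        \<le> y * (exp \<theta> / (y * Z) - 1) + (1 - y) * (1 / ((1 - y) * Z) - 1)"
      using A B 3 by (intro add_mono mult_left_mono) auto
    also have "\<dots> = (exp \<theta> + 1) / Z - 1"
      using 3 Z by (simp add: right_diff_distrib add_divide_distrib)
    also have "\<dots> = 0" using Z by (simp add: Z_def add.commute)
    finally show ?thesis by (simp add: eta_def Z_def algebra_simps)
  qed (simp add: eta_def ln_ge_zero)
qed

text \<open>The converse half of Legendre duality: \<open>eta p\<close> is the supremum over \<open>\<theta>\<close>, attained in
  the interior and approached for \<open>\<theta> \<rightarrow> \<plusminus>\<infinity>\<close> at the end points.\<close>

lemma eta_le_if_Fenchel:
  assumes p: "0 \<le> p" "p \<le> 1" and c: "\<And>\<theta>. \<theta> * p - ln (1 + exp \<theta>) \<le> c"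
  shows "eta p \<le> c"
proof -
  have edge: "0 \<le> c" if "\<And>\<theta>. - ln (1 + exp \<theta>) \<le> c"
  proof (rule ccontr)
    assume "\<not> 0 \<le> c"
    then have "c < 0" by simp
    define E where "E = exp (- c)"
    have E: "E > 1" unfolding E_def using \<open>c < 0\<close> by simp
    \<comment> \<open>A \<open>\<theta>\<close> so negative that \<open>ln (1 + exp \<theta>) < - c\<close>.\<close>
    define \<theta> where "\<theta> = ln ((E - 1) / 2)"
    have "exp \<theta> = (E - 1) / 2" unfolding \<theta>_def using E by simp
    then have "1 + exp \<theta> < exp (- c)" using E unfolding E_def[symmetric] by simp
    then have "ln (1 + exp \<theta>) < - c" by (metis add_pos_pos exp_gt_zero ln_less_cancel_iff ln_exp zero_less_one)
    then show False using that[of \<theta>] by simp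
  qed
  consider "p = 0" | "p = 1" | "0 < p" "p < 1" using p by linarith
  then show ?thesis
  proof cases
    case 1
    then show ?thesis using edge c by (simp add: eta_def)
  next
    case 2
    have "- ln (1 + exp \<theta>) \<le> c" for \<theta>
    proof -
      have "1 + exp (- \<theta>) = (1 + exp \<theta>) / exp \<theta>" by (simp add: exp_minus field_simps)
      moreover have "1 + exp \<theta> > 0" by (simp add: add_pos_pos)
      ultimately have "ln (1 + exp (- \<theta>)) = ln (1 + exp \<theta>) - \<theta>"
        by (simp only: ln_divide_pos exp_gt_zero ln_exp)
      then show ?thesis using c[of "- \<theta>"] 2 by simp
    qed
    then show ?thesis using edge 2 by (simp add: eta_def)
  next
    case 3
    define \<theta> where "\<theta> = ln (p / (1 - p))"
    have "exp \<theta> = p / (1 - p)" unfolding \<theta>_def using 3 by simp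
    then have "1 + exp \<theta> = 1 / (1 - p)" using 3 by (simp add: field_simps)
    then have L: "ln (1 + exp \<theta>) = - ln (1 - p)" using 3 by (simp add: ln_div)
    have T: "\<theta> = ln p - ln (1 - p)" unfolding \<theta>_def using 3 by (simp add: ln_div)
    have "(ln p - ln (1 - p)) * p - - ln (1 - p) \<le> c" using c[of \<theta>] unfolding L T[symmetric] .
    then show ?thesis by (simp add: eta_def algebra_simps)
  qed
qed

lemma has_integral_step:
  fixes g c :: "_ \<Rightarrow> real"
  assumes "w \<ge> 0" "\<And>j x. j < n \<Longrightarrow> s + real j * w < x \<Longrightarrow> x < s + real (Suc j) * w \<Longrightarrow> g x = c j"
  shows "(g has_integral (\<Sum>j<n. w * c j)) {s..s + real n * w}"
  using assms(2)
proof (induction n)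
  case 0
  then show ?case by (simp add: has_integral_refl)
next
  case (Suc n)
  have "((\<lambda>x. c n) has_integral w * c n) {s + real n * w..s + real (Suc n) * w}"
    using has_integral_const_real[of "c n" "s + real n * w" "s + real (Suc n) * w"] \<open>w \<ge> 0\<close>
    by (simp add: algebra_simps)
  then have "(g has_integral w * c n) {s + real n * w..s + real (Suc n) * w}"
    using Suc.prems[of n] has_integral_spike_interior[of "\<lambda>x. c n" "w * c n" "s + real n * w" "s + real (Suc n) * w" g]
    by simp
  moreover have "(g has_integral (\<Sum>j<n. w * c j)) {s..s + real n * w}"
    using Suc.prems by (intro Suc.IH) auto
  moreover have "s \<le> s + real n * w" "s + real n * w \<le> s + real (Suc n) * w"
    using \<open>w \<ge> 0\<close> by (auto simp: algebra_simps)
  ultimately show ?case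
    using has_integral_combine[of s "s + real n * w" "s + real (Suc n) * w" g] by simp
qed

text \<open>The end points may coincide with \<open>x\<close>, so that grid points need no separate treatment.\<close>

lemma straddle_slope_tendsto:
  fixes f :: "real \<Rightarrow> real"
  assumes D: "(f has_real_derivative D) (at x)"
    and uv: "\<And>n. u n \<le> x" "\<And>n. x \<le> v n" "\<And>n. u n < v n" "(\<lambda>n. v n - u n) \<longlonglongrightarrow> 0"
  shows "(\<lambda>n. (f (v n) - f (u n)) / (v n - u n)) \<longlonglongrightarrow> D"
proof (rule LIMSEQ_I)
  fix e :: real assume "e > 0"
  have "((\<lambda>y. (f y - f x) / (y - x)) \<longlongrightarrow> D) (at x)" using D by (simp add: has_field_derivative_iff)
  from LIM_D[OF this, of "e / 2"] \<open>e > 0\<close>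
  obtain r where "r > 0" and r: "\<And>y. y \<noteq> x \<Longrightarrow> norm (y - x) < r \<Longrightarrow> norm ((f y - f x) / (y - x) - D) < e / 2" by auto
  have near: "\<bar>f y - f x - D * (y - x)\<bar> \<le> e / 2 * \<bar>y - x\<bar>" if "\<bar>y - x\<bar> < r" for y
  proof (cases "y = x")
    case False
    have eq: "f y - f x - D * (y - x) = ((f y - f x) / (y - x) - D) * (y - x)"
      using False by (simp add: field_simps)
    have "\<bar>(f y - f x) / (y - x) - D\<bar> \<le> e / 2" using r[of y] that False by simp
    then show ?thesis unfolding eq abs_mult by (intro mult_right_mono) auto
  qed simp
  obtain n0 where n0: "\<And>n. n \<ge> n0 \<Longrightarrow> norm (v n - u n - 0) < r"
    using LIMSEQ_D[OF uv(4) \<open>r > 0\<close>] by blast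
  have "norm ((f (v n) - f (u n)) / (v n - u n) - D) < e" if "n \<ge> n0" for n
  proof -
    have "v n - u n < r" using n0[OF that] uv(3)[of n] by simp
    then have "\<bar>f (v n) - f x - D * (v n - x)\<bar> \<le> e / 2 * (v n - x)"
      "\<bar>f (u n) - f x - D * (u n - x)\<bar> \<le> e / 2 * (x - u n)"
      using near[of "v n"] near[of "u n"] uv(1,2)[of n] by auto
    moreover have "f (v n) - f (u n) - D * (v n - u n)
        = (f (v n) - f x - D * (v n - x)) - (f (u n) - f x - D * (u n - x))"
      by (simp add: algebra_simps)
    moreover have "e / 2 * (v n - u n) = e / 2 * (v n - x) + e / 2 * (x - u n)"
      unfolding distrib_left[symmetric] by simp
    ultimately have "\<bar>f (v n) - f (u n) - D * (v n - u n)\<bar> \<le> e / 2 * (v n - u n)"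
      by linarith
    then have "\<bar>(f (v n) - f (u n) - D * (v n - u n)) / (v n - u n)\<bar> \<le> e / 2"
      using uv(3)[of n] by (simp add: abs_divide pos_divide_le_eq)
    moreover have "(f (v n) - f (u n) - D * (v n - u n)) / (v n - u n) = (f (v n) - f (u n)) / (v n - u n) - D"
      using uv(3)[of n] by (simp add: diff_divide_distrib)
    ultimately show ?thesis using \<open>e > 0\<close> by simp
  qed
  then show "\<exists>n0. \<forall>n\<ge>n0. norm ((f (v n) - f (u n)) / (v n - u n) - D) < e" by blast
qed

text \<open>The Riemann sums are the integrals of step functions whose value on each cell is \<open>\<phi>\<close> of the mean
  slope of \<open>f\<close>.  At a point of differentiability these slopes converge to the derivative, and
  dominated convergence applies.  The identity in place of \<open>\<phi>\<close> gives the fundamental theorem of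
  calculus, and \<open>eta\<close> the convergence of the discretised entropy.\<close>

lemma admissible_step_integral_tendsto:
  assumes f: "f \<in> admissible" and st: "0 \<le> s" "s < t" "t \<le> 1" and \<phi>: "continuous_on {0..1} \<phi>"
  shows "(\<lambda>x. \<phi> (deriv f x)) integrable_on {s..t}"
    "(\<lambda>n. \<Sum>j<Suc n. (t - s) / Suc n * \<phi> ((f (s + real (Suc j) * ((t - s) / Suc n))
         - f (s + real j * ((t - s) / Suc n))) / ((t - s) / Suc n)))
      \<longlonglongrightarrow> integral {s..t} (\<lambda>x. \<phi> (deriv f x))"
proof -
  define w where "w n = (t - s) / real (Suc n)" for n
  have w: "w n > 0" "s + real (Suc n) * w n = t" for n using st by (auto simp: w_def)
  define slope where "slope n j = (f (s + real (Suc j) * w n) - f (s + real j * w n)) / w n" for n j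
  define k where "k n x = nat \<lfloor>(x - s) / w n\<rfloor>" for n x
  define g where "g n x = \<phi> (slope n (k n x))" for n x
  have cell: "k n x = j" if "s + real j * w n \<le> x" "x < s + real (Suc j) * w n" for n j x
  proof -
    have "real j \<le> (x - s) / w n" "(x - s) / w n < real j + 1"
      using that w(1)[of n] by (simp_all add: pos_le_divide_eq pos_divide_less_eq algebra_simps)
    then have "\<lfloor>(x - s) / w n\<rfloor> = int j" by (intro floor_unique) auto
    then show ?thesis by (simp add: k_def)
  qed
  have k: "s + real (k n x) * w n \<le> x" "x < s + real (Suc (k n x)) * w n" "k n x < Suc n" if "s \<le> x" "x < t" for n x
  proof -
    have nn: "(x - s) / w n \<ge> 0" using that w(1)[of n] by simp
    then have fl: "real (k n x) \<le> (x - s) / w n" "(x - s) / w n < real (k n x) + 1"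
      unfolding k_def by (auto simp: of_nat_nat)
    then show "s + real (k n x) * w n \<le> x" "x < s + real (Suc (k n x)) * w n"
      using w(1)[of n] by (simp_all add: pos_le_divide_eq pos_divide_less_eq algebra_simps)
    have "(x - s) / w n < real (Suc n)" using that w(1,2)[of n] by (simp add: pos_divide_less_eq algebra_simps)
    then have "real (k n x) < real (Suc n)" using fl(1) by linarith
    then show "k n x < Suc n" by simp
  qed
  have slope01: "slope n j \<in> {0..1}" if "j < Suc n" for n j
  proof -
    have "real (Suc j) * w n \<le> real (Suc n) * w n" using that w(1)[of n] by (intro mult_right_mono) auto
    then have "s + real (Suc j) * w n \<le> 1" using w(2)[of n] st(3) by linarith
    moreover have "0 \<le> s + real j * w n" using st w(1)[of n] by simp
    moreover have "s + real j * w n \<le> s + real (Suc j) * w n" using w(1)[of n] by (simp add: algebra_simps)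
    ultimately have "0 \<le> f (s + real (Suc j) * w n) - f (s + real j * w n)"
      "f (s + real (Suc j) * w n) - f (s + real j * w n) \<le> w n"
      using admissibleD[OF f, of "s + real j * w n" "s + real (Suc j) * w n"] by (auto simp: algebra_simps)
    then show ?thesis using w(1)[of n] by (simp add: slope_def pos_divide_le_eq)
  qed
  have int: "(g n has_integral (\<Sum>j<Suc n. w n * \<phi> (slope n j))) {s..t}" for n
  proof -
    have "(g n has_integral (\<Sum>j<Suc n. w n * \<phi> (slope n j))) {s..s + real (Suc n) * w n}"
    proof (rule has_integral_step)
      fix j x assume "s + real j * w n < x" "x < s + real (Suc j) * w n"
      then show "g n x = \<phi> (slope n j)" using cell[of j n x] by (simp only: g_def less_imp_le)
    qed (use w(1)[of n] in simp)
    then show ?thesis by (simp only: w(2))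
  qed
  define N where "N = {x\<in>{0<..<1}. \<not> ((f has_real_derivative deriv f x) (at x) \<and> deriv f x \<in> {0..1})} \<union> {s, t}"
  have N: "negligible N" unfolding N_def using admissible_deriv_ae[OF f] by (intro negligible_Un) auto
  have "compact (\<phi> ` {0..1})" using \<phi> by (rule compact_continuous_image) simp
  then obtain B where B: "\<And>y. y \<in> {0..1} \<Longrightarrow> norm (\<phi> y) \<le> B"
    using compact_imp_bounded bounded_iff by (metis image_eqI)
  define g' where "g' n x = (if x \<in> N then 0 else g n x)" for n x
  define h' where "h' x = (if x \<in> N then 0 else \<phi> (deriv f x))" for x
  have int': "(g' n has_integral (\<Sum>j<Suc n. w n * \<phi> (slope n j))) {s..t}" for n
    by (rule has_integral_spike[OF N _ int[of n]]) (simp add: g'_def)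
  have bound: "norm (g' n x) \<le> B" if "x \<in> {s..t}" for n x
  proof (cases "x \<in> N")
    case False
    then have "s \<le> x" "x < t" using that unfolding N_def by auto
    then show ?thesis using False B[OF slope01[OF k(3)]] by (simp add: g'_def g_def)
  next
    case True
    then show ?thesis using B[of 0] by (simp add: g'_def)
  qed
  have conv: "(\<lambda>n. g' n x) \<longlonglongrightarrow> h' x" if x: "x \<in> {s..t}" for x
  proof (cases "x \<in> N")
    case False
    then have xs: "s < x" "x < t" and D: "(f has_real_derivative deriv f x) (at x)" "deriv f x \<in> {0..1}"
      using x st unfolding N_def by auto
    have "(\<lambda>n. (t - s) * (1 / real (Suc n))) \<longlonglongrightarrow> (t - s) * 0"
      using LIMSEQ_inverse_real_of_nat by (intro tendsto_mult tendsto_const) (simp add: inverse_eq_divide)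
    then have w0: "w \<longlonglongrightarrow> 0" by (simp add: w_def[abs_def])
    have "(\<lambda>n. (f (s + real (Suc (k n x)) * w n) - f (s + real (k n x) * w n))
        / (s + real (Suc (k n x)) * w n - (s + real (k n x) * w n))) \<longlonglongrightarrow> deriv f x"
    proof (rule straddle_slope_tendsto[OF D(1)])
      show "(\<lambda>n. s + real (Suc (k n x)) * w n - (s + real (k n x) * w n)) \<longlonglongrightarrow> 0"
        using w0 by (simp add: algebra_simps)
    qed (use k xs w(1) in \<open>auto simp: less_imp_le\<close>)
    then have "(\<lambda>n. slope n (k n x)) \<longlonglongrightarrow> deriv f x"
      unfolding slope_def by (simp add: algebra_simps)
    then have "(\<lambda>n. \<phi> (slope n (k n x))) \<longlonglongrightarrow> \<phi> (deriv f x)"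
      using slope01 k(3) xs D(2)
      by (intro continuous_on_tendsto_compose[OF \<phi>]) (auto intro!: always_eventually simp del: atLeastAtMost_iff)
    then show ?thesis using False by (simp add: g'_def h'_def g_def)
  qed (simp add: g'_def h'_def)
  note dc = dominated_convergence[of g' "{s..t}" "\<lambda>_. B" h', OF has_integral_integrable[OF int'] _ bound conv]
  have h'_int: "h' integrable_on {s..t}" and lim: "(\<lambda>n. integral {s..t} (g' n)) \<longlonglongrightarrow> integral {s..t} h'"
    using dc by auto
  have spike: "((\<lambda>x. \<phi> (deriv f x)) has_integral integral {s..t} h') {s..t}"
    by (rule has_integral_spike[OF N _ integrable_integral[OF h'_int]]) (simp add: h'_def)
  then show "(\<lambda>x. \<phi> (deriv f x)) integrable_on {s..t}" by blast
  show "(\<lambda>n. \<Sum>j<Suc n. (t - s) / Suc n * \<phi> ((f (s + real (Suc j) * ((t - s) / Suc n))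
         - f (s + real j * ((t - s) / Suc n))) / ((t - s) / Suc n)))
      \<longlonglongrightarrow> integral {s..t} (\<lambda>x. \<phi> (deriv f x))"
    using lim unfolding integral_unique[OF spike] integral_unique[OF int'] slope_def w_def .
qed

lemma admissible_FTC:
  assumes f: "f \<in> admissible" and st: "0 \<le> s" "s \<le> t" "t \<le> 1"
  shows "(deriv f has_integral f t - f s) {s..t}"
proof (cases "s = t")
  case True
  then show ?thesis by (simp add: has_integral_refl)
next
  case False
  then have "s < t" using st by simp
  note lim = admissible_step_integral_tendsto[OF f st(1) \<open>s < t\<close> st(3), of "\<lambda>x. x"]
  have "(\<Sum>j<Suc n. (t - s) / Suc n * ((f (s + real (Suc j) * ((t - s) / Suc n))
         - f (s + real j * ((t - s) / Suc n))) / ((t - s) / Suc n))) = f t - f s" for n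
  proof -
    have "(\<Sum>j<Suc n. (t - s) / Suc n * ((f (s + real (Suc j) * ((t - s) / Suc n))
         - f (s + real j * ((t - s) / Suc n))) / ((t - s) / Suc n)))
      = (\<Sum>j<Suc n. f (s + real (Suc j) * ((t - s) / Suc n)) - f (s + real j * ((t - s) / Suc n)))"
      using \<open>s < t\<close> by (intro sum.cong refl) (simp del: of_nat_Suc)
    also have "\<dots> = f (s + real (Suc n) * ((t - s) / Suc n)) - f (s + real 0 * ((t - s) / Suc n))"
      by (rule sum_lessThan_telescope)
    finally show ?thesis by (simp del: of_nat_Suc)
  qed
  with lim(2) have "(\<lambda>n. f t - f s) \<longlonglongrightarrow> integral {s..t} (deriv f)" by (simp only: continuous_on_id)
  then have "integral {s..t} (deriv f) = f t - f s" using LIMSEQ_unique tendsto_const by blast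
  then show ?thesis using lim(1) by (metis continuous_on_id has_integral_integral)
qed

lemma admissible_eta_integrable:
  assumes "f \<in> admissible" "0 \<le> s" "s \<le> t" "t \<le> 1"
  shows "(\<lambda>x. eta (deriv f x)) integrable_on {s..t}"
  using admissible_step_integral_tendsto(1)[OF assms(1,2) _ assms(4) continuous_on_eta] assms(3)
  by (cases "s = t") (auto intro: has_integral_integrable[OF has_integral_refl(2)])

text \<open>Integrating the pointwise Fenchel inequality at the slope avoids any convexity argument for the
  boundary points of \<open>[0, 1]\<close>; Jensen's inequality follows by optimising over \<open>\<theta>\<close>.\<close>

lemma admissible_eta_Fenchel:
  assumes f: "f \<in> admissible" and st: "0 \<le> s" "s \<le> t" "t \<le> 1"
  shows "\<theta> * (f t - f s) - (t - s) * ln (1 + exp \<theta>) \<le> integral {s..t} (\<lambda>x. eta (deriv f x))"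
proof -
  have "((\<lambda>x. \<theta> * deriv f x - ln (1 + exp \<theta>)) has_integral
      \<theta> * (f t - f s) - (t - s) * ln (1 + exp \<theta>)) {s..t}"
    using has_integral_const_real[of "ln (1 + exp \<theta>)" s t] st
    by (intro has_integral_diff has_integral_mult_right admissible_FTC[OF f]) auto
  moreover define N where "N = {x\<in>{0<..<1}. \<not> ((f has_real_derivative deriv f x) (at x) \<and> deriv f x \<in> {0..1})} \<union> {0, 1}"
  have N: "negligible N" unfolding N_def using admissible_deriv_ae[OF f] by (intro negligible_Un) auto
  have "((\<lambda>x. if x \<in> N then \<theta> * deriv f x - ln (1 + exp \<theta>) else eta (deriv f x))
      has_integral integral {s..t} (\<lambda>x. eta (deriv f x))) {s..t}"
    by (rule has_integral_spike[OF N _ integrable_integral[OF admissible_eta_integrable[OF f st]]]) simp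
  ultimately show ?thesis
  proof (rule has_integral_le)
    fix x assume x: "x \<in> {s..t}"
    have "\<theta> * deriv f x - ln (1 + exp \<theta>) \<le> eta (deriv f x)" if "x \<notin> N"
      using that st x by (intro eta_Fenchel) (auto simp: N_def)
    then show "\<theta> * deriv f x - ln (1 + exp \<theta>) \<le> (if x \<in> N then \<theta> * deriv f x - ln (1 + exp \<theta>) else eta (deriv f x))"
      by simp
  qed
qed

lemma admissible_eta_Jensen:
  assumes f: "f \<in> admissible" and st: "0 \<le> s" "s < t" "t \<le> 1"
  shows "(t - s) * eta ((f t - f s) / (t - s)) \<le> integral {s..t} (\<lambda>x. eta (deriv f x))"
proof -
  have "eta ((f t - f s) / (t - s)) \<le> integral {s..t} (\<lambda>x. eta (deriv f x)) / (t - s)"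
  proof (rule eta_le_if_Fenchel)
    show "0 \<le> (f t - f s) / (t - s)" "(f t - f s) / (t - s) \<le> 1"
      using admissibleD[OF f, of s t] st by auto
    show "\<theta> * ((f t - f s) / (t - s)) - ln (1 + exp \<theta>) \<le> integral {s..t} (\<lambda>x. eta (deriv f x)) / (t - s)" for \<theta>
    proof (subst pos_le_divide_eq)
      have "(\<theta> * ((f t - f s) / (t - s)) - ln (1 + exp \<theta>)) * (t - s)
          = \<theta> * (((f t - f s) / (t - s)) * (t - s)) - (t - s) * ln (1 + exp \<theta>)"
        by (simp only: algebra_simps)
      also have "((f t - f s) / (t - s)) * (t - s) = f t - f s" using st by simp
      finally show "(\<theta> * ((f t - f s) / (t - s)) - ln (1 + exp \<theta>)) * (t - s)
          \<le> integral {s..t} (\<lambda>x. eta (deriv f x))"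
        using admissible_eta_Fenchel[OF f, of s t \<theta>] st by simp
    qed (use st in simp)
  qed
  then show ?thesis using st by (simp add: field_simps)
qed

definition path_cost :: "(real \<Rightarrow> real) \<Rightarrow> real" where
  "path_cost f = integral {0..1} (\<lambda>x. eta (deriv f x))"

text \<open>The cost of the piecewise linear interpolation of \<open>f\<close> at the multiples of \<open>1 / N\<close>.\<close>

definition grid_entropy :: "nat \<Rightarrow> (real \<Rightarrow> real) \<Rightarrow> real" where
  "grid_entropy N f = (\<Sum>j<N. 1 / real N * eta (real N * (f (real (Suc j) / N) - f (real j / N))))"

lemma admissible_eta_Jensen_sum:
  assumes f: "f \<in> admissible" and "w > 0" "real n * w \<le> 1"
  shows "(\<Sum>j<n. w * eta ((f (real (Suc j) * w) - f (real j * w)) / w)) \<le> integral {0..real n * w} (\<lambda>x. eta (deriv f x))"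
  using assms(3)
proof (induction n)
  case (Suc n)
  have le: "real n * w \<le> real (Suc n) * w" using \<open>w > 0\<close> by (simp add: algebra_simps)
  have "w * eta ((f (real (Suc n) * w) - f (real n * w)) / w)
      \<le> integral {real n * w..real (Suc n) * w} (\<lambda>x. eta (deriv f x))"
    using admissible_eta_Jensen[OF f, of "real n * w" "real (Suc n) * w"] \<open>w > 0\<close> Suc.prems
    by (simp add: algebra_simps)
  moreover have "integral {0..real n * w} (\<lambda>x. eta (deriv f x))
      + integral {real n * w..real (Suc n) * w} (\<lambda>x. eta (deriv f x)) = integral {0..real (Suc n) * w} (\<lambda>x. eta (deriv f x))"
    using le Suc.prems \<open>w > 0\<close> by (intro Henstock_Kurzweil_Integration.integral_combine admissible_eta_integrable[OF f]) auto
  ultimately show ?case using Suc le by simp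
qed simp

lemma grid_entropy_le_path_cost:
  assumes "f \<in> admissible" "N > 0"
  shows "grid_entropy N f \<le> path_cost f"
  using admissible_eta_Jensen_sum[OF assms(1), of "1 / real N" N] assms(2)
  by (simp add: grid_entropy_def path_cost_def mult.commute del: of_nat_Suc)

lemma grid_entropy_tendsto_path_cost:
  assumes "f \<in> admissible"
  shows "(\<lambda>n. grid_entropy (Suc n) f) \<longlonglongrightarrow> path_cost f"
  using admissible_step_integral_tendsto(2)[OF assms, of 0 1 eta] continuous_on_eta
  by (simp add: grid_entropy_def path_cost_def mult.commute del: of_nat_Suc)

lemma path_cost_nonpos: "f \<in> admissible \<Longrightarrow> path_cost f \<le> 0"
proof -
  assume f: "f \<in> admissible"
  have "grid_entropy (Suc n) f \<le> 0" for n
    unfolding grid_entropy_def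
  proof (rule sum_nonpos)
    fix j assume j: "j \<in> {..<Suc n}"
    then have "real (Suc j) / real (Suc n) \<le> 1" by simp
    moreover have "real j / real (Suc n) \<le> real (Suc j) / real (Suc n)" by (intro divide_right_mono) auto
    ultimately have "0 \<le> f (real (Suc j) / Suc n) - f (real j / Suc n)"
      "f (real (Suc j) / Suc n) - f (real j / Suc n) \<le> 1 / Suc n"
      using admissibleD[OF f, of "real j / Suc n" "real (Suc j) / Suc n"]
      by (auto simp flip: diff_divide_distrib simp del: of_nat_Suc) simp
    then show "1 / real (Suc n) * eta (real (Suc n) * (f (real (Suc j) / Suc n) - f (real j / Suc n))) \<le> 0"
      by (intro mult_nonneg_nonpos eta_nonpos) (auto simp: field_simps simp del: of_nat_Suc)
  qed
  then show ?thesis using grid_entropy_tendsto_path_cost[OF f] by (intro LIMSEQ_le_const2) auto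
qed

text \<open>For a fixed grid the discretised entropy is continuous and at most the cost; pass to the limit
  along the sequence first and refine the grid afterwards.\<close>

lemma path_cost_lower_semicontinuous:
  assumes K: "\<And>n. f n \<in> admissible" "\<And>n. g n \<in> admissible" "F \<in> admissible" "G \<in> admissible"
    and lim: "\<And>x. x \<in> {0..1} \<Longrightarrow> (\<lambda>n. f n x) \<longlonglongrightarrow> F x" "\<And>x. x \<in> {0..1} \<Longrightarrow> (\<lambda>n. g n x) \<longlonglongrightarrow> G x"
    and c: "\<And>n. path_cost (f n) + path_cost (g n) \<le> c n" "c \<longlonglongrightarrow> c0"
  shows "path_cost F + path_cost G \<le> c0"
proof -
  have slope: "real N * (f (real (Suc j) / N) - f (real j / N)) \<in> {0..1}" if "f \<in> admissible" "j < N" for f j N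
  proof -
    have "real j / N \<le> real (Suc j) / N" by (intro divide_right_mono) auto
    moreover have "real (Suc j) / N - real j / N = 1 / N" by (simp add: diff_divide_distrib[symmetric])
    moreover have "real (Suc j) / N \<le> 1" using that by simp
    ultimately show ?thesis
      using admissibleD[OF that(1), of "real j / N" "real (Suc j) / N"] that(2) by (auto simp: field_simps)
  qed
  have lim_grid: "(\<lambda>n. grid_entropy N (f n)) \<longlonglongrightarrow> grid_entropy N F"
    if f: "\<And>n. f n \<in> admissible" "F \<in> admissible" "\<And>x. x \<in> {0..1} \<Longrightarrow> (\<lambda>n. f n x) \<longlonglongrightarrow> F x" for f F N
    unfolding grid_entropy_def
  proof (intro tendsto_intros)
    fix j assume j: "j \<in> {..<N}"
    show "(\<lambda>n. eta (real N * (f n (real (Suc j) / N) - f n (real j / N))))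
        \<longlonglongrightarrow> eta (real N * (F (real (Suc j) / N) - F (real j / N)))"
    proof (rule continuous_on_tendsto_compose[OF continuous_on_eta])
      show "(\<lambda>n. real N * (f n (real (Suc j) / N) - f n (real j / N)))
        \<longlonglongrightarrow> real N * (F (real (Suc j) / N) - F (real j / N))"
        using j by (intro tendsto_intros f(3)) auto
    qed (use slope f(1,2) j in \<open>auto intro!: always_eventually simp del: atLeastAtMost_iff\<close>)
  qed
  have "grid_entropy (Suc N) F + grid_entropy (Suc N) G \<le> c0" for N
  proof (rule LIMSEQ_le)
    show "(\<lambda>n. grid_entropy (Suc N) (f n) + grid_entropy (Suc N) (g n)) \<longlonglongrightarrow> grid_entropy (Suc N) F + grid_entropy (Suc N) G"
      using K lim by (intro tendsto_add lim_grid)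
    show "c \<longlonglongrightarrow> c0" by fact
    show "\<exists>n0. \<forall>n\<ge>n0. grid_entropy (Suc N) (f n) + grid_entropy (Suc N) (g n) \<le> c n"
    proof (intro exI allI impI)
      fix n
      show "grid_entropy (Suc N) (f n) + grid_entropy (Suc N) (g n) \<le> c n"
        using grid_entropy_le_path_cost[OF K(1), of "Suc N" n] grid_entropy_le_path_cost[OF K(2), of "Suc N" n] c(1)[of n] by simp
    qed
  qed
  then show ?thesis
    using tendsto_add[OF grid_entropy_tendsto_path_cost[OF K(3)] grid_entropy_tendsto_path_cost[OF K(4)]]
    by (intro LIMSEQ_le_const2) auto
qed

section \<open>Piecewise linear paths\<close>

text \<open>Writing the interpolation as a sum of ramps turns its regularity and monotonicity into
  properties of \<open>max\<close> and \<open>min\<close>.\<close>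

lemma interpolate_clamp:
  assumes "N > 0" "x \<in> {0..1}"
  shows "interpolate N H x = H 0 + (\<Sum>i<N. (H (Suc i) - H i) * max 0 (min 1 (real N * x - real i)))"
proof -
  define k where "k = nat \<lfloor>real N * x\<rfloor>"
  have k: "real k \<le> real N * x" "real N * x < real k + 1"
    using assms unfolding k_def by (auto simp: of_nat_nat)
  have Nx: "real N * x \<le> real N" using assms by (simp add: mult_left_le)
  then have kN: "k \<le> N" using k(1) by linarith
  have clamp: "max 0 (min 1 (real N * x - real i)) = (if i < k then 1 else 0) + (if i = k then real N * x - real k else 0)" for i
  proof -
    consider "i < k" | "i = k" | "i > k" by linarith
    then show ?thesis
    proof cases
      case 1
      then have "real i + 1 \<le> real k" by linarith
      then show ?thesis using 1 k by (simp add: max_def min_def)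
    next
      case 3
      then have "real k + 1 \<le> real i" by linarith
      then show ?thesis using 3 k by (simp add: max_def min_def)
    qed (use k in \<open>auto simp: max_def min_def\<close>)
  qed
  have "(\<Sum>i<N. (H (Suc i) - H i) * max 0 (min 1 (real N * x - real i)))
     = (\<Sum>i<N. if i < k then H (Suc i) - H i else 0) + (\<Sum>i<N. if i = k then (H (Suc i) - H i) * (real N * x - real k) else 0)"
    unfolding clamp sum.distrib[symmetric] by (intro sum.cong) auto
  also have "(\<Sum>i<N. if i < k then H (Suc i) - H i else 0) = (\<Sum>i<k. H (Suc i) - H i)"
    using kN by (intro sum.mono_neutral_cong_right) auto
  also have "\<dots> = H k - H 0" by (rule sum_lessThan_telescope)
  also have "(\<Sum>i<N. if i = k then (H (Suc i) - H i) * (real N * x - real k) else 0)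
      = (real N * x - real k) * (H (Suc k) - H k)"
  proof (cases "k < N")
    case False
    then have "real N * x - real k = 0" using kN k Nx by simp
    then show ?thesis by (simp add: sum.delta)
  qed (simp add: sum.delta mult.commute)
  finally show ?thesis using assms by (simp add: interpolate_def k_def Let_def)
qed

lemma continuous_on_interpolate: "N > 0 \<Longrightarrow> continuous_on {0..1} (interpolate N H)"
proof (rule iffD1[OF continuous_on_cong[OF refl]])
  show "continuous_on {0..1} (\<lambda>x. H 0 + (\<Sum>i<N. (H (Suc i) - H i) * max 0 (min 1 (real N * x - real i))))"
    by (intro continuous_intros)
qed (simp add: interpolate_clamp)

text \<open>The rescaled interpolation with real increments \<open>p 1, \<dots>, p N\<close>; a configuration is the case of
  increments in \<open>{0, 1}\<close>.\<close>

definition linear_path :: "nat \<Rightarrow> (nat \<Rightarrow> real) \<Rightarrow> real \<Rightarrow> real" where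
  "linear_path N p = (\<lambda>x\<in>{0..1}. 1 / real N * interpolate N (\<lambda>k. \<Sum>j=1..k. p j) x)"

lemma scaled_height_eq_linear_path: "scaled_height N \<tau> = linear_path N (\<lambda>j. real (\<tau> j))"
  by (simp add: scaled_height_def linear_path_def height_def[abs_def])

lemma linear_path_cell:
  assumes "N > 0" "k < N" "real k / N \<le> x" "x \<le> real (Suc k) / N"
  shows "linear_path N p x = 1 / real N * ((\<Sum>j=1..k. p j) + (real N * x - real k) * p (Suc k))"
proof -
  have x: "x \<in> {0..1}"
  proof -
    have "0 \<le> real k / N" by simp
    moreover have "real (Suc k) / N \<le> 1" using assms(1,2) by (auto simp: divide_le_eq_1)
    ultimately show ?thesis unfolding atLeastAtMost_iff using assms(3,4) by linarith
  qed
  have kx: "real k \<le> real N * x" "real N * x \<le> real (Suc k)"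
    using assms(1,3,4) by (simp_all add: field_simps)
  show ?thesis
  proof (cases "real N * x = real (Suc k)")
    case True
    then have "nat \<lfloor>real N * x\<rfloor> = Suc k" by (metis floor_of_nat nat_int)
    then have "interpolate N (\<lambda>k. \<Sum>j=1..k. p j) x = (\<Sum>j=1..Suc k. p j)"
      using x True by (simp add: interpolate_def Let_def)
    then show ?thesis using x True by (simp add: linear_path_def)
  next
    case False
    then have "\<lfloor>real N * x\<rfloor> = int k" using kx by (intro floor_unique) auto
    then have "nat \<lfloor>real N * x\<rfloor> = k" by simp
    then show ?thesis using x by (simp add: linear_path_def interpolate_def Let_def)
  qed
qed

lemma linear_path_grid:
  assumes "N > 0" "k \<le> N"
  shows "linear_path N p (real k / N) = 1 / real N * (\<Sum>j=1..k. p j)"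
proof -
  have "nat \<lfloor>real N * (real k / N)\<rfloor> = k" using assms by simp
  then show ?thesis using assms by (simp add: linear_path_def interpolate_def Let_def divide_le_eq_1)
qed

lemma linear_path_admissible:
  assumes "N > 0" and p: "\<And>j. j \<in> {1..N} \<Longrightarrow> p j \<in> {0..1}"
  shows "linear_path N p \<in> admissible"
proof -
  let ?c = "\<lambda>x i. max 0 (min 1 (real N * x - real i))"
  have eq: "linear_path N p x = 1 / real N * (\<Sum>i<N. p (Suc i) * ?c x i)" if "x \<in> {0..1}" for x
    using that interpolate_clamp[OF assms(1) that, of "\<lambda>k. \<Sum>j=1..k. p j"] by (simp add: linear_path_def)
  have id: "(\<Sum>i<N. ?c x i) = real N * x" if "x \<in> {0..1}" for x
  proof -
    have "interpolate N real x = real N * x" using that by (simp add: interpolate_def Let_def)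
    then show ?thesis using interpolate_clamp[OF assms(1) that, of real] by simp
  qed
  have "0 \<le> linear_path N p y - linear_path N p x \<and> linear_path N p y - linear_path N p x \<le> y - x"
    if xy: "0 \<le> x" "x \<le> y" "y \<le> 1" for x y
  proof -
    have mono: "?c x i \<le> ?c y i" for i
    proof -
      have "real N * x \<le> real N * y" using xy by (simp add: mult_left_mono)
      then show ?thesis by (intro max.mono min.mono) auto
    qed
    have diff: "linear_path N p y - linear_path N p x = 1 / real N * (\<Sum>i<N. p (Suc i) * (?c y i - ?c x i))"
      using xy by (simp add: eq right_diff_distrib sum_subtractf)
    have "0 \<le> (\<Sum>i<N. p (Suc i) * (?c y i - ?c x i))"
      using p mono by (intro sum_nonneg mult_nonneg_nonneg) auto
    moreover have "(\<Sum>i<N. p (Suc i) * (?c y i - ?c x i)) \<le> (\<Sum>i<N. ?c y i - ?c x i)"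
      using p mono by (intro sum_mono mult_left_le_one_le) auto
    moreover have "(\<Sum>i<N. ?c y i - ?c x i) = real N * (y - x)"
      using xy by (simp add: sum_subtractf id right_diff_distrib)
    ultimately show ?thesis unfolding diff using assms(1) by (simp add: field_simps)
  qed
  moreover have "linear_path N p 0 = 0" using linear_path_grid[OF assms(1), of 0 p] by simp
  moreover have "linear_path N p \<in> extensional {0..1}" unfolding linear_path_def by simp
  ultimately show ?thesis unfolding admissible_def by simp
qed

text \<open>The slope is constant on every cell of the grid.\<close>

lemma path_cost_linear_path:
  assumes "N > 0"
  shows "path_cost (linear_path N p) = 1 / real N * (\<Sum>j=1..N. eta (p j))"
proof -
  have "((\<lambda>x. eta (deriv (linear_path N p) x)) has_integral (\<Sum>j<N. 1 / real N * eta (p (Suc j)))) {0..0 + real N * (1 / real N)}"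
  proof (rule has_integral_step)
    fix j x assume j: "j < N" and x: "0 + real j * (1 / real N) < x" "x < 0 + real (Suc j) * (1 / real N)"
    have "((\<lambda>x. 1 / real N * ((\<Sum>j=1..j. p j) + (real N * x - real j) * p (Suc j))) has_real_derivative
        1 / real N * (real N * p (Suc j))) (at x)"
      by (auto intro!: derivative_eq_intros)
    then have "(linear_path N p has_real_derivative 1 / real N * (real N * p (Suc j))) (at x)"
    proof (rule has_field_derivative_transform_within_open)
      show "x \<in> {real j / N<..<real (Suc j) / N}" using x by simp
      show "1 / real N * ((\<Sum>j=1..j. p j) + (real N * y - real j) * p (Suc j)) = linear_path N p y"
        if "y \<in> {real j / N<..<real (Suc j) / N}" for y
        using linear_path_cell[OF assms j, of y p] that by simp
    qed simp
    then have "deriv (linear_path N p) x = p (Suc j)"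
      using assms DERIV_imp_deriv by fastforce
    then show "eta (deriv (linear_path N p) x) = eta (p (Suc j))" by simp
  qed simp
  then have "path_cost (linear_path N p) = (\<Sum>j<N. 1 / real N * eta (p (Suc j)))"
    unfolding path_cost_def using assms by (simp add: integral_unique)
  also have "\<dots> = 1 / real N * (\<Sum>j=1..N. eta (p j))"
    by (simp add: sum_distrib_left sum.atLeast1_atMost_eq lessThan_atLeast0)
  finally show ?thesis .
qed

lemma scaled_height_admissible: "N > 0 \<Longrightarrow> \<tau> \<in> configs N \<Longrightarrow> scaled_height N \<tau> \<in> admissible"
  unfolding scaled_height_eq_linear_path
  by (rule linear_path_admissible) (use configs_01 in fastforce)+

text \<open>Between two neighbouring nodes monotonicity and the Lipschitz bound control both paths by their
  values at the nodes.\<close>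

lemma admissible_close_on_nodes:
  assumes f: "f \<in> admissible" and g: "g \<in> admissible" and "N > 0" "L > 0"
    and nodes: "\<And>k. k \<le> N \<Longrightarrow> L dvd k \<or> k = N \<Longrightarrow> \<bar>f (real k / N) - g (real k / N)\<bar> \<le> d"
    and x: "x \<in> {0..1}"
  shows "\<bar>f x - g x\<bar> \<le> d + real L / N"
proof -
  define i where "i = nat \<lfloor>real N * x\<rfloor> div L"
  define a where "a = i * L"
  define b where "b = min N (a + L)"
  have fl: "real (nat \<lfloor>real N * x\<rfloor>) \<le> real N * x" "real N * x < real (nat \<lfloor>real N * x\<rfloor>) + 1"
    using x by (auto simp: of_nat_nat)
  have Nx: "real N * x \<le> real N" using x by (simp add: mult_left_le)
  have "a \<le> nat \<lfloor>real N * x\<rfloor>" unfolding a_def i_def by simp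
  then have aNx: "real a \<le> real N * x" using fl(1) by linarith
  have "nat \<lfloor>real N * x\<rfloor> < a + L"
    unfolding a_def i_def using \<open>L > 0\<close> dividend_less_div_times[of L "nat \<lfloor>real N * x\<rfloor>"] by simp
  then have "nat \<lfloor>real N * x\<rfloor> + 1 \<le> a + L" by simp
  then have bNx: "real N * x \<le> real b" using fl(2) Nx unfolding b_def by linarith
  have aN: "a \<le> N" using aNx Nx by linarith
  have ab: "b \<le> N" "b \<le> a + L" by (auto simp: b_def)
  have bnode: "L dvd b \<or> b = N" by (auto simp: b_def a_def min_def)
  have ax: "real a / N \<le> x" and xb: "x \<le> real b / N" using aNx bNx \<open>N > 0\<close> by (simp_all add: field_simps)
  have bnd: "0 \<le> real a / N" "real b / N \<le> 1" using ab \<open>N > 0\<close> by (simp_all add: divide_le_eq_1)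
  have len: "real b / N - real a / N \<le> real L / N"
    using ab(2) \<open>N > 0\<close> by (simp add: diff_divide_distrib[symmetric] divide_right_mono)
  note fg = admissibleD[OF f, of "real a / N" x] admissibleD[OF f, of x "real b / N"]
    admissibleD[OF f, of "real a / N" "real b / N"]
    admissibleD[OF g, of "real a / N" x] admissibleD[OF g, of x "real b / N"] admissibleD[OF g, of "real a / N" "real b / N"]
  show ?thesis
    using fg nodes[of a] nodes[of b] aN ab bnode ax xb bnd len x by (auto simp: abs_le_iff a_def)
qed

section \<open>Product measures on configurations\<close>

text \<open>The probability of \<open>\<tau>\<close> when the sites are independent and site \<open>j\<close> is occupied with probability \<open>p j\<close>.\<close>

definition product_weight :: "nat \<Rightarrow> (nat \<Rightarrow> real) \<Rightarrow> (nat \<Rightarrow> nat) \<Rightarrow> real" where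
  "product_weight N p \<tau> = (\<Prod>j=1..N. if \<tau> j = 1 then p j else 1 - p j)"

lemma product_weight_Suc:
  "product_weight (Suc N) p (\<tau>(Suc N := t)) = product_weight N p \<tau> * (if t = 1 then p (Suc N) else 1 - p (Suc N))"
proof -
  have "(\<Prod>j=1..N. if (\<tau>(Suc N := t)) j = 1 then p j else 1 - p j) = (\<Prod>j=1..N. if \<tau> j = 1 then p j else 1 - p j)"
    by (intro prod.cong) auto
  then show ?thesis unfolding product_weight_def by simp
qed

lemma product_weight_nonneg:
  "(\<And>j. j \<in> {1..N} \<Longrightarrow> p j \<in> {0..1}) \<Longrightarrow> product_weight N p \<tau> \<ge> 0"
  unfolding product_weight_def by (intro prod_nonneg) auto

lemma sum_product_weight: "(\<Sum>\<tau>\<in>configs N. product_weight N p \<tau>) = 1"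
proof (induction N)
  case 0
  then show ?case by (simp add: configs_0 product_weight_def)
next
  case (Suc N)
  then show ?case
    unfolding sum_configs_Suc product_weight_Suc by (simp flip: distrib_left)
qed

lemma linear_sum_upd:
  "(\<Sum>j=1..Suc N. c j * (real ((\<tau>(Suc N := t)) j) - p j)) = (\<Sum>j=1..N. c j * (real (\<tau> j) - p j)) + c (Suc N) * (real t - p (Suc N))"
proof -
  have "(\<Sum>j=1..N. c j * (real ((\<tau>(Suc N := t)) j) - p j)) = (\<Sum>j=1..N. c j * (real (\<tau> j) - p j))"
    by (intro sum.cong) auto
  then show ?thesis by simp
qed

lemma product_weight_variance:
  "(\<Sum>\<tau>\<in>configs N. product_weight N p \<tau> * (\<Sum>j=1..N. c j * (real (\<tau> j) - p j))\<^sup>2)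
     = (\<Sum>j=1..N. (c j)\<^sup>2 * (p j * (1 - p j)))"
proof (induction N)
  case (Suc N)
  have "(w * (1 - q)) * (X + k * (real 0 - q))\<^sup>2 + (w * q) * (X + k * (real 1 - q))\<^sup>2
      = w * X\<^sup>2 + k\<^sup>2 * (q * (1 - q)) * w" for w q X k :: real
    by (simp add: algebra_simps power2_eq_square)
  then show ?case
    using Suc sum_product_weight[of N p]
    unfolding sum_configs_Suc product_weight_Suc linear_sum_upd
    by (simp add: sum.distrib flip: sum_distrib_left)
qed simp

text \<open>The additivity of entropy under independence, valid also at zero because \<open>0 * ln 0 = 0\<close>.\<close>

lemma mult_ln_mult: "x * y * ln (x * y) = y * (x * ln x) + x * (y * ln (y::real))"
  by (cases "x = 0 \<or> y = 0") (auto simp: ln_mult algebra_simps)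

lemma product_weight_entropy:
  "(\<Sum>\<tau>\<in>configs N. product_weight N p \<tau> * ln (product_weight N p \<tau>)) = (\<Sum>j=1..N. eta (p j))"
proof (induction N)
  case 0
  then show ?case by (simp add: configs_0 product_weight_def)
next
  case (Suc N)
  have "(w * (1 - q)) * ln (w * (1 - q)) + (w * q) * ln (w * q) = w * ln w + eta q * w" for w q :: real
    unfolding mult_ln_mult eta_def by (simp add: algebra_simps)
  then show ?case
    using Suc sum_product_weight[of N p] unfolding sum_configs_Suc product_weight_Suc
    by (simp add: sum.distrib flip: sum_distrib_left)
qed

text \<open>With \<open>c\<close> the left hand side, \<open>exp (a i - c)\<close> is at least \<open>w i (1 + a i - ln (w i) - c)\<close> because
  \<open>exp u \<ge> 1 + u\<close>, and these lower bounds sum to \<open>1\<close>.  Indices of weight zero contribute nothing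
  since \<open>0 * ln 0 = 0\<close>.\<close>

lemma Gibbs_variational_inequality:
  fixes w a :: "'i \<Rightarrow> real"
  assumes "finite I" "\<And>i. i \<in> I \<Longrightarrow> w i \<ge> 0" "(\<Sum>i\<in>I. w i) = 1"
  shows "(\<Sum>i\<in>I. w i * a i) - (\<Sum>i\<in>I. w i * ln (w i)) \<le> ln (\<Sum>i\<in>I. exp (a i))"
proof -
  define c where "c = (\<Sum>i\<in>I. w i * a i) - (\<Sum>i\<in>I. w i * ln (w i))"
  have "w i * (1 + a i - ln (w i) - c) \<le> exp (a i - c)" if "i \<in> I" for i
  proof (cases "w i = 0")
    case False
    then have "w i > 0" using assms(2)[OF that] by simp
    then have eq: "exp (a i - c) = w i * exp (a i - ln (w i) - c)"
      by (simp add: exp_diff)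
    have "1 + a i - ln (w i) - c \<le> exp (a i - ln (w i) - c)"
      using exp_ge_add_one_self[of "a i - ln (w i) - c"] by (simp only: diff_conv_add_uminus add.assoc)
    then show ?thesis unfolding eq using \<open>w i > 0\<close> by (intro mult_left_mono) auto
  qed simp
  then have "(\<Sum>i\<in>I. w i * (1 + a i - ln (w i) - c)) \<le> (\<Sum>i\<in>I. exp (a i - c))"
    by (rule sum_mono)
  also have "(\<Sum>i\<in>I. w i * (1 + a i - ln (w i) - c))
      = (\<Sum>i\<in>I. w i) + ((\<Sum>i\<in>I. w i * a i) - (\<Sum>i\<in>I. w i * ln (w i))) - c * (\<Sum>i\<in>I. w i)"
    by (simp add: algebra_simps sum.distrib sum_subtractf sum_distrib_left)
  also have "(\<Sum>i\<in>I. exp (a i - c)) = (\<Sum>i\<in>I. exp (a i)) / exp c"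
    by (simp add: exp_diff sum_divide_distrib)
  finally have le: "exp c \<le> (\<Sum>i\<in>I. exp (a i))" using assms(3) by (simp add: pos_le_divide_eq flip: c_def)
  then have "c \<le> ln (\<Sum>i\<in>I. exp (a i))" by (metis exp_gt_zero ln_exp ln_mono)
  then show ?thesis by (simp add: c_def)
qed

section \<open>The Laplace principle for a pair of independent layers\<close>

text \<open>Sites are grouped into consecutive blocks of length \<open>L\<close>; the last block may be shorter.\<close>

definition block :: "nat \<Rightarrow> nat \<Rightarrow> nat \<Rightarrow> nat set" where
  "block N L b = {j\<in>{1..N}. (j - 1) div L = b}"

definition block_counts :: "nat \<Rightarrow> nat \<Rightarrow> nat \<Rightarrow> (nat \<Rightarrow> nat) \<Rightarrow> nat \<Rightarrow> nat" where
  "block_counts N L m \<tau> = (\<lambda>b\<in>{..<m}. \<Sum>j\<in>block N L b. \<tau> j)"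

text \<open>The averages are a function of the block counts \<open>\<kappa>\<close>, so that configurations with the same counts
  share the same product measure.\<close>

definition block_average :: "nat \<Rightarrow> nat \<Rightarrow> (nat \<Rightarrow> nat) \<Rightarrow> nat \<Rightarrow> real" where
  "block_average N L \<kappa> j = real (\<kappa> ((j - 1) div L)) / real (card (block N L ((j - 1) div L)))"

context
  fixes N L m :: nat
  assumes L: "L > 0" and cover: "N \<le> m * L"
begin

lemma block_index:
  assumes "j \<in> {1..N}"
  shows "(j - 1) div L < m"
proof -
  have "j - 1 < N" using assms by auto
  then have "j - 1 < m * L" using cover by linarith
  then show ?thesis using L by (simp only: div_less_iff_less_mult)
qed

lemma finite_block: "finite (block N L b)"
  unfolding block_def by simp

lemma sum_by_blocks: "(\<Sum>j=1..N. g j) = (\<Sum>b<m. \<Sum>j\<in>block N L b. g j)"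
  unfolding block_def using block_index by (intro sum.group[symmetric]) auto

lemma block_counts_eq: "j \<in> {1..N} \<Longrightarrow>
    block_counts N L m \<tau> ((j - 1) div L) = (\<Sum>i\<in>block N L ((j - 1) div L). \<tau> i)"
  using block_index by (simp add: block_counts_def)

text \<open>Against weights that are constant on blocks, a configuration may be replaced by its block averages.\<close>

lemma sum_block_average:
  "(\<Sum>j=1..N. block_average N L (block_counts N L m \<tau>) j * \<phi> ((j - 1) div L))
    = (\<Sum>j=1..N. real (\<tau> j) * \<phi> ((j - 1) div L))"
  unfolding sum_by_blocks
proof (rule sum.cong[OF refl])
  fix b assume b: "b \<in> {..<m}"
  have "(\<Sum>j\<in>block N L b. block_average N L (block_counts N L m \<tau>) j * \<phi> ((j - 1) div L))
     = (\<Sum>j\<in>block N L b. real (\<Sum>i\<in>block N L b. \<tau> i) / real (card (block N L b)) * \<phi> b)"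
    using b by (intro sum.cong) (auto simp: block_average_def block_counts_def block_def)
  also have "\<dots> = real (\<Sum>i\<in>block N L b. \<tau> i) * \<phi> b"
    using finite_block[of b] by (cases "block N L b = {}") auto
  also have "\<dots> = (\<Sum>j\<in>block N L b. real (\<tau> j) * \<phi> ((j - 1) div L))"
    unfolding of_nat_sum sum_distrib_right by (intro sum.cong) (auto simp: block_def)
  finally show "(\<Sum>j\<in>block N L b. block_average N L (block_counts N L m \<tau>) j * \<phi> ((j - 1) div L))
      = (\<Sum>j\<in>block N L b. real (\<tau> j) * \<phi> ((j - 1) div L))" .
qed

context
  fixes \<tau> assumes \<tau>: "\<tau> \<in> configs N"
begin

lemma sum_block_le_card: "(\<Sum>i\<in>block N L b. \<tau> i) \<le> card (block N L b)"
proof -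
  have "(\<Sum>i\<in>block N L b. \<tau> i) \<le> (\<Sum>i\<in>block N L b. 1)"
    using configs_01[OF \<tau>] by (intro sum_mono) (fastforce simp: block_def)
  then show ?thesis by simp
qed

lemma block_average_01:
  assumes "j \<in> {1..N}"
  shows "block_average N L (block_counts N L m \<tau>) j \<in> {0..1}"
  using sum_block_le_card[of "(j - 1) div L"] block_counts_eq[OF assms, of \<tau>]
  by (auto simp: block_average_def divide_le_eq_1 simp del: of_nat_sum)

lemma block_counts_in: "block_counts N L m \<tau> \<in> {..<m} \<rightarrow>\<^sub>E {0..N}"
proof -
  have "card (block N L b) \<le> card {1..N}" for b
    unfolding block_def by (intro card_mono) auto
  then show ?thesis
    unfolding block_counts_def using sum_block_le_card order_trans by (fastforce intro!: restrict_PiE_iff[THEN iffD2])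
qed

text \<open>The logarithm of the probability of \<open>\<tau>\<close> is linear in \<open>\<tau>\<close> with coefficients that are constant on
  blocks, so \<open>\<tau>\<close> may be replaced by its averages, which turns the logarithm into the entropy.\<close>

lemma exp_sum_eta_block_average:
  "exp (\<Sum>j=1..N. eta (block_average N L (block_counts N L m \<tau>) j))
     = product_weight N (block_average N L (block_counts N L m \<tau>)) \<tau>"
proof -
  define p where "p = block_average N L (block_counts N L m \<tau>)"
  have factor_pos: "(if \<tau> j = 1 then p j else 1 - p j) > 0" if j: "j \<in> {1..N}" for j
  proof -
    let ?B = "block N L ((j - 1) div L)"
    have jB: "j \<in> ?B" using j by (simp add: block_def)
    then have card: "card ?B > 0" using finite_block card_gt_0_iff by blast
    have p: "p j = real (\<Sum>i\<in>?B. \<tau> i) / real (card ?B)"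
      unfolding p_def block_average_def block_counts_eq[OF j] ..
    show ?thesis
    proof (cases "\<tau> j = 1")
      case True
      then have "(\<Sum>i\<in>?B. \<tau> i) \<ge> 1" using member_le_sum[OF jB, of \<tau>] finite_block by simp
      then have "0 < real (\<Sum>i\<in>?B. \<tau> i)" by linarith
      then show ?thesis using True card unfolding p by simp
    next
      case False
      then have "\<tau> j = 0" using configs_01[OF \<tau> j] by simp
      then have "(\<Sum>i\<in>?B. \<tau> i) = (\<Sum>i\<in>?B - {j}. \<tau> i)"
        using jB finite_block by (simp add: sum.remove)
      also have "\<dots> \<le> (\<Sum>i\<in>?B - {j}. 1)"
        using configs_01[OF \<tau>] by (intro sum_mono) (fastforce simp: block_def)
      also have "\<dots> < card ?B" using jB card finite_block by simp
      finally have "real (\<Sum>i\<in>?B. \<tau> i) < real (card ?B)" by (simp only: of_nat_less_iff)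
      then show ?thesis using False card unfolding p by simp
    qed
  qed
  define \<phi> where "\<phi> b = (let q = real (block_counts N L m \<tau> b) / real (card (block N L b)) in ln q - ln (1 - q))" for b
  have \<phi>: "\<phi> ((j - 1) div L) = ln (p j) - ln (1 - p j)" for j
    unfolding \<phi>_def p_def block_average_def Let_def ..
  have "ln (product_weight N p \<tau>) = (\<Sum>j=1..N. ln (if \<tau> j = 1 then p j else 1 - p j))"
    unfolding product_weight_def
  proof (rule ln_prod)
    fix j assume "j \<in> {1..N}"
    from factor_pos[OF this] show "(if \<tau> j = 1 then p j else 1 - p j) \<noteq> 0"
      by (rule less_imp_neq[symmetric])
  qed simp
  also have "\<dots> = (\<Sum>j=1..N. real (\<tau> j) * \<phi> ((j - 1) div L) + ln (1 - p j))"
    unfolding \<phi> using configs_01[OF \<tau>] by (intro sum.cong) force+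
  also have "\<dots> = (\<Sum>j=1..N. p j * \<phi> ((j - 1) div L) + ln (1 - p j))"
    unfolding sum.distrib p_def sum_block_average ..
  also have "\<dots> = (\<Sum>j=1..N. eta (p j))"
    unfolding \<phi> eta_def by (simp add: algebra_simps)
  finally have "ln (product_weight N p \<tau>) = (\<Sum>j=1..N. eta (p j))" .
  moreover have "product_weight N p \<tau> > 0"
    unfolding product_weight_def using factor_pos by (intro prod_pos) auto
  ultimately show ?thesis unfolding p_def[symmetric] by (metis exp_ln)
qed

text \<open>Both paths agree at the ends of the blocks.\<close>

lemma block_average_path_close:
  assumes "N > 0" "x \<in> {0..1}"
  shows "\<bar>linear_path N (block_average N L (block_counts N L m \<tau>)) x - scaled_height N \<tau> x\<bar> \<le> real L / N"
proof -
  let ?p = "block_average N L (block_counts N L m \<tau>)"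
  have sums: "(\<Sum>j=1..k. ?p j) = (\<Sum>j=1..k. real (\<tau> j))" if k: "k \<le> N" "L dvd k \<or> k = N" for k
  proof -
    \<comment> \<open>The indicator of the blocks that lie to the left of \<open>k\<close>; no block contains \<open>k\<close> in its interior.\<close>
    define \<phi> :: "nat \<Rightarrow> real" where "\<phi> b = (if b * L < k then 1 else 0)" for b
    have \<phi>: "\<phi> ((j - 1) div L) = (if j \<le> k then 1 else 0)" if "j \<in> {1..N}" for j
    proof (cases "k = N")
      case True
      have "(j - 1) div L * L \<le> j - 1" by (rule div_times_less_eq_dividend)
      also have "j - 1 < N" using that by auto
      finally have "(j - 1) div L * L < N" .
      then show ?thesis using True that by (simp add: \<phi>_def)
    next
      case False
      then have "L dvd k" using k(2) by simp
      then obtain q where "k = L * q" by (rule dvdE)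
      then have q: "k = q * L" by (simp add: mult.commute)
      have "(j - 1) div L * L < k \<longleftrightarrow> (j - 1) div L < q" using L by (simp add: q)
      also have "\<dots> \<longleftrightarrow> j - 1 < k" using L by (simp add: q div_less_iff_less_mult)
      also have "\<dots> \<longleftrightarrow> j \<le> k" using that by auto
      finally show ?thesis by (simp add: \<phi>_def)
    qed
    have "(\<Sum>j=1..k. g j) = (\<Sum>j=1..N. g j * \<phi> ((j - 1) div L))" for g :: "nat \<Rightarrow> real"
    proof -
      have "(\<Sum>j=1..N. g j * \<phi> ((j - 1) div L)) = (\<Sum>j=1..N. if j \<le> k then g j else 0)"
        using \<phi> by (intro sum.cong) auto
      also have "\<dots> = (\<Sum>j=1..k. g j)"
        using k(1) by (intro sum.mono_neutral_cong_right) auto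
      finally show ?thesis by simp
    qed
    then show ?thesis using sum_block_average by simp
  qed
  have "\<bar>linear_path N ?p x - scaled_height N \<tau> x\<bar> \<le> 0 + real L / N"
  proof (rule admissible_close_on_nodes[where f = "linear_path N ?p" and g = "scaled_height N \<tau>" and L = L])
    show "linear_path N ?p \<in> admissible" using assms(1) block_average_01 by (rule linear_path_admissible)
    show "scaled_height N \<tau> \<in> admissible" using assms(1) \<tau> by (rule scaled_height_admissible)
    fix k assume "k \<le> N" "L dvd k \<or> k = N"
    then show "\<bar>linear_path N ?p (real k / N) - scaled_height N \<tau> (real k / N)\<bar> \<le> 0"
      unfolding scaled_height_eq_linear_path using assms(1) sums by (simp add: linear_path_grid)
  qed (use assms L in auto)
  then show ?thesis by simp
qed

end

text \<open>Each summand is the probability of \<open>\<tau>\<close> under one of at most \<open>(N + 1) ^ m\<close> product measures, each of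
  which has total mass \<open>1\<close>.\<close>

lemma sum_exp_eta_block_average_le:
  "(\<Sum>\<tau>\<in>configs N. exp (\<Sum>j=1..N. eta (block_average N L (block_counts N L m \<tau>) j))) \<le> real (N + 1) ^ m"
proof -
  let ?K = "block_counts N L m ` configs N"
  have fin: "finite ?K" using finite_configs by simp
  have "(\<Sum>\<tau>\<in>configs N. exp (\<Sum>j=1..N. eta (block_average N L (block_counts N L m \<tau>) j)))
      = (\<Sum>\<tau>\<in>configs N. product_weight N (block_average N L (block_counts N L m \<tau>)) \<tau>)"
    by (intro sum.cong refl exp_sum_eta_block_average)
  also have "\<dots> \<le> (\<Sum>\<tau>\<in>configs N. \<Sum>\<kappa>\<in>?K. product_weight N (block_average N L \<kappa>) \<tau>)"
  proof (rule sum_mono)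
    fix \<tau> assume \<tau>: "\<tau> \<in> configs N"
    show "product_weight N (block_average N L (block_counts N L m \<tau>)) \<tau>
        \<le> (\<Sum>\<kappa>\<in>?K. product_weight N (block_average N L \<kappa>) \<tau>)"
      using fin \<tau> block_average_01
      by (intro member_le_sum[of _ ?K "\<lambda>\<kappa>. product_weight N (block_average N L \<kappa>) \<tau>"])
        (auto intro!: product_weight_nonneg)
  qed
  also have "\<dots> = (\<Sum>\<kappa>\<in>?K. \<Sum>\<tau>\<in>configs N. product_weight N (block_average N L \<kappa>) \<tau>)"
    by (rule sum.swap)
  also have "\<dots> = real (card ?K)" by (simp add: sum_product_weight)
  also have "card ?K \<le> card ({..<m} \<rightarrow>\<^sub>E {0..N})"
    using block_counts_in by (intro card_mono finite_PiE) auto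
  also have "\<dots> = (N + 1) ^ m" by (simp add: card_PiE)
  finally show ?thesis by simp
qed

end

definition oscillation_le :: "((real \<Rightarrow> real) \<Rightarrow> (real \<Rightarrow> real) \<Rightarrow> real) \<Rightarrow> real \<Rightarrow> real \<Rightarrow> bool" where
  "oscillation_le \<Psi> \<delta> \<epsilon> \<longleftrightarrow> (\<forall>f\<in>admissible. \<forall>g\<in>admissible. \<forall>f'\<in>admissible. \<forall>g'\<in>admissible.
     (\<forall>x\<in>{0..1}. \<bar>f x - f' x\<bar> \<le> \<delta>) \<and> (\<forall>x\<in>{0..1}. \<bar>g x - g' x\<bar> \<le> \<delta>) \<longrightarrow> \<bar>\<Psi> f g - \<Psi> f' g'\<bar> \<le> \<epsilon>)"

definition path_continuous :: "((real \<Rightarrow> real) \<Rightarrow> (real \<Rightarrow> real) \<Rightarrow> real) \<Rightarrow> bool" where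
  "path_continuous \<Psi> \<longleftrightarrow> (\<exists>M. \<forall>f\<in>admissible. \<forall>g\<in>admissible. \<bar>\<Psi> f g\<bar> \<le> M) \<and>
     (\<forall>\<epsilon>>0. \<exists>\<delta>>0. oscillation_le \<Psi> \<delta> \<epsilon>)"

lemma oscillation_leD:
  assumes "oscillation_le \<Psi> \<delta> \<epsilon>" "f \<in> admissible" "g \<in> admissible" "f' \<in> admissible" "g' \<in> admissible"
    "\<And>x. x \<in> {0..1} \<Longrightarrow> \<bar>f x - f' x\<bar> \<le> \<delta>" "\<And>x. x \<in> {0..1} \<Longrightarrow> \<bar>g x - g' x\<bar> \<le> \<delta>"
  shows "\<bar>\<Psi> f g - \<Psi> f' g'\<bar> \<le> \<epsilon>"
  using assms unfolding oscillation_le_def by blast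

lemma path_continuous_bound:
  assumes "path_continuous \<Psi>"
  obtains M where "\<And>f g. f \<in> admissible \<Longrightarrow> g \<in> admissible \<Longrightarrow> \<bar>\<Psi> f g\<bar> \<le> M"
  using conjunct1[OF assms[unfolded path_continuous_def]] by blast

text \<open>Blocks of length \<open>N div m + 1\<close> number at most \<open>m\<close> and are short on the scale of \<open>N\<close>.\<close>

lemma block_length:
  fixes \<delta> :: real
  assumes "\<delta> > 0"
  obtains m where "m > 0" "\<forall>\<^sub>F N in sequentially. N > 0 \<and> N \<le> m * (N div m + 1) \<and> real (N div m + 1) / real N \<le> \<delta>"
proof -
  obtain n where n: "1 / real (Suc n) < \<delta> / 2" using nat_approx_posE[of "\<delta> / 2"] assms by auto
  define m where "m = Suc n"
  have "\<forall>\<^sub>F N in sequentially. N > 0 \<and> N \<le> m * (N div m + 1) \<and> real (N div m + 1) / real N \<le> \<delta>"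
    unfolding eventually_sequentially
  proof (intro exI[of _ "nat \<lceil>2 / \<delta>\<rceil> + 1"] allI impI conjI)
    fix N assume N: "nat \<lceil>2 / \<delta>\<rceil> + 1 \<le> N"
    show "N > 0" using N by simp
    show "N \<le> m * (N div m + 1)"
      using dividend_less_div_times[of m N] by (simp add: m_def mult.commute)
    have "2 / \<delta> \<le> real N" using N by linarith
    then have "1 / real N \<le> \<delta> / 2" using assms \<open>N > 0\<close> by (simp add: field_simps)
    moreover have "real (N div m) / real N \<le> 1 / real m"
    proof -
      have "real (N div m * m) \<le> real N" by (simp only: of_nat_le_iff div_times_less_eq_dividend)
      then have "real (N div m) \<le> real N / real m" by (simp add: m_def field_simps)
      then show ?thesis using \<open>N > 0\<close> by (simp add: field_simps m_def)
    qed
    ultimately show "real (N div m + 1) / real N \<le> \<delta>"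
      using n unfolding m_def by (simp add: add_divide_distrib)
  qed
  then show ?thesis using that[of m] by (simp add: m_def)
qed

text \<open>Replacing both layers by their block averages changes \<open>\<Psi>\<close> by little and turns its value
  into at most \<open>S\<close> plus the two costs; the exponentials of the costs sum to a polynomial
  factor.\<close>

lemma Laplace_upper:
  assumes \<Psi>: "path_continuous \<Psi>" and "\<epsilon> > 0"
    and S: "\<And>f g. f \<in> admissible \<Longrightarrow> g \<in> admissible \<Longrightarrow> \<Psi> f g - path_cost f - path_cost g \<le> S"
  shows "\<forall>\<^sub>F N in sequentially.
    1 / real N * ln (\<Sum>\<tau>\<in>configs N. \<Sum>\<sigma>\<in>configs N. exp (real N * \<Psi> (scaled_height N \<tau>) (scaled_height N \<sigma>))) \<le> S + \<epsilon>"
proof -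
  have "\<epsilon> / 2 > 0" using \<open>\<epsilon> > 0\<close> by simp
  then obtain \<delta> where "\<delta> > 0" and osc: "oscillation_le \<Psi> \<delta> (\<epsilon> / 2)"
    using \<Psi> unfolding path_continuous_def by blast
  note \<delta> = oscillation_leD[OF osc]
  obtain m where m: "m > 0" and ev: "\<forall>\<^sub>F N in sequentially. N > 0 \<and> N \<le> m * (N div m + 1) \<and> real (N div m + 1) / real N \<le> \<delta>"
    using block_length[OF \<open>\<delta> > 0\<close>] by blast
  have "(\<lambda>N. 2 * real m * (ln (real N + 1) / real N)) \<longlonglongrightarrow> 2 * real m * 0"
  proof (intro tendsto_mult tendsto_const)
    show "(\<lambda>N. ln (real N + 1) / real N) \<longlonglongrightarrow> 0" by real_asymp
  qed
  then have small: "\<forall>\<^sub>F N in sequentially. 2 * real m * (ln (real N + 1) / real N) < \<epsilon> / 2"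
    using \<open>\<epsilon> / 2 > 0\<close> by (intro order_tendstoD(2)) auto
  show ?thesis
    using ev small
  proof eventually_elim
    case (elim N)
    define L where "L = N div m + 1"
    have N: "N > 0" and L: "L > 0" "N \<le> m * L" "real L / real N \<le> \<delta>" using elim(1) unfolding L_def by auto
    define A where "A \<tau> = block_average N L (block_counts N L m \<tau>)" for \<tau>
    define e where "e \<tau> = exp (\<Sum>j=1..N. eta (A \<tau> j))" for \<tau>
    let ?E = "\<lambda>\<tau> \<sigma>. exp (real N * \<Psi> (scaled_height N \<tau>) (scaled_height N \<sigma>))"
    have AK: "linear_path N (A \<tau>) \<in> admissible" if "\<tau> \<in> configs N" for \<tau>
      unfolding A_def using N block_average_01[OF L(1,2) that] by (rule linear_path_admissible)
    have close: "\<bar>scaled_height N \<tau> x - linear_path N (A \<tau>) x\<bar> \<le> \<delta>" if "\<tau> \<in> configs N" "x \<in> {0..1}" for \<tau> x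
      using block_average_path_close[OF L(1,2) that(1) N that(2)] L(3) unfolding A_def by linarith
    have pointwise: "?E \<tau> \<sigma> \<le> exp (real N * (S + \<epsilon> / 2)) * (e \<tau> * e \<sigma>)"
      if \<tau>: "\<tau> \<in> configs N" and \<sigma>: "\<sigma> \<in> configs N" for \<tau> \<sigma>
    proof -
      have "\<bar>\<Psi> (scaled_height N \<tau>) (scaled_height N \<sigma>) - \<Psi> (linear_path N (A \<tau>)) (linear_path N (A \<sigma>))\<bar> \<le> \<epsilon> / 2"
        using \<tau> \<sigma> N by (intro \<delta> scaled_height_admissible AK close)
      then have "\<Psi> (scaled_height N \<tau>) (scaled_height N \<sigma>)
          \<le> S + \<epsilon> / 2 + path_cost (linear_path N (A \<tau>)) + path_cost (linear_path N (A \<sigma>))"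
        using S[OF AK[OF \<tau>] AK[OF \<sigma>]] by linarith
      then have "real N * \<Psi> (scaled_height N \<tau>) (scaled_height N \<sigma>)
          \<le> real N * (S + \<epsilon> / 2 + path_cost (linear_path N (A \<tau>)) + path_cost (linear_path N (A \<sigma>)))"
        by (intro mult_left_mono) auto
      also have "\<dots> = real N * (S + \<epsilon> / 2) + ((\<Sum>j=1..N. eta (A \<tau> j)) + (\<Sum>j=1..N. eta (A \<sigma> j)))"
        using N by (simp add: path_cost_linear_path distrib_left)
      finally show ?thesis unfolding e_def exp_add[symmetric] by simp
    qed
    have esum: "(\<Sum>\<tau>\<in>configs N. e \<tau>) \<le> real (N + 1) ^ m" "0 \<le> (\<Sum>\<tau>\<in>configs N. e \<tau>)"
      using sum_exp_eta_block_average_le[OF L(1,2)] by (auto simp: e_def A_def intro!: sum_nonneg)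
    have "(\<Sum>\<tau>\<in>configs N. \<Sum>\<sigma>\<in>configs N. ?E \<tau> \<sigma>)
        \<le> (\<Sum>\<tau>\<in>configs N. \<Sum>\<sigma>\<in>configs N. exp (real N * (S + \<epsilon> / 2)) * (e \<tau> * e \<sigma>))"
      by (intro sum_mono pointwise)
    also have "\<dots> = exp (real N * (S + \<epsilon> / 2)) * ((\<Sum>\<tau>\<in>configs N. e \<tau>) * (\<Sum>\<sigma>\<in>configs N. e \<sigma>))"
      by (subst sum_product) (simp only: sum_distrib_left)
    also have "\<dots> \<le> exp (real N * (S + \<epsilon> / 2)) * (real (N + 1) ^ m * real (N + 1) ^ m)"
      using esum by (intro mult_left_mono mult_mono) auto
    finally have le: "(\<Sum>\<tau>\<in>configs N. \<Sum>\<sigma>\<in>configs N. ?E \<tau> \<sigma>) \<le> exp (real N * (S + \<epsilon> / 2)) * (real (N + 1) ^ m * real (N + 1) ^ m)" .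
    have pos: "(\<Sum>\<tau>\<in>configs N. \<Sum>\<sigma>\<in>configs N. ?E \<tau> \<sigma>) > 0"
      using finite_configs configs_nonempty by (intro sum_pos) auto
    have "ln (\<Sum>\<tau>\<in>configs N. \<Sum>\<sigma>\<in>configs N. ?E \<tau> \<sigma>) \<le> ln (exp (real N * (S + \<epsilon> / 2)) * (real (N + 1) ^ m * real (N + 1) ^ m))"
      using le pos by (intro ln_mono) auto
    also have "\<dots> = real N * (S + \<epsilon> / 2) + 2 * real m * ln (real N + 1)"
      by (simp add: ln_mult ln_realpow add.commute)
    finally have "1 / real N * ln (\<Sum>\<tau>\<in>configs N. \<Sum>\<sigma>\<in>configs N. ?E \<tau> \<sigma>)
        \<le> 1 / real N * (real N * (S + \<epsilon> / 2) + 2 * real m * ln (real N + 1))"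
      by (intro mult_left_mono) auto
    also have "\<dots> = S + \<epsilon> / 2 + 2 * real m * (ln (real N + 1) / real N)"
      using N by (simp add: field_simps)
    finally show ?case using elim(2) by linarith
  qed
qed

text \<open>The trial measure makes the sites independent with the increments of \<open>f\<close> and \<open>g\<close> as densities.  Its
  entropy is at least \<open>-N (path_cost f + path_cost g)\<close> by Jensen's inequality.  Under it both height functions
  are close to \<open>f\<close> and \<open>g\<close>: \<open>\<Psi>\<close> exceeds \<open>\<Psi> f g\<close> minus a small constant minus a multiple
  of the squared deviations at boundedly many nodes, and each expected square is at most \<open>1 / N\<close>.\<close>

lemma Laplace_lower:
  assumes \<Psi>: "path_continuous \<Psi>" and "\<epsilon> > 0" and f: "f \<in> admissible" and g: "g \<in> admissible"
  shows "\<forall>\<^sub>F N in sequentially.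
    1 / real N * ln (\<Sum>\<tau>\<in>configs N. \<Sum>\<sigma>\<in>configs N. exp (real N * \<Psi> (scaled_height N \<tau>) (scaled_height N \<sigma>)))
      \<ge> \<Psi> f g - path_cost f - path_cost g - \<epsilon>"
proof -
  have "\<epsilon> / 2 > 0" using \<open>\<epsilon> > 0\<close> by simp
  then obtain \<delta> where "\<delta> > 0" and osc: "oscillation_le \<Psi> \<delta> (\<epsilon> / 2)"
    using \<Psi> unfolding path_continuous_def by blast
  note \<delta> = oscillation_leD[OF osc]
  obtain M where M: "\<And>f g. f \<in> admissible \<Longrightarrow> g \<in> admissible \<Longrightarrow> \<bar>\<Psi> f g\<bar> \<le> M"
    using path_continuous_bound[OF \<Psi>] by metis
  have "M \<ge> 0" using M[OF f g] by linarith
  have "\<delta> / 2 > 0" using \<open>\<delta> > 0\<close> by simp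
  obtain m where m: "m > 0" and ev: "\<forall>\<^sub>F N in sequentially. N > 0 \<and> N \<le> m * (N div m + 1) \<and> real (N div m + 1) / real N \<le> \<delta> / 2"
    using block_length[OF \<open>\<delta> / 2 > 0\<close>] by blast
  \<comment> \<open>If the squared deviations add up to at least \<open>(\<delta> / 2)\<^sup>2\<close>, the penalty \<open>C\<close> times their sum is at least the oscillation \<open>2 M\<close> of \<open>\<Psi>\<close>.\<close>
  define C where "C = 2 * M / (\<delta> / 2)\<^sup>2"
  have "C \<ge> 0" using \<open>M \<ge> 0\<close> by (simp add: C_def)
  have "(\<lambda>N. C * (2 * real (m + 2)) * (1 / real N)) \<longlonglongrightarrow> C * (2 * real (m + 2)) * 0"
    by (intro tendsto_mult tendsto_const lim_1_over_n)
  then have small: "\<forall>\<^sub>F N in sequentially. C * (2 * real (m + 2)) * (1 / real N) < \<epsilon> / 2"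
    using \<open>\<epsilon> / 2 > 0\<close> by (intro order_tendstoD(2)) auto
  show ?thesis
    using ev small
  proof eventually_elim
    case (elim N)
    define L where "L = N div m + 1"
    have N: "N > 0" and L: "L > 0" "N \<le> m * L" "real L / real N \<le> \<delta> / 2" using elim(1) unfolding L_def by auto
    define nodes where "nodes = {k. k \<le> N \<and> (L dvd k \<or> k = N)}"
    have "nodes \<subseteq> (\<lambda>i. i * L) ` {..m} \<union> {N}"
    proof
      fix k assume "k \<in> nodes"
      then have k: "k \<le> N" "L dvd k \<or> k = N" unfolding nodes_def by auto
      show "k \<in> (\<lambda>i. i * L) ` {..m} \<union> {N}"
      proof (cases "k = N")
        case False
        then have "L dvd k" using k(2) by simp
        then obtain i where "k = L * i" by (rule dvdE)
        then have i: "k = i * L" by (simp add: mult.commute)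
        then have "i * L \<le> m * L" using k(1) L(2) by linarith
        then have "i \<le> m" using L(1) mult_le_cancel2 by blast
        then show ?thesis using i by blast
      qed simp
    qed
    moreover have "card ((\<lambda>i. i * L) ` {..m} \<union> {N}) \<le> m + 2"
      using card_Un_le[of "(\<lambda>i. i * L) ` {..m}" "{N}"] card_image_le[of "{..m}" "\<lambda>i. i * L"] by simp
    ultimately have cnodes: "finite nodes" "card nodes \<le> m + 2"
      using finite_subset card_mono[of "(\<lambda>i. i * L) ` {..m} \<union> {N}" nodes] by auto
    define p where "p f j = real N * (f (real j / N) - f (real (j - 1) / N))" for f :: "real \<Rightarrow> real" and j
    have p01: "p f j \<in> {0..1}" if "f \<in> admissible" "j \<in> {1..N}" for f j
    proof -
      have "real (j - 1) / N \<le> real j / N" by (intro divide_right_mono) auto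
      moreover have "real j / N - real (j - 1) / N = 1 / N"
        using that(2) by (simp add: diff_divide_distrib[symmetric] of_nat_diff)
      moreover have "real j / N \<le> 1" using that(2) by simp
      ultimately have D: "0 \<le> f (real j / N) - f (real (j - 1) / N)" "f (real j / N) - f (real (j - 1) / N) \<le> 1 / N"
        using admissibleD[OF that(1), of "real (j - 1) / N" "real j / N"] by auto
      have "real N * (f (real j / N) - f (real (j - 1) / N)) \<le> real N * (1 / N)"
        using D(2) by (rule mult_left_mono) simp
      moreover have "0 \<le> real N * (f (real j / N) - f (real (j - 1) / N))"
        using D(1) by (rule mult_nonneg_nonneg[rotated]) simp
      ultimately show ?thesis using N by (simp add: p_def)
    qed
    have psum: "(\<Sum>j=1..k. p f j) = real N * f (real k / N)" if "f \<in> admissible" for f k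
    proof (induction k)
      case (Suc k)
      then show ?case by (simp add: p_def algebra_simps)
    qed (simp add: admissible_0[OF that])
    have peta: "(\<Sum>j=1..N. eta (p f j)) \<le> real N * path_cost f" if "f \<in> admissible" for f
    proof -
      have "(\<Sum>j=1..N. eta (p f j)) = (\<Sum>j<N. eta (p f (Suc j)))"
        by (simp add: sum.atLeast1_atMost_eq lessThan_atLeast0)
      also have "\<dots> = real N * grid_entropy N f"
        using N by (simp add: grid_entropy_def p_def sum_distrib_left)
      also have "\<dots> \<le> real N * path_cost f" using grid_entropy_le_path_cost[OF that N] by (intro mult_left_mono) auto
      finally show ?thesis .
    qed
    define dev where "dev f \<tau> = (\<Sum>k\<in>nodes. (scaled_height N \<tau> (real k / N) - f (real k / N))\<^sup>2)" for f \<tau>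
    define w where "w f = product_weight N (p f)" for f
    have wpos: "w f \<tau> \<ge> 0" if "f \<in> admissible" for f \<tau>
      unfolding w_def using p01[OF that] by (rule product_weight_nonneg)
    have wsum: "(\<Sum>\<tau>\<in>configs N. w f \<tau>) = 1" for f
      unfolding w_def by (rule sum_product_weight)
    have var: "(\<Sum>\<tau>\<in>configs N. w f \<tau> * dev f \<tau>) \<le> real (m + 2) / real N" if K: "f \<in> admissible" for f
    proof -
      have one: "(\<Sum>\<tau>\<in>configs N. w f \<tau> * (scaled_height N \<tau> (real k / N) - f (real k / N))\<^sup>2) \<le> 1 / real N"
        if k: "k \<in> nodes" for k
      proof -
        define c where "c j = (if j \<le> k then 1 / real N else 0)" for j
        have kN: "k \<le> N" using k by (simp add: nodes_def)
        have "scaled_height N \<tau> (real k / N) - f (real k / N) = (\<Sum>j=1..N. c j * (real (\<tau> j) - p f j))" for \<tau>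
        proof -
          have "(\<Sum>j=1..N. c j * (real (\<tau> j) - p f j)) = (\<Sum>j=1..k. 1 / real N * (real (\<tau> j) - p f j))"
            using kN by (intro sum.mono_neutral_cong_right) (auto simp: c_def)
          also have "\<dots> = 1 / real N * ((\<Sum>j=1..k. real (\<tau> j)) - real N * f (real k / N))"
            unfolding psum[OF K, symmetric] sum_subtractf[symmetric] sum_distrib_left ..
          finally show ?thesis
            unfolding scaled_height_eq_linear_path linear_path_grid[OF N kN] using N by (simp add: field_simps)
        qed
        then have "(\<Sum>\<tau>\<in>configs N. w f \<tau> * (scaled_height N \<tau> (real k / N) - f (real k / N))\<^sup>2)
            = (\<Sum>j=1..N. (c j)\<^sup>2 * (p f j * (1 - p f j)))"
          unfolding w_def by (simp only: product_weight_variance)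
        also have "\<dots> \<le> (\<Sum>j=1..N. (1 / real N)\<^sup>2)"
        proof (rule sum_mono)
          fix j assume "j \<in> {1..N}"
          then have "p f j \<in> {0..1}" by (rule p01[OF K])
          then have "p f j * (1 - p f j) \<le> 1" "0 \<le> p f j * (1 - p f j)" by (auto intro: mult_le_one)
          then have "(c j)\<^sup>2 * (p f j * (1 - p f j)) \<le> (c j)\<^sup>2 * 1" by (intro mult_left_mono) auto
          also have "\<dots> \<le> (1 / real N)\<^sup>2" by (simp add: c_def)
          finally show "(c j)\<^sup>2 * (p f j * (1 - p f j)) \<le> (1 / real N)\<^sup>2" .
        qed
        also have "\<dots> = 1 / real N" using N by (simp add: power2_eq_square)
        finally show ?thesis .
      qed
      have "(\<Sum>\<tau>\<in>configs N. w f \<tau> * dev f \<tau>)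
          = (\<Sum>k\<in>nodes. \<Sum>\<tau>\<in>configs N. w f \<tau> * (scaled_height N \<tau> (real k / N) - f (real k / N))\<^sup>2)"
        unfolding dev_def sum_distrib_left by (rule sum.swap)
      also have "\<dots> \<le> (\<Sum>k\<in>nodes. 1 / real N)" by (intro sum_mono one)
      also have "\<dots> = real (card nodes) * (1 / real N)" by simp
      also have "\<dots> \<le> real (m + 2) * (1 / real N)" using cnodes(2) by (intro mult_right_mono) auto
      finally show ?thesis by simp
    qed
    have near: "\<forall>x\<in>{0..1}. \<bar>scaled_height N \<tau> x - f x\<bar> \<le> \<delta>" if "\<tau> \<in> configs N" "f \<in> admissible" "dev f \<tau> < (\<delta> / 2)\<^sup>2" for f \<tau>
    proof
      fix x :: real assume x: "x \<in> {0..1}"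
      have "\<bar>scaled_height N \<tau> x - f x\<bar> \<le> \<delta> / 2 + real L / N"
      proof (rule admissible_close_on_nodes[OF scaled_height_admissible[OF N that(1)] that(2) N L(1) _ x])
        fix k assume "k \<le> N" "L dvd k \<or> k = N"
        then have "k \<in> nodes" by (simp add: nodes_def)
        then have "(scaled_height N \<tau> (real k / N) - f (real k / N))\<^sup>2 \<le> dev f \<tau>"
          unfolding dev_def using cnodes(1)
          by (intro member_le_sum[of k nodes "\<lambda>k. (scaled_height N \<tau> (real k / N) - f (real k / N))\<^sup>2"]) auto
        then have "\<bar>scaled_height N \<tau> (real k / N) - f (real k / N)\<bar>\<^sup>2 \<le> (\<delta> / 2)\<^sup>2"
          unfolding power2_abs using that(3) by linarith
        then show "\<bar>scaled_height N \<tau> (real k / N) - f (real k / N)\<bar> \<le> \<delta> / 2"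
          by (rule power2_le_imp_le) (use \<open>\<delta> / 2 > 0\<close> in linarith)
      qed
      then show "\<bar>scaled_height N \<tau> x - f x\<bar> \<le> \<delta>" using L(3) by linarith
    qed
    have dev_nonneg: "dev f \<tau> \<ge> 0" for f \<tau> unfolding dev_def by (intro sum_nonneg) auto
    have lower: "\<Psi> f g - \<epsilon> / 2 - C * (dev f \<tau> + dev g \<sigma>) \<le> \<Psi> (scaled_height N \<tau>) (scaled_height N \<sigma>)"
      if \<tau>: "\<tau> \<in> configs N" and \<sigma>: "\<sigma> \<in> configs N" for \<tau> \<sigma>
    proof (cases "dev f \<tau> + dev g \<sigma> < (\<delta> / 2)\<^sup>2")
      case True
      then have "dev f \<tau> < (\<delta> / 2)\<^sup>2" "dev g \<sigma> < (\<delta> / 2)\<^sup>2" using dev_nonneg[of f \<tau>] dev_nonneg[of g \<sigma>] by linarith+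
      then have "\<bar>\<Psi> (scaled_height N \<tau>) (scaled_height N \<sigma>) - \<Psi> f g\<bar> \<le> \<epsilon> / 2"
        using near[OF \<tau> f] near[OF \<sigma> g] by (intro \<delta> scaled_height_admissible N \<tau> \<sigma> f g) auto
      moreover have "C * (dev f \<tau> + dev g \<sigma>) \<ge> 0" using \<open>C \<ge> 0\<close> dev_nonneg by (simp add: add_nonneg_nonneg)
      ultimately show ?thesis by linarith
    next
      case False
      then have "C * (\<delta> / 2)\<^sup>2 \<le> C * (dev f \<tau> + dev g \<sigma>)" using \<open>C \<ge> 0\<close> by (intro mult_left_mono) auto
      moreover have "C * (\<delta> / 2)\<^sup>2 = 2 * M" using \<open>\<delta> > 0\<close> by (simp add: C_def)
      moreover have "\<bar>\<Psi> f g\<bar> \<le> M" "\<bar>\<Psi> (scaled_height N \<tau>) (scaled_height N \<sigma>)\<bar> \<le> M"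
        by (intro M f g scaled_height_admissible N \<tau> \<sigma>)+
      ultimately show ?thesis using \<open>\<epsilon> > 0\<close> by linarith
    qed
    define a where "a \<tau> \<sigma> = real N * \<Psi> (scaled_height N \<tau>) (scaled_height N \<sigma>)" for \<tau> \<sigma>
    have Gibbs: "(\<Sum>(\<tau>, \<sigma>)\<in>configs N \<times> configs N. (w f \<tau> * w g \<sigma>) * a \<tau> \<sigma>)
        - (\<Sum>(\<tau>, \<sigma>)\<in>configs N \<times> configs N. (w f \<tau> * w g \<sigma>) * ln (w f \<tau> * w g \<sigma>))
        \<le> ln (\<Sum>(\<tau>, \<sigma>)\<in>configs N \<times> configs N. exp (a \<tau> \<sigma>))"
    proof -
      have "(\<Sum>i\<in>configs N \<times> configs N. w f (fst i) * w g (snd i)) = 1"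
        unfolding sum.cartesian_product'[symmetric] using wsum
        by (simp add: sum.cartesian_product' flip: sum_distrib_left)
      then show ?thesis
        using Gibbs_variational_inequality[of "configs N \<times> configs N" "\<lambda>i. w f (fst i) * w g (snd i)" "\<lambda>i. a (fst i) (snd i)"]
          finite_configs wpos f g by (simp add: case_prod_unfold)
    qed
    have pair: "(\<Sum>\<tau>\<in>configs N. \<Sum>\<sigma>\<in>configs N. w f \<tau> * w g \<sigma> * (u \<tau> + v \<sigma>))
        = (\<Sum>\<tau>\<in>configs N. w f \<tau> * u \<tau>) + (\<Sum>\<sigma>\<in>configs N. w g \<sigma> * v \<sigma>)" for u v
    proof -
      have "(\<Sum>\<tau>\<in>configs N. \<Sum>\<sigma>\<in>configs N. w f \<tau> * w g \<sigma> * (u \<tau> + v \<sigma>))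
        = (\<Sum>\<tau>\<in>configs N. w f \<tau> * u \<tau>) * (\<Sum>\<sigma>\<in>configs N. w g \<sigma>) + (\<Sum>\<tau>\<in>configs N. w f \<tau>) * (\<Sum>\<sigma>\<in>configs N. w g \<sigma> * v \<sigma>)"
        unfolding sum_product sum.distrib[symmetric] by (intro sum.cong) (auto simp: algebra_simps)
      then show ?thesis by (simp add: wsum)
    qed
    have ent: "(\<Sum>(\<tau>, \<sigma>)\<in>configs N \<times> configs N. (w f \<tau> * w g \<sigma>) * ln (w f \<tau> * w g \<sigma>))
        = (\<Sum>j=1..N. eta (p f j)) + (\<Sum>j=1..N. eta (p g j))"
    proof -
      have "(\<Sum>(\<tau>, \<sigma>)\<in>configs N \<times> configs N. (w f \<tau> * w g \<sigma>) * ln (w f \<tau> * w g \<sigma>))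
         = (\<Sum>\<tau>\<in>configs N. \<Sum>\<sigma>\<in>configs N. w f \<tau> * w g \<sigma> * (ln (w f \<tau>) + ln (w g \<sigma>)))"
        unfolding sum.cartesian_product[symmetric] mult_ln_mult by (intro sum.cong) (auto simp: algebra_simps)
      then show ?thesis unfolding pair unfolding w_def product_weight_entropy .
    qed
    have "real N * (\<Psi> f g - \<epsilon> / 2 - C * (2 * real (m + 2)) * (1 / real N))
        \<le> (\<Sum>(\<tau>, \<sigma>)\<in>configs N \<times> configs N. (w f \<tau> * w g \<sigma>) * a \<tau> \<sigma>)"
    proof -
      have collect: "P - X \<le> R" if "x1 + x2 \<le> R" "x1 = P * 1 - s" "x2 = - t" "s \<le> v" "t \<le> v" "X = v + v"
        for P X R x1 x2 s t v :: real
        using that by linarith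
      have "(\<Sum>\<tau>\<in>configs N. \<Sum>\<sigma>\<in>configs N. w f \<tau> * w g \<sigma> * ((\<Psi> f g - \<epsilon> / 2 - C * dev f \<tau>) + (- C * dev g \<sigma>)))
         \<le> (\<Sum>\<tau>\<in>configs N. \<Sum>\<sigma>\<in>configs N. w f \<tau> * w g \<sigma> * \<Psi> (scaled_height N \<tau>) (scaled_height N \<sigma>))"
        using lower wpos f g by (intro sum_mono mult_left_mono) (auto simp: algebra_simps)
      moreover have "(\<Sum>\<tau>\<in>configs N. w f \<tau> * (\<Psi> f g - \<epsilon> / 2 - C * dev f \<tau>))
          = (\<Psi> f g - \<epsilon> / 2) * (\<Sum>\<tau>\<in>configs N. w f \<tau>) - C * (\<Sum>\<tau>\<in>configs N. w f \<tau> * dev f \<tau>)"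
        unfolding sum_distrib_left sum_subtractf[symmetric] by (intro sum.cong) (auto simp: algebra_simps)
      moreover have "(\<Sum>\<sigma>\<in>configs N. w g \<sigma> * (- C * dev g \<sigma>)) = - (C * (\<Sum>\<sigma>\<in>configs N. w g \<sigma> * dev g \<sigma>))"
        unfolding sum_distrib_left sum_negf[symmetric] by (intro sum.cong) (auto simp: algebra_simps)
      moreover have "C * (\<Sum>\<tau>\<in>configs N. w f \<tau> * dev f \<tau>) \<le> C * (real (m + 2) / real N)"
        "C * (\<Sum>\<tau>\<in>configs N. w g \<tau> * dev g \<tau>) \<le> C * (real (m + 2) / real N)"
        using var[OF f] var[OF g] \<open>C \<ge> 0\<close> by (intro mult_left_mono; simp)+
      moreover have "C * (2 * real (m + 2)) * (1 / real N) = C * (real (m + 2) / real N) + C * (real (m + 2) / real N)"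
        by (simp add: field_simps)
      ultimately have "\<Psi> f g - \<epsilon> / 2 - C * (2 * real (m + 2)) * (1 / real N)
          \<le> (\<Sum>\<tau>\<in>configs N. \<Sum>\<sigma>\<in>configs N. w f \<tau> * w g \<sigma> * \<Psi> (scaled_height N \<tau>) (scaled_height N \<sigma>))"
        unfolding pair wsum by (rule collect)
      then have "real N * (\<Psi> f g - \<epsilon> / 2 - C * (2 * real (m + 2)) * (1 / real N))
          \<le> real N * (\<Sum>\<tau>\<in>configs N. \<Sum>\<sigma>\<in>configs N. w f \<tau> * w g \<sigma> * \<Psi> (scaled_height N \<tau>) (scaled_height N \<sigma>))"
        by (intro mult_left_mono) auto
      also have "\<dots> = (\<Sum>(\<tau>, \<sigma>)\<in>configs N \<times> configs N. (w f \<tau> * w g \<sigma>) * a \<tau> \<sigma>)"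
        unfolding sum.cartesian_product[symmetric] a_def sum_distrib_left by (intro sum.cong) (auto simp: algebra_simps)
      finally show ?thesis .
    qed
    then have "real N * (\<Psi> f g - \<epsilon> / 2 - C * (2 * real (m + 2)) * (1 / real N)) - real N * path_cost f - real N * path_cost g
        \<le> ln (\<Sum>(\<tau>, \<sigma>)\<in>configs N \<times> configs N. exp (a \<tau> \<sigma>))"
      using Gibbs ent peta[OF f] peta[OF g] by linarith
    then have "real N * (\<Psi> f g - \<epsilon> / 2 - C * (2 * real (m + 2)) * (1 / real N)) - real N * path_cost f - real N * path_cost g
        \<le> ln (\<Sum>\<tau>\<in>configs N. \<Sum>\<sigma>\<in>configs N. exp (a \<tau> \<sigma>))"
      unfolding sum.cartesian_product .
    then have "1 / real N * (real N * (\<Psi> f g - \<epsilon> / 2 - C * (2 * real (m + 2)) * (1 / real N)) - real N * path_cost f - real N * path_cost g)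
        \<le> 1 / real N * ln (\<Sum>\<tau>\<in>configs N. \<Sum>\<sigma>\<in>configs N. exp (a \<tau> \<sigma>))"
      by (intro mult_left_mono) auto
    moreover have "1 / real N * (real N * X - real N * Y - real N * Z) = X - Y - Z" for X Y Z
      using N by (simp add: field_simps)
    ultimately show ?case using elim(2) unfolding a_def by simp
  qed
qed

lemma Laplace_limit:
  assumes \<Psi>: "path_continuous \<Psi>"
    and upper: "\<And>f g. f \<in> admissible \<Longrightarrow> g \<in> admissible \<Longrightarrow> \<Psi> f g - path_cost f - path_cost g \<le> S"
    and attained: "\<And>\<epsilon>. \<epsilon> > 0 \<Longrightarrow> \<exists>f\<in>admissible. \<exists>g\<in>admissible. \<Psi> f g - path_cost f - path_cost g \<ge> S - \<epsilon>"
  shows "(\<lambda>N. 1 / real N * ln (\<Sum>\<tau>\<in>configs N. \<Sum>\<sigma>\<in>configs N.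
      exp (real N * \<Psi> (scaled_height N \<tau>) (scaled_height N \<sigma>)))) \<longlonglongrightarrow> S"
proof (rule tendstoI)
  fix e :: real assume "e > 0"
  then have e: "e / 3 > 0" by simp
  obtain f g where fg: "f \<in> admissible" "g \<in> admissible" "\<Psi> f g - path_cost f - path_cost g \<ge> S - e / 3" using attained[OF e] by blast
  let ?L = "\<lambda>N. 1 / real N * ln (\<Sum>\<tau>\<in>configs N. \<Sum>\<sigma>\<in>configs N.
      exp (real N * \<Psi> (scaled_height N \<tau>) (scaled_height N \<sigma>)))"
  have "\<forall>\<^sub>F N in sequentially. ?L N \<le> S + e / 3"
    using upper by (intro Laplace_upper[OF \<Psi> e])
  moreover have "\<forall>\<^sub>F N in sequentially. ?L N \<ge> \<Psi> f g - path_cost f - path_cost g - e / 3"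
    by (rule Laplace_lower[OF \<Psi> e fg(1,2)])
  ultimately show "\<forall>\<^sub>F N in sequentially. dist (1 / real N * ln (\<Sum>\<tau>\<in>configs N. \<Sum>\<sigma>\<in>configs N.
      exp (real N * \<Psi> (scaled_height N \<tau>) (scaled_height N \<sigma>)))) S < e"
  proof eventually_elim
    case (elim N)
    then show ?case unfolding dist_real_def using fg(3) \<open>e > 0\<close> by linarith
  qed
qed

section \<open>The space of continuous functions on the unit interval\<close>

lemma mspace_C01: "mspace C01 = {f \<in> extensional {0..1}. continuous_on {0..1} f}"
proof -
  have "compactin (top_of_set {0..1::real}) (topspace (top_of_set {0..1}))"
    by (simp add: compactin_subtopology)
  from compactin_mspace_cfunspace[OF this, of euclidean_metric] show ?thesis
    unfolding C01_def by auto
qed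

lemma mdist_C01_le:
  assumes "e \<ge> 0" "\<And>x. x \<in> {0..1} \<Longrightarrow> \<bar>f x - g x\<bar> \<le> e"
  shows "mdist C01 f g \<le> e"
  unfolding C01_def using assms by (intro mdist_cfunspace_le) (auto simp: dist_real_def)

lemma limitin_C01:
  assumes "f \<in> mspace C01" "\<And>n. s n \<in> mspace C01"
    and unif: "\<And>e. e > 0 \<Longrightarrow> \<exists>n0. \<forall>n\<ge>n0. \<forall>x\<in>{0..1}. \<bar>s n x - f x\<bar> \<le> e"
  shows "limitin (mtopology_of C01) s f sequentially"
proof -
  interpret Metric_space "mspace C01" "mdist C01" by (rule Metric_space_mspace_mdist)
  show ?thesis
    unfolding mtopology_of_def limit_metric_sequentially
  proof (intro conjI allI impI)
    fix e :: real assume "e > 0"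
    then obtain n0 where "\<forall>n\<ge>n0. \<forall>x\<in>{0..1}. \<bar>s n x - f x\<bar> \<le> e / 2" using unif[of "e / 2"] by auto
    then have "mdist C01 (s n) f \<le> e / 2" if "n \<ge> n0" for n using that \<open>e > 0\<close> by (intro mdist_C01_le) auto
    then show "\<exists>N. \<forall>n\<ge>N. s n \<in> mspace C01 \<and> mdist C01 (s n) f < e"
      using assms(2) \<open>e > 0\<close> by (intro exI[of _ n0]) fastforce
  qed fact
qed

lemma admissible_continuous_on: "f \<in> admissible \<Longrightarrow> continuous_on {0..1} f"
  by (intro abs_continuous_on_imp_continuous_on admissible_abs_continuous)

lemma admissible_C01: "f \<in> admissible \<Longrightarrow> f \<in> mspace C01"
  unfolding mspace_C01 using admissible_continuous_on by (auto simp: admissible_def)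

lemma admissible_AC0: "f \<in> admissible \<Longrightarrow> f \<in> AC0"
  unfolding AC0_def by (simp add: admissible_C01 admissible_abs_continuous admissible_0)

text \<open>The theorem of Arzela and Ascoli applies because all admissible paths share one Lipschitz
  constant; the defining inequalities pass to pointwise limits.\<close>

lemma admissible_sequentially_compact:
  assumes K: "\<And>n. s n \<in> admissible"
  obtains f r where "f \<in> admissible" "strict_mono (r :: nat \<Rightarrow> nat)"
    "\<And>e. e > 0 \<Longrightarrow> \<exists>n0. \<forall>n\<ge>n0. \<forall>x\<in>{0..1}. \<bar>s (r n) x - f x\<bar> \<le> e"
proof -
  obtain g r where g: "continuous_on {0..1} g" "strict_mono (r :: nat \<Rightarrow> nat)"
    and lim: "\<And>e. 0 < e \<Longrightarrow> \<exists>N. \<forall>n x. n \<ge> N \<and> x \<in> {0..1} \<longrightarrow> norm (s (r n) x - g x) < e"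
  proof (rule Arzela_Ascoli[of "{0..1::real}" s 1])
    show "norm (s n x) \<le> 1" if "x \<in> {0..1}" for n x
      using admissible_bounds[OF K that, of n] by simp
    fix x e :: real assume x: "x \<in> {0..1}" and "0 < e"
    then show "\<exists>d>0. \<forall>n y. y \<in> {0..1} \<and> norm (x - y) < d \<longrightarrow> norm (s n x - s n y) < e"
    proof (intro exI[of _ e] conjI allI impI)
      fix n y assume "y \<in> {0..1} \<and> norm (x - y) < e"
      then show "norm (s n x - s n y) < e" using admissible_Lipschitz[OF K[of n] x, of y] by simp
    qed
  qed auto
  define f where "f = restrict g {0..1}"
  have unif: "\<exists>n0. \<forall>n\<ge>n0. \<forall>x\<in>{0..1}. \<bar>s (r n) x - f x\<bar> \<le> e" if e: "e > 0" for e
  proof -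
    obtain n0 where "\<And>n x. n \<ge> n0 \<and> x \<in> {0..1} \<longrightarrow> norm (s (r n) x - g x) < e" using lim[OF e] by blast
    then show ?thesis by (intro exI[of _ n0]) (fastforce simp: f_def)
  qed
  have pt: "(\<lambda>n. s (r n) x) \<longlonglongrightarrow> f x" if x: "x \<in> {0..1}" for x
  proof (rule LIMSEQ_I)
    fix e :: real assume "e > 0"
    then obtain n0 where "\<forall>n\<ge>n0. \<forall>x\<in>{0..1}. \<bar>s (r n) x - f x\<bar> \<le> e / 2" using unif[of "e / 2"] by auto
    then show "\<exists>n0. \<forall>n\<ge>n0. norm (s (r n) x - f x) < e"
      using x \<open>e > 0\<close> by (intro exI[of _ n0]) fastforce
  qed
  have "f \<in> admissible"
    unfolding admissible_def mem_Collect_eq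
  proof (intro conjI allI impI)
    show "f \<in> extensional {0..1}" by (simp add: f_def)
    have "(\<lambda>n. s (r n) 0) \<longlonglongrightarrow> f 0" by (intro pt) simp
    then show "f 0 = 0" by (simp add: admissible_0[OF K] LIMSEQ_const_iff)
    fix x y :: real assume xy: "0 \<le> x \<and> x \<le> y \<and> y \<le> 1"
    then have d: "(\<lambda>n. s (r n) y - s (r n) x) \<longlonglongrightarrow> f y - f x" by (intro tendsto_diff pt) auto
    show "0 \<le> f y - f x" using admissibleD[OF K, of x y] xy by (intro LIMSEQ_le_const[OF d]) auto
    show "f y - f x \<le> y - x" using admissibleD[OF K, of x y] xy by (intro LIMSEQ_le_const2[OF d]) auto
  qed
  then show ?thesis using that g(2) unif by blast
qed

text \<open>Continuity on a compact set, argued with sequences: two sequences at vanishing distance have a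
  common limit along a subsequence.\<close>

lemma uniformly_continuous_on_admissible:
  assumes \<Phi>: "continuous_map (mtopology_of C01) euclideanreal \<Phi>" and "\<epsilon> > 0"
  obtains \<delta> where "\<delta> > 0" "\<And>f g. f \<in> admissible \<Longrightarrow> g \<in> admissible \<Longrightarrow> \<forall>x\<in>{0..1}. \<bar>f x - g x\<bar> \<le> \<delta> \<Longrightarrow> \<bar>\<Phi> f - \<Phi> g\<bar> \<le> \<epsilon>"
proof (rule ccontr)
  assume neg: "\<not> thesis"
  have "\<exists>f g. f \<in> admissible \<and> g \<in> admissible \<and> (\<forall>x\<in>{0..1}. \<bar>f x - g x\<bar> \<le> 1 / real (Suc n)) \<and> \<bar>\<Phi> f - \<Phi> g\<bar> > \<epsilon>" for n
  proof (rule ccontr)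
    assume "\<not> ?thesis"
    then show False using neg that[of "1 / real (Suc n)"] by (force simp: not_less)
  qed
  then obtain s t where s: "\<And>n. s n \<in> admissible" and t: "\<And>n. t n \<in> admissible"
    and close: "\<And>n. \<forall>x\<in>{0..1}. \<bar>s n x - t n x\<bar> \<le> 1 / real (Suc n)" and far: "\<And>n. \<bar>\<Phi> (s n) - \<Phi> (t n)\<bar> > \<epsilon>"
    by metis
  obtain f r where f: "f \<in> admissible" and r: "strict_mono (r :: nat \<Rightarrow> nat)"
    and lim: "\<And>e. e > 0 \<Longrightarrow> \<exists>n0. \<forall>n\<ge>n0. \<forall>x\<in>{0..1}. \<bar>s (r n) x - f x\<bar> \<le> e"
    using admissible_sequentially_compact[where s = s, OF s] by blast
  have "limitin (mtopology_of C01) (\<lambda>n. s (r n)) f sequentially"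
    by (rule limitin_C01[OF admissible_C01[OF f] admissible_C01[OF s] lim])
  then have 1: "(\<lambda>n. \<Phi> (s (r n))) \<longlonglongrightarrow> \<Phi> f"
    using continuous_map_limit[OF \<Phi>] by (fastforce simp: o_def)
  have "limitin (mtopology_of C01) (\<lambda>n. t (r n)) f sequentially"
  proof (rule limitin_C01[OF admissible_C01[OF f] admissible_C01[OF t]])
    fix e :: real assume "e > 0"
    then obtain n0 where n0: "\<forall>n\<ge>n0. \<forall>x\<in>{0..1}. \<bar>s (r n) x - f x\<bar> \<le> e / 2" using lim[of "e / 2"] by auto
    obtain n1 where n1: "1 / real (Suc n1) < e / 2" using nat_approx_posE[of "e / 2"] \<open>e > 0\<close> by auto
    show "\<exists>n0. \<forall>n\<ge>n0. \<forall>x\<in>{0..1}. \<bar>t (r n) x - f x\<bar> \<le> e"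
    proof (intro exI[of _ "max n0 n1"] allI impI ballI)
      fix n x assume n: "max n0 n1 \<le> n" and x: "x \<in> {0..1::real}"
      have "\<bar>s (r n) x - f x\<bar> \<le> e / 2" using n0 n x by simp
      moreover have "\<bar>s (r n) x - t (r n) x\<bar> \<le> 1 / real (Suc (r n))" using close x by blast
      moreover have "n1 \<le> r n" using n seq_suble[OF r, of n] by linarith
      then have "1 / real (Suc (r n)) \<le> 1 / real (Suc n1)" by (intro divide_left_mono) auto
      ultimately show "\<bar>t (r n) x - f x\<bar> \<le> e" using n1 by linarith
    qed
  qed
  then have 2: "(\<lambda>n. \<Phi> (t (r n))) \<longlonglongrightarrow> \<Phi> f"
    using continuous_map_limit[OF \<Phi>] by (fastforce simp: o_def)
  have "(\<lambda>n. \<bar>\<Phi> (s (r n)) - \<Phi> (t (r n))\<bar>) \<longlonglongrightarrow> \<bar>\<Phi> f - \<Phi> f\<bar>" by (intro tendsto_intros 1 2)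
  then have "\<epsilon> \<le> \<bar>\<Phi> f - \<Phi> f\<bar>" using far by (intro LIMSEQ_le_const) (auto intro: less_imp_le)
  then show False using \<open>\<epsilon> > 0\<close> by simp
qed

section \<open>The interaction of the layers\<close>

text \<open>The exponential rate of the two-layer weight as a functional of the rescaled heights.\<close>

definition interaction :: "real \<Rightarrow> real \<Rightarrow> (real \<Rightarrow> real) \<Rightarrow> (real \<Rightarrow> real) \<Rightarrow> real" where
  "interaction a b f g = - ln (a * b) * (INF x\<in>{0..1}. f x - g x) + ln b * (f 1 - g 1)"

lemma admissible_diff_bounds:
  assumes "f \<in> admissible" "g \<in> admissible" "x \<in> {0..1}"
  shows "\<bar>f x - g x\<bar> \<le> 1"
  using admissible_bounds[OF assms(1,3)] admissible_bounds[OF assms(2,3)] by auto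

lemma admissible_INF_diff_le:
  assumes "f \<in> admissible" "g \<in> admissible" "f' \<in> admissible" "g' \<in> admissible"
    and "\<And>x. x \<in> {0..1} \<Longrightarrow> \<bar>f x - f' x\<bar> \<le> d" "\<And>x. x \<in> {0..1} \<Longrightarrow> \<bar>g x - g' x\<bar> \<le> d"
  shows "(INF x\<in>{0..1}. f x - g x) \<le> (INF x\<in>{0..1}. f' x - g' x) + 2 * d"
proof -
  have bdd: "bdd_below ((\<lambda>x. f x - g x) ` {0..1})"
  proof (rule bdd_belowI2)
    show "- 1 \<le> f x - g x" if "x \<in> {0..1}" for x
      using admissible_diff_bounds[OF assms(1,2) that] by linarith
  qed
  have "(INF x\<in>{0..1}. f x - g x) - 2 * d \<le> (INF x\<in>{0..1}. f' x - g' x)"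
  proof (rule cINF_greatest)
    fix x :: real assume x: "x \<in> {0..1}"
    have "(INF x\<in>{0..1}. f x - g x) \<le> f x - g x" by (rule cINF_lower[OF bdd x])
    then show "(INF x\<in>{0..1}. f x - g x) - 2 * d \<le> f' x - g' x"
      using assms(5,6)[OF x] by linarith
  qed simp
  then show ?thesis by linarith
qed

lemma interaction_diff_le:
  assumes "f \<in> admissible" "g \<in> admissible" "f' \<in> admissible" "g' \<in> admissible"
    and d: "\<And>x. x \<in> {0..1} \<Longrightarrow> \<bar>f x - f' x\<bar> \<le> d" "\<And>x. x \<in> {0..1} \<Longrightarrow> \<bar>g x - g' x\<bar> \<le> d"
  shows "\<bar>interaction a b f g - interaction a b f' g'\<bar> \<le> (\<bar>ln (a * b)\<bar> + \<bar>ln b\<bar>) * (2 * d)"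
proof -
  let ?I = "INF x\<in>{0..1}. f x - g x" and ?I' = "INF x\<in>{0..1}. f' x - g' x"
  have "\<bar>?I - ?I'\<bar> \<le> 2 * d"
  proof -
    have "?I \<le> ?I' + 2 * d" using d by (intro admissible_INF_diff_le assms)
    moreover have "?I' \<le> ?I + 2 * d"
      using d by (intro admissible_INF_diff_le assms) (simp_all add: abs_minus_commute)
    ultimately show ?thesis by linarith
  qed
  then have 1: "\<bar>ln (a * b) * (?I - ?I')\<bar> \<le> \<bar>ln (a * b)\<bar> * (2 * d)"
    unfolding abs_mult by (intro mult_left_mono) auto
  have "\<bar>(f 1 - g 1) - (f' 1 - g' 1)\<bar> \<le> 2 * d" using d(1)[of 1] d(2)[of 1] by simp
  then have 2: "\<bar>ln b * ((f 1 - g 1) - (f' 1 - g' 1))\<bar> \<le> \<bar>ln b\<bar> * (2 * d)"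
    unfolding abs_mult by (intro mult_left_mono) auto
  have "interaction a b f g - interaction a b f' g'
      = - (ln (a * b) * (?I - ?I')) + ln b * ((f 1 - g 1) - (f' 1 - g' 1))"
    by (simp add: interaction_def algebra_simps)
  then show ?thesis using 1 2 unfolding distrib_right by linarith
qed

lemma interaction_bound:
  assumes f: "f \<in> admissible" and g: "g \<in> admissible"
  shows "\<bar>interaction a b f g\<bar> \<le> (\<bar>ln (a * b)\<bar> + \<bar>ln b\<bar>) * 2"
proof -
  have z: "(\<lambda>x\<in>{0..1}. 0) \<in> admissible" by (simp add: admissible_def)
  have "interaction a b (\<lambda>x\<in>{0..1}. 0) (\<lambda>x\<in>{0..1}. 0) = 0"
    by (simp add: interaction_def)
  moreover have "\<bar>f x - (\<lambda>x\<in>{0..1}. 0) x\<bar> \<le> 1" if "f \<in> admissible" "x \<in> {0..1}" for f and x :: real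
    using admissible_diff_bounds[OF that(1) z that(2)] .
  ultimately show ?thesis using interaction_diff_le[OF f g z z, of 1 a b] f g by simp
qed

text \<open>The interaction is Lipschitz in the supremum distance; test functions are uniformly continuous on the
  compact set of admissible paths.\<close>

lemma path_continuous_interaction:
  assumes \<Phi>: "continuous_map (mtopology_of C01) euclideanreal \<Phi>" and bdd: "bounded (\<Phi> ` mspace C01)"
  shows "path_continuous (\<lambda>f g. \<Phi> f + interaction a b f g)"
  unfolding path_continuous_def
proof (intro conjI allI impI)
  obtain B where B: "\<And>f. f \<in> mspace C01 \<Longrightarrow> \<bar>\<Phi> f\<bar> \<le> B" using bdd unfolding bounded_iff by auto
  have "\<bar>\<Phi> f + interaction a b f g\<bar> \<le> B + (\<bar>ln (a * b)\<bar> + \<bar>ln b\<bar>) * 2" if "f \<in> admissible" "g \<in> admissible" for f g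
    using B[OF admissible_C01[OF that(1)]] interaction_bound[OF that, of a b] by linarith
  then show "\<exists>M. \<forall>f\<in>admissible. \<forall>g\<in>admissible. \<bar>\<Phi> f + interaction a b f g\<bar> \<le> M" by blast
  fix \<epsilon> :: real assume "\<epsilon> > 0"
  then have "\<epsilon> / 2 > 0" by simp
  obtain \<delta> where "\<delta> > 0" and \<delta>: "\<And>f g. f \<in> admissible \<Longrightarrow> g \<in> admissible \<Longrightarrow> \<forall>x\<in>{0..1}. \<bar>f x - g x\<bar> \<le> \<delta> \<Longrightarrow> \<bar>\<Phi> f - \<Phi> g\<bar> \<le> \<epsilon> / 2"
    using uniformly_continuous_on_admissible[OF \<Phi> \<open>\<epsilon> / 2 > 0\<close>] by blast
  define C where "C = (\<bar>ln (a * b)\<bar> + \<bar>ln b\<bar>) * 2 + 1"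
  have "C > 0" by (auto simp: C_def intro!: add_nonneg_pos)
  define d where "d = min \<delta> (\<epsilon> / 2 / C)"
  have "d > 0" using \<open>\<delta> > 0\<close> \<open>\<epsilon> > 0\<close> \<open>C > 0\<close> by (simp add: d_def)
  have "C * d \<le> C * (\<epsilon> / 2 / C)" using \<open>C > 0\<close> by (intro mult_left_mono) (auto simp: d_def)
  then have Cd: "C * d \<le> \<epsilon> / 2" using \<open>C > 0\<close> by simp
  have "oscillation_le (\<lambda>f g. \<Phi> f + interaction a b f g) d \<epsilon>"
    unfolding oscillation_le_def
  proof (intro ballI impI, elim conjE)
    fix f g f' g' assume K: "f \<in> admissible" "g \<in> admissible" "f' \<in> admissible" "g' \<in> admissible"
      and fd: "\<forall>x\<in>{0..1}. \<bar>f x - f' x\<bar> \<le> d" and gd: "\<forall>x\<in>{0..1}. \<bar>g x - g' x\<bar> \<le> d"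
    have "\<bar>\<Phi> f - \<Phi> f'\<bar> \<le> \<epsilon> / 2" using K(1,3) fd by (intro \<delta>) (auto simp: d_def)
    moreover have "\<bar>interaction a b f g - interaction a b f' g'\<bar> \<le> (\<bar>ln (a * b)\<bar> + \<bar>ln b\<bar>) * (2 * d)"
      using fd gd by (intro interaction_diff_le K) auto
    moreover have "(\<bar>ln (a * b)\<bar> + \<bar>ln b\<bar>) * (2 * d) \<le> C * d" using \<open>d > 0\<close> by (simp add: C_def algebra_simps)
    ultimately show "\<bar>\<Phi> f + interaction a b f g - (\<Phi> f' + interaction a b f' g')\<bar> \<le> \<epsilon>"
      using Cd by linarith
  qed
  then show "\<exists>\<delta>>0. oscillation_le (\<lambda>f g. \<Phi> f + interaction a b f g) \<delta> \<epsilon>" using \<open>d > 0\<close> by blast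
qed

section \<open>The free energy\<close>

text \<open>The sum of the Legendre transforms of \<open>eta\<close> at \<open>ln s\<close> and \<open>- ln s\<close>: the growth rate of two
  independent layers tilted in opposite directions.\<close>

definition layer_pressure :: "real \<Rightarrow> real" where
  "layer_pressure s = ln ((1 + s)\<^sup>2 / s)"

lemma layer_pressure_eq: "s > 0 \<Longrightarrow> layer_pressure s = 2 * ln (1 + s) - ln s"
  by (simp add: layer_pressure_def ln_div ln_realpow)

lemma layer_pressure_eq_exp: "s > 0 \<Longrightarrow> ln (1 + exp (ln s)) + ln (1 + exp (- ln s)) = layer_pressure s"
proof -
  assume s: "s > 0"
  have "1 + exp (- ln s) = (1 + s) / s" using s by (simp add: exp_minus field_simps)
  then have "ln (1 + exp (- ln s)) = ln (1 + s) - ln s" using s by (simp only: ln_divide_pos add_pos_pos zero_less_one)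
  then show ?thesis using s by (simp add: layer_pressure_eq)
qed

lemma layer_pressure_mono:
  assumes "1 \<le> s" "s \<le> t"
  shows "layer_pressure s \<le> layer_pressure t"
proof -
  have "0 \<le> (t - s) * (s * t - 1)"
    using assms mult_mono[of 1 s 1 t] by (intro mult_nonneg_nonneg) auto
  then have "(1 + s)\<^sup>2 * t \<le> (1 + t)\<^sup>2 * s" by (simp add: power2_eq_square algebra_simps)
  then have "(1 + s)\<^sup>2 / s \<le> (1 + t)\<^sup>2 / t" using assms by (simp add: field_simps)
  then show ?thesis unfolding layer_pressure_def using assms by (intro ln_mono) auto
qed

text \<open>The three phases of \<open>rho_bar\<close> correspond to the three candidates for the maximum.\<close>

lemma log_rho_bar_eq:
  assumes a: "a > 0" and b: "b > 0"
  shows "- ln (rho_bar a b * (1 - rho_bar a b)) = layer_pressure (max 1 (max a b))"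
proof -
  have Q: "- ln (r * (1 - r)) = layer_pressure s" if "s > 0" "r = 1 / (1 + s) \<or> r = s / (1 + s)" for r s
  proof -
    have e: "1 - 1 / (1 + s) = s / (1 + s)" "1 - s / (1 + s) = 1 / (1 + s)" using that(1) by (simp_all add: field_simps)
    have "r * (1 - r) = s / (1 + s)\<^sup>2"
      using that(2)
    proof
      assume r: "r = 1 / (1 + s)"
      show ?thesis unfolding r e(1) by (simp add: power2_eq_square)
    next
      assume r: "r = s / (1 + s)"
      show ?thesis unfolding r e(2) by (simp add: power2_eq_square)
    qed
    then show ?thesis using that(1) by (simp add: layer_pressure_eq ln_div ln_realpow)
  qed
  consider "a > 1" "a \<ge> b" | "a \<le> 1" "b \<le> 1" | "b > 1" "b > a" by linarith
  then show ?thesis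
  proof cases
    case 1
    then show ?thesis using Q[of a "rho_bar a b"] by (simp add: rho_bar_def max_def)
  next
    case 2
    then show ?thesis using Q[of 1 "rho_bar a b"] by (simp add: rho_bar_def max_def)
  next
    case 3
    then show ?thesis using Q[of b "rho_bar a b"] by (simp add: rho_bar_def max_def)
  qed
qed

text \<open>Let \<open>z\<close> be a point where \<open>f - g\<close> is minimal.  The interaction tilts the slopes by \<open>- ln a\<close> before \<open>z\<close>
  and by \<open>ln b\<close> after it.  Since \<open>f - g\<close> is nonpositive at \<open>z\<close> and does not lie below that value
  at \<open>1\<close>, tilts with \<open>a < 1\<close> or \<open>b < 1\<close> only lower the value and may be replaced by no tilt at
  all, that is by \<open>max a 1\<close> and \<open>max b 1\<close>.  Fenchel's inequality bounds both parts.\<close>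

lemma free_energy_upper:
  assumes a: "a > 0" and b: "b > 0" and f: "f \<in> admissible" and g: "g \<in> admissible"
  shows "interaction a b f g - path_cost f - path_cost g \<le> layer_pressure (max 1 (max a b))"
proof -
  have "\<exists>z\<in>{0..1}. \<forall>x\<in>{0..1}. f z - g z \<le> f x - g x"
    using continuous_on_diff[OF admissible_continuous_on[OF f] admissible_continuous_on[OF g]]
    by (intro continuous_attains_inf) simp_all
  then obtain z where z: "z \<in> {0..1}" and zmin: "\<And>x. x \<in> {0..1} \<Longrightarrow> f z - g z \<le> f x - g x"
    by blast
  have INF: "(INF x\<in>{0..1}. f x - g x) = f z - g z"
    using z zmin by (intro cInf_eq_minimum) auto
  \<comment> \<open>The untilted value \<open>1\<close> replaces parameters below \<open>1\<close>.\<close>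
  define A where "A = max a 1"
  define B where "B = max b 1"
  have AB: "A \<ge> 1" "B \<ge> 1" "A \<le> max 1 (max a b)" "B \<le> max 1 (max a b)" by (auto simp: A_def B_def)
  have split: "path_cost \<phi> = integral {0..z} (\<lambda>x. eta (deriv \<phi> x)) + integral {z..1} (\<lambda>x. eta (deriv \<phi> x))" if "\<phi> \<in> admissible" for \<phi>
    unfolding path_cost_def using z by (intro Henstock_Kurzweil_Integration.integral_combine[symmetric] admissible_eta_integrable[OF that]) auto
  have z01: "0 \<le> z" "z \<le> 1" using z by auto
  note F = admissible_eta_Fenchel[OF f order.refl z01, of "- ln A"] admissible_eta_Fenchel[OF g order.refl z01, of "ln A"]
    admissible_eta_Fenchel[OF f z01 order.refl, of "ln B"] admissible_eta_Fenchel[OF g z01 order.refl, of "- ln B"]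
  have d0: "f z - g z \<le> 0" using zmin[of 0] by (simp add: admissible_0[OF f] admissible_0[OF g])
  have d1: "(f 1 - g 1) - (f z - g z) \<ge> 0" using zmin[of 1] by simp
  have "ln a \<le> ln A" "ln b \<le> ln B" using a b by (auto simp: A_def B_def)
  then have 1: "- ln a * (f z - g z) \<le> - ln A * (f z - g z)"
    "ln b * ((f 1 - g 1) - (f z - g z)) \<le> ln B * ((f 1 - g 1) - (f z - g z))"
    using d0 d1 by (auto intro: mult_right_mono mult_right_mono_neg)
  have "interaction a b f g = - ln a * (f z - g z) + ln b * ((f 1 - g 1) - (f z - g z))"
    unfolding interaction_def INF using a b by (simp add: ln_mult algebra_simps)
  then have 2: "interaction a b f g \<le> - ln A * (f z - g z) + ln B * ((f 1 - g 1) - (f z - g z))" using 1 by linarith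
  have QA: "z * (ln (1 + exp (ln A)) + ln (1 + exp (- ln A))) \<le> z * layer_pressure (max 1 (max a b))"
    using AB z01 by (subst layer_pressure_eq_exp) (auto intro!: mult_left_mono layer_pressure_mono)
  have QB: "(1 - z) * (ln (1 + exp (ln B)) + ln (1 + exp (- ln B))) \<le> (1 - z) * layer_pressure (max 1 (max a b))"
    using AB z01 by (subst layer_pressure_eq_exp) (auto intro!: mult_left_mono layer_pressure_mono)
  have "- ln A * (f z - g z) + ln B * ((f 1 - g 1) - (f z - g z)) - path_cost f - path_cost g
      \<le> z * (ln (1 + exp (ln A)) + ln (1 + exp (- ln A))) + (1 - z) * (ln (1 + exp (ln B)) + ln (1 + exp (- ln B)))"
    using F unfolding split[OF f] split[OF g] by (simp add: admissible_0[OF f] admissible_0[OF g] algebra_simps)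
  also have "\<dots> \<le> z * layer_pressure (max 1 (max a b)) + (1 - z) * layer_pressure (max 1 (max a b))"
    using QA QB by (rule add_mono)
  also have "\<dots> = layer_pressure (max 1 (max a b))" by (simp add: algebra_simps)
  finally show ?thesis using 2 by linarith
qed

text \<open>Two straight lines suffice, with the slopes dual to the tilt of the dominant phase.\<close>

lemma free_energy_attained:
  assumes a: "a > 0" and b: "b > 0"
  obtains f g where "f \<in> admissible" "g \<in> admissible" "interaction a b f g - path_cost f - path_cost g = layer_pressure (max 1 (max a b))"
proof -
  define L where "L p = linear_path 1 (\<lambda>_. p)" for p
  have L: "L p x = p * x" if "x \<in> {0..1}" for p x
    using linear_path_cell[of 1 0 x "\<lambda>_. p"] that by (simp add: L_def)
  have LK: "L p \<in> admissible" if "p \<in> {0..1}" for p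
    unfolding L_def using that by (intro linear_path_admissible) auto
  have JL: "path_cost (L p) = eta p" for p
    unfolding L_def by (simp add: path_cost_linear_path)
  have eta1: "eta (1 / (1 + s)) = s / (1 + s) * ln s - ln (1 + s)" if "s > 0" for s
  proof -
    have "1 - 1 / (1 + s) = s / (1 + s)" using that by (simp add: field_simps)
    then have "eta (1 / (1 + s)) = 1 / (1 + s) * (- ln (1 + s)) + s / (1 + s) * (ln s - ln (1 + s))"
      using that by (simp add: eta_def ln_div)
    also have "\<dots> = s / (1 + s) * ln s - (1 / (1 + s) + s / (1 + s)) * ln (1 + s)" by (simp add: algebra_simps)
    also have "1 / (1 + s) + s / (1 + s) = 1" using that by (simp add: field_simps)
    finally show ?thesis by simp
  qed
  have eta2: "eta (s / (1 + s)) = eta (1 / (1 + s))" if "s > 0" for s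
  proof -
    have e: "1 - 1 / (1 + s) = s / (1 + s)" "1 - s / (1 + s) = 1 / (1 + s)" using that by (simp_all add: field_simps)
    show ?thesis unfolding eta_def e by simp
  qed
  have p01: "1 / (1 + s) \<in> {0..1}" "s / (1 + s) \<in> {0..1}" if "s > 0" for s :: real
    using that by auto
  have pq: "s / (1 + s) = 1 - 1 / (1 + s)" if "s > 0" for s :: real using that by (simp add: field_simps)
  consider "a > 1" "a \<ge> b" | "a \<le> 1" "b \<le> 1" | "b > 1" "b > a" by linarith
  then show ?thesis
  proof cases
    case 1
    \<comment> \<open>Both lines keep the tilt \<open>- ln a\<close> up to the right end point, where \<open>f - g\<close> is minimal.\<close>
    define p where "p = 1 / (1 + a)"
    define q where "q = a / (1 + a)"
    have "p \<le> q" unfolding p_def q_def using 1 by (intro divide_right_mono) auto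
    have inf: "(INF x\<in>{0..1}. L p x - L q x) = p - q"
    proof (rule cInf_eq_minimum)
      show "p - q \<in> (\<lambda>x. L p x - L q x) ` {0..1}" using L[of 1] by (auto intro!: image_eqI[of _ _ 1])
      fix y assume "y \<in> (\<lambda>x. L p x - L q x) ` {0..1}"
      then obtain x where x: "x \<in> {0..1}" "y = L p x - L q x" by blast
      then have "y = x * (p - q)" by (simp add: L algebra_simps)
      moreover have "1 * (p - q) \<le> x * (p - q)" using x \<open>p \<le> q\<close> by (intro mult_right_mono_neg) auto
      ultimately show "p - q \<le> y" by simp
    qed
    have "interaction a b (L p) (L q) = - ln a * (p - q)"
      unfolding interaction_def inf using a b by (simp add: L[of 1] ln_mult algebra_simps)
    moreover have "p = 1 - q" using pq[OF a] by (simp add: p_def q_def)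
    ultimately have "interaction a b (L p) (L q) - path_cost (L p) - path_cost (L q) = - ln a * (1 - q - q) - 2 * (q * ln a - ln (1 + a))"
      unfolding JL using eta1[OF a] eta2[OF a] by (simp add: p_def q_def)
    also have "\<dots> = layer_pressure a" using a by (simp add: layer_pressure_eq algebra_simps)
    finally have "interaction a b (L p) (L q) - path_cost (L p) - path_cost (L q) = layer_pressure (max 1 (max a b))" using 1 by (simp add: max_def)
    then show ?thesis using that[of "L p" "L q"] LK p01[OF a] by (simp add: p_def q_def)
  next
    case 2
    have "interaction a b (L (1/2)) (L (1/2)) = 0" by (simp add: interaction_def)
    moreover have "path_cost (L (1/2)) = - ln 2" unfolding JL using eta1[of 1] by simp
    ultimately have "interaction a b (L (1/2)) (L (1/2)) - path_cost (L (1/2)) - path_cost (L (1/2)) = layer_pressure (max 1 (max a b))"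
      using 2 by (simp add: max_def layer_pressure_eq)
    then show ?thesis using that[of "L (1/2)" "L (1/2)"] LK[of "1/2"] by simp
  next
    case 3
    \<comment> \<open>Here \<open>f - g\<close> is minimal at \<open>0\<close>, and the tilt \<open>ln b\<close> acts everywhere.\<close>
    define p where "p = b / (1 + b)"
    define q where "q = 1 / (1 + b)"
    have "q \<le> p" unfolding p_def q_def using 3 by (intro divide_right_mono) auto
    have inf: "(INF x\<in>{0..1}. L p x - L q x) = 0"
    proof (rule cInf_eq_minimum)
      show "0 \<in> (\<lambda>x. L p x - L q x) ` {0..1}" using L[of 0] by (auto intro!: image_eqI[of _ _ 0])
      fix y assume "y \<in> (\<lambda>x. L p x - L q x) ` {0..1}"
      then obtain x where x: "x \<in> {0..1}" "y = L p x - L q x" by blast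
      then have "y = x * (p - q)" by (simp add: L algebra_simps)
      then show "0 \<le> y" using x \<open>q \<le> p\<close> by simp
    qed
    have "interaction a b (L p) (L q) = ln b * (p - q)"
      unfolding interaction_def inf by (simp add: L[of 1])
    moreover have "q = 1 - p" using pq[OF b] by (simp add: p_def q_def)
    ultimately have "interaction a b (L p) (L q) - path_cost (L p) - path_cost (L q) = ln b * (p - (1 - p)) - 2 * (p * ln b - ln (1 + b))"
      unfolding JL using eta1[OF b] eta2[OF b] by (simp add: p_def q_def)
    also have "\<dots> = layer_pressure b" using b by (simp add: layer_pressure_eq algebra_simps)
    finally have "interaction a b (L p) (L q) - path_cost (L p) - path_cost (L q) = layer_pressure (max 1 (max a b))" using 3 by (simp add: max_def)
    then show ?thesis using that[of "L p" "L q"] LK p01[OF b] by (simp add: p_def q_def)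
  qed
qed

section \<open>The rate function\<close>

lemma h_eq: "0 \<le> x \<Longrightarrow> x \<le> 1 \<Longrightarrow> h x = ereal (eta x)"
  by (simp add: h_def eta_def)

lemma eta_ge: "0 \<le> x \<Longrightarrow> x \<le> 1 \<Longrightarrow> - 1 \<le> eta x"
  using eta_Fenchel[of x 0] ln_le_minus_one[of 2] by simp

lemma h_ge: "- 1 \<le> h x"
proof (cases "0 \<le> x \<and> x \<le> 1")
  case True
  then show ?thesis using eta_ge[of x] by (simp add: h_eq one_ereal_def)
next
  case False
  then have "h x = \<infinity>" by (auto simp: h_def)
  then show ?thesis by simp
qed

lemma negligible_imp_AE: "negligible N \<Longrightarrow> AE x in lebesgue. x \<notin> N"
  by (intro AE_not_in) (simp add: negligible_iff_null_sets)

text \<open>Slopes lie in \<open>[0, 1]\<close> almost everywhere, where the integrand is finite and nonpositive, so only the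
  integral of the negative part contributes.\<close>

lemma ereal_integral_admissible:
  assumes f: "f \<in> admissible" and g: "g \<in> admissible"
  shows "ereal_integral (lebesgue_on {0..1}) (\<lambda>x. h (deriv f x) + h (deriv g x)) = ereal (path_cost f + path_cost g)"
proof -
  let ?u = "\<lambda>x. eta (deriv f x) + eta (deriv g x)"
  define N where "N = {x\<in>{0<..<1}. \<not> ((f has_real_derivative deriv f x) (at x) \<and> deriv f x \<in> {0..1})}
    \<union> {x\<in>{0<..<1}. \<not> ((g has_real_derivative deriv g x) (at x) \<and> deriv g x \<in> {0..1})} \<union> {0, 1}"
  have N: "negligible N"
    unfolding N_def using admissible_deriv_ae[OF f] admissible_deriv_ae[OF g] by (intro negligible_Un) auto
  have good: "0 \<le> deriv f x" "deriv f x \<le> 1" "0 \<le> deriv g x" "deriv g x \<le> 1" if "x \<in> {0..1} - N" for x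
    using that unfolding N_def by auto
  define v where "v x = (if x \<in> N then 0 else - ?u x)" for x
  have eq: "h (deriv f x) + h (deriv g x) = ereal (- v x)" "v x \<ge> 0" if "x \<in> {0..1} - N" for x
    using good[OF that] that eta_nonpos[of "deriv f x"] eta_nonpos[of "deriv g x"] by (auto simp: h_eq v_def)
  have "(?u has_integral path_cost f + path_cost g) {0..1}"
    unfolding path_cost_def using admissible_eta_integrable[OF f, of 0 1] admissible_eta_integrable[OF g, of 0 1]
    by (intro has_integral_add integrable_integral) auto
  then have "((\<lambda>x. - ?u x) has_integral - (path_cost f + path_cost g)) {0..1}" by (rule has_integral_neg)
  then have vint: "(v has_integral - (path_cost f + path_cost g)) {0..1}"
    by (rule has_integral_spike[OF N, rotated]) (simp add: v_def)
  have vpos: "v x \<ge> 0" if "x \<in> {0..1}" for x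
    using eq(2)[of x] that by (cases "x \<in> N") (auto simp: v_def)
  have "(\<integral>\<^sup>+x. e2ennreal (h (deriv f x) + h (deriv g x)) \<partial>lebesgue_on {0..1})
      = (\<integral>\<^sup>+x. e2ennreal (h (deriv f x) + h (deriv g x)) * indicator {0..1} x \<partial>lebesgue)"
    by (intro nn_integral_restrict_space) simp
  also have "\<dots> = (\<integral>\<^sup>+(x::real). 0 \<partial>lebesgue)"
  proof (rule nn_integral_cong_AE)
    show "AE x in lebesgue. e2ennreal (h (deriv f x) + h (deriv g x)) * indicator {0..1} x = 0"
      using negligible_imp_AE[OF N]
    proof eventually_elim
      case (elim x)
      then show ?case using eq[of x] by (auto simp: indicator_def ennreal_neg)
    qed
  qed
  finally have pos: "(\<integral>\<^sup>+x. e2ennreal (h (deriv f x) + h (deriv g x)) \<partial>lebesgue_on {0..1}) = 0" by simp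
  have "(\<integral>\<^sup>+x. e2ennreal (- (h (deriv f x) + h (deriv g x))) \<partial>lebesgue_on {0..1})
      = (\<integral>\<^sup>+x. e2ennreal (- (h (deriv f x) + h (deriv g x))) * indicator {0..1} x \<partial>lebesgue)"
    by (intro nn_integral_restrict_space) simp
  also have "\<dots> = (\<integral>\<^sup>+x. ennreal (indicator {0..1} x * v x) \<partial>lebesgue)"
  proof (rule nn_integral_cong_AE)
    show "AE x in lebesgue. e2ennreal (- (h (deriv f x) + h (deriv g x))) * indicator {0..1} x = ennreal (indicator {0..1} x * v x)"
      using negligible_imp_AE[OF N]
    proof eventually_elim
      case (elim x)
      then show ?case using eq[of x] by (auto simp: indicator_def)
    qed
  qed
  also have "\<dots> = (\<integral>\<^sup>+x. ennreal (indicator {0..1} x * v x) \<partial>lborel)"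
    by (rule nn_integral_completion)
  also have "\<dots> = ennreal (- (path_cost f + path_cost g))"
    using vpos vint by (rule nn_integral_has_integral_lebesgue)
  finally have neg: "(\<integral>\<^sup>+x. e2ennreal (- (h (deriv f x) + h (deriv g x))) \<partial>lebesgue_on {0..1}) = ennreal (- (path_cost f + path_cost g))" .
  have "- (path_cost f + path_cost g) \<ge> 0" using path_cost_nonpos[OF f] path_cost_nonpos[OF g] by simp
  then show ?thesis
    unfolding ereal_integral_def pos neg by (simp add: enn2ereal_ennreal zero_ennreal.rep_eq)
qed

text \<open>The derivative is an almost everywhere limit of continuous difference quotients, so the set of
  slopes outside \<open>[0, 1]\<close> is measurable up to a null set.  It cannot be null, since \<open>f\<close> would
  be admissible.  Measurability matters: the nonnegative integral of a function that is infinite on a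
  set of inner measure zero can vanish.\<close>

lemma AC0_deriv_bad_set:
  assumes f: "f \<in> AC0" "f \<notin> admissible"
  obtains B where "B \<in> sets lebesgue" "B \<subseteq> {0..1}" "emeasure lebesgue B \<noteq> 0" "\<And>x. x \<in> B \<Longrightarrow> h (deriv f x) = \<infinity>"
proof -
  have ac: "abs_continuous_on 0 1 f" and f0: "f 0 = 0" and ext: "f \<in> extensional {0..1}"
    and cont: "continuous_on {0..1} f"
    using f(1) unfolding AC0_def mspace_C01 by auto
  define N where "N = {x\<in>{0<..<1}. \<nexists>D. (f has_real_derivative D) (at x)}"
  have N: "negligible N" unfolding N_def by (rule AC_differentiable_ae[OF ac])
  define S where "S = {0<..<1} - N"
  have S: "S \<in> sets lebesgue"
    unfolding S_def using N by (intro sets.Diff) (auto simp: negligible_iff_null_sets)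
  define q where "q n x = (f (min 1 (x + 1 / real (Suc n))) - f x) / (1 / real (Suc n))" for n x
  have qmeas: "q n \<in> borel_measurable (lebesgue_on S)" for n
  proof -
    have "continuous_on S (\<lambda>x. f (min 1 (x + 1 / real (Suc n))))"
      by (rule continuous_on_compose2[OF cont]) (auto intro!: continuous_intros simp: S_def)
    moreover have "continuous_on S f" by (rule continuous_on_subset[OF cont]) (auto simp: S_def)
    ultimately have "continuous_on S (q n)"
      unfolding q_def[abs_def] by (intro continuous_on_divide continuous_on_diff continuous_on_const) auto
    then show ?thesis using S by (rule continuous_imp_measurable_on_sets_lebesgue)
  qed
  have qlim: "(\<lambda>n. q n x) \<longlonglongrightarrow> deriv f x" if x: "x \<in> S" for x
  proof -
    obtain D where "(f has_real_derivative D) (at x)" using x unfolding S_def N_def by blast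
    then have D: "(f has_real_derivative deriv f x) (at x)" using DERIV_imp_deriv by metis
    have "(\<lambda>n. 1 / real (Suc n)) \<longlonglongrightarrow> 0" using LIMSEQ_inverse_real_of_nat by (simp add: inverse_eq_divide)
    then have "(\<lambda>n. (f (x + 1 / real (Suc n)) - f x) / (x + 1 / real (Suc n) - x)) \<longlonglongrightarrow> deriv f x"
      by (intro straddle_slope_tendsto[OF D, of "\<lambda>_. x"]) auto
    moreover have "\<forall>\<^sub>F n in sequentially. (f (x + 1 / real (Suc n)) - f x) / (x + 1 / real (Suc n) - x) = q n x"
    proof -
      have "1 - x > 0" using x by (simp add: S_def)
      then have "\<forall>\<^sub>F n in sequentially. 1 / real (Suc n) < 1 - x"
        using \<open>(\<lambda>n. 1 / real (Suc n)) \<longlonglongrightarrow> 0\<close> by (intro order_tendstoD(2))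
      then show ?thesis by eventually_elim (simp add: q_def min_def)
    qed
    ultimately show ?thesis by (rule Lim_transform_eventually)
  qed
  have dmeas: "deriv f \<in> borel_measurable (lebesgue_on S)"
    by (rule borel_measurable_LIMSEQ_real[of "lebesgue_on S" q]) (use qlim qmeas in auto)
  define B where "B = {x\<in>S. deriv f x \<notin> {0..1}}"
  have "deriv f -` (- {0..1}) \<inter> space (lebesgue_on S) \<in> sets (lebesgue_on S)"
    using dmeas by (rule measurable_sets) auto
  moreover have "deriv f -` (- {0..1}) \<inter> space (lebesgue_on S) = B" by (auto simp: B_def space_restrict_space)
  ultimately have B: "B \<in> sets lebesgue"
    using S by (simp add: sets_restrict_space_iff)
  have "emeasure lebesgue B \<noteq> 0"
  proof
    assume "emeasure lebesgue B = 0"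
    then have "negligible B" using B by (simp add: negligible_iff_null_sets null_sets_def)
    then have "negligible (B \<union> N)" using N by (rule negligible_Un)
    then have "negligible {x\<in>{0<..<1}. deriv f x \<notin> {0..1}}"
      by (rule negligible_subset) (auto simp: B_def S_def)
    then show False using admissible_if_deriv_01[OF ext ac f0] f(2) by blast
  qed
  moreover have "h (deriv f x) = \<infinity>" if "x \<in> B" for x using that by (auto simp: B_def h_def)
  moreover have "B \<subseteq> {0..1}" by (auto simp: B_def S_def)
  ultimately show ?thesis using that B by blast
qed

text \<open>The positive part is infinite on a set of positive measure, while \<open>h\<close> is bounded below, so the
  negative part has finite integral.\<close>

lemma ereal_integral_AC0_infinite:
  assumes f: "f \<in> AC0" "f \<notin> admissible"
  shows "ereal_integral (lebesgue_on {0..1}) (\<lambda>x. h (deriv f x) + h (deriv g x)) = \<infinity>"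
proof -
  obtain B where B: "B \<in> sets lebesgue" "B \<subseteq> {0..1}" "emeasure lebesgue B \<noteq> 0" "\<And>x. x \<in> B \<Longrightarrow> h (deriv f x) = \<infinity>"
    using AC0_deriv_bad_set[OF f] by blast
  have "\<infinity> * emeasure lebesgue B = (\<integral>\<^sup>+x. \<infinity> * indicator B x \<partial>lebesgue)"
    using B(1) by (rule nn_integral_cmult_indicator[symmetric])
  also have "\<dots> \<le> (\<integral>\<^sup>+x. e2ennreal (h (deriv f x) + h (deriv g x)) * indicator {0..1} x \<partial>lebesgue)"
  proof (rule nn_integral_mono)
    fix x :: real
    have "h (deriv g x) \<noteq> - \<infinity>" using h_ge[of "deriv g x"] by auto
    then show "\<infinity> * indicator B x \<le> e2ennreal (h (deriv f x) + h (deriv g x)) * indicator {0..1} x"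
      using B(2) B(4)[of x] by (cases "x \<in> B") (auto simp: e2ennreal_infty)
  qed
  also have "\<dots> = (\<integral>\<^sup>+x. e2ennreal (h (deriv f x) + h (deriv g x)) \<partial>lebesgue_on {0..1})"
    by (intro nn_integral_restrict_space[symmetric]) simp
  finally have pos: "(\<integral>\<^sup>+x. e2ennreal (h (deriv f x) + h (deriv g x)) \<partial>lebesgue_on {0..1}) = \<infinity>"
    using B(3) by (simp add: ennreal_top_mult top_unique)
  have "(\<integral>\<^sup>+x. e2ennreal (- (h (deriv f x) + h (deriv g x))) \<partial>lebesgue_on {0..1}) \<le> (\<integral>\<^sup>+(x::real). ennreal 2 \<partial>lebesgue_on {0..1})"
  proof (rule nn_integral_mono)
    fix x :: real
    have "- 1 + - 1 \<le> h (deriv f x) + h (deriv g x)" by (intro add_mono h_ge)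
    then have "- (h (deriv f x) + h (deriv g x)) \<le> - (- 1 + - 1)" by (simp only: ereal_minus_le_minus)
    also have "- (- 1 + - 1) = ereal 2" by (simp add: one_ereal_def)
    finally have "e2ennreal (- (h (deriv f x) + h (deriv g x))) \<le> e2ennreal (ereal 2)" by (rule e2ennreal_mono)
    then show "e2ennreal (- (h (deriv f x) + h (deriv g x))) \<le> ennreal 2" by simp
  qed
  also have "\<dots> = ennreal 2 * emeasure (lebesgue_on {0..1}) {0..1::real}"
    by (simp add: space_restrict_space)
  also have "\<dots> < \<infinity>" by (simp add: emeasure_restrict_space ennreal_mult_less_top)
  finally have "(\<integral>\<^sup>+x. e2ennreal (- (h (deriv f x) + h (deriv g x))) \<partial>lebesgue_on {0..1}) < \<infinity>" .
  then have "enn2ereal (\<integral>\<^sup>+x. e2ennreal (- (h (deriv f x) + h (deriv g x))) \<partial>lebesgue_on {0..1}) \<noteq> \<infinity>"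
    by (metis enn2ereal_ennreal ennreal_cases ereal_infty_less(1) less_irrefl MInfty_neq_PInfty(1) PInfty_neq_ereal(1) infinity_ennreal_def)
  then show ?thesis unfolding ereal_integral_def pos by simp
qed

text \<open>The growth rate of the normalising constants.\<close>

definition free_energy :: "real \<Rightarrow> real \<Rightarrow> real" where
  "free_energy a b = - ln (rho_bar a b * (1 - rho_bar a b))"

context
  fixes a b :: real
  assumes a: "a > 0" and b: "b > 0"
begin

lemma free_energy_eq: "free_energy a b = layer_pressure (max 1 (max a b))"
  unfolding free_energy_def using a b by (rule log_rho_bar_eq)

lemma rate_bracket_admissible:
  assumes "f \<in> admissible" "g \<in> admissible"
  shows "ereal_integral (lebesgue_on {0..1}) (\<lambda>x. h (deriv f x) + h (deriv g x))
           + ereal (ln (a * b) * (INF x\<in>{0..1}. f x - g x)) - ereal (ln b * (f 1 - g 1))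
       = ereal (path_cost f + path_cost g - interaction a b f g)"
  unfolding ereal_integral_admissible[OF assms] by (simp add: interaction_def)

lemma rate_bracket_infinite:
  assumes "f \<in> AC0" "g \<in> AC0" "f \<notin> admissible \<or> g \<notin> admissible"
  shows "ereal_integral (lebesgue_on {0..1}) (\<lambda>x. h (deriv f x) + h (deriv g x))
           + ereal (ln (a * b) * (INF x\<in>{0..1}. f x - g x)) - ereal (ln b * (f 1 - g 1)) = \<infinity>"
proof -
  have "ereal_integral (lebesgue_on {0..1}) (\<lambda>x. h (deriv f x) + h (deriv g x)) = \<infinity>"
    using assms(3)
  proof
    assume "f \<notin> admissible"
    then show ?thesis by (rule ereal_integral_AC0_infinite[OF assms(1)])
  next
    assume "g \<notin> admissible"
    then show ?thesis using ereal_integral_AC0_infinite[OF assms(2), of f] by (simp add: add.commute)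
  qed
  then show ?thesis by simp
qed

lemma rate_infinite:
  assumes "f \<notin> admissible"
  shows "rate a b f = \<infinity>"
proof (cases "f \<in> AC0")
  case True
  have "(INF g\<in>AC0. ereal_integral (lebesgue_on {0..1}) (\<lambda>x. h (deriv f x) + h (deriv g x))
           + ereal (ln (a * b) * (INF x\<in>{0..1}. f x - g x)) - ereal (ln b * (f 1 - g 1))) = (INF g\<in>AC0. \<infinity>)"
    using assms True by (intro INF_cong rate_bracket_infinite) auto
  also have "\<dots> = \<infinity>" using True by (auto simp: top_ereal_def[symmetric])
  finally show ?thesis unfolding rate_def using True by simp
qed (simp add: rate_def)

text \<open>This inequality and \<open>rate_ge\<close> characterise \<open>rate\<close> on admissible paths; all later arguments use
  these two instead of the infimum over \<open>AC0\<close>.\<close>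

lemma rate_le:
  assumes f: "f \<in> admissible" and g: "g \<in> admissible"
  shows "rate a b f \<le> ereal (path_cost f + path_cost g - interaction a b f g + free_energy a b)"
proof -
  have "(INF g\<in>AC0. ereal_integral (lebesgue_on {0..1}) (\<lambda>x. h (deriv f x) + h (deriv g x))
           + ereal (ln (a * b) * (INF x\<in>{0..1}. f x - g x)) - ereal (ln b * (f 1 - g 1)))
       \<le> ereal (path_cost f + path_cost g - interaction a b f g)"
    unfolding rate_bracket_admissible[OF assms, symmetric] using admissible_AC0[OF g] by (rule INF_lower)
  then have "rate a b f \<le> ereal (path_cost f + path_cost g - interaction a b f g) - ereal (ln (rho_bar a b * (1 - rho_bar a b)))"
    unfolding rate_def if_P[OF admissible_AC0[OF f]] by (rule ereal_minus_mono) (rule order.refl)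
  then show ?thesis by (simp add: free_energy_def)
qed

lemma rate_ge:
  assumes f: "f \<in> admissible" and c: "\<And>g. g \<in> admissible \<Longrightarrow> c \<le> path_cost f + path_cost g - interaction a b f g + free_energy a b"
  shows "ereal c \<le> rate a b f"
proof -
  have "ereal (c - free_energy a b) \<le> (INF g\<in>AC0. ereal_integral (lebesgue_on {0..1}) (\<lambda>x. h (deriv f x) + h (deriv g x))
           + ereal (ln (a * b) * (INF x\<in>{0..1}. f x - g x)) - ereal (ln b * (f 1 - g 1)))"
  proof (rule INF_greatest)
    fix g assume g: "g \<in> AC0"
    show "ereal (c - free_energy a b) \<le> ereal_integral (lebesgue_on {0..1}) (\<lambda>x. h (deriv f x) + h (deriv g x))
           + ereal (ln (a * b) * (INF x\<in>{0..1}. f x - g x)) - ereal (ln b * (f 1 - g 1))"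
    proof (cases "g \<in> admissible")
      case True
      show ?thesis unfolding rate_bracket_admissible[OF f True] using c[OF True] by simp
    next
      case False
      then show ?thesis using rate_bracket_infinite[OF admissible_AC0[OF f] g] by simp
    qed
  qed
  then have "ereal (c - free_energy a b) - ereal (ln (rho_bar a b * (1 - rho_bar a b))) \<le> rate a b f"
    unfolding rate_def using admissible_AC0[OF f] by (simp only: if_True ereal_minus_mono order.refl)
  then show ?thesis by (simp add: free_energy_def)
qed

lemma rate_nonneg: "0 \<le> rate a b f"
proof (cases "f \<in> admissible")
  case True
  then have "ereal 0 \<le> rate a b f"
    using free_energy_upper[OF a b True] unfolding free_energy_eq by (intro rate_ge) (auto simp: free_energy_eq algebra_simps)
  then show ?thesis by (simp add: zero_ereal_def)
qed (simp add: rate_infinite)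

text \<open>A sequence in the level set is a sequence of admissible paths \<open>f\<close>, each of which has an almost optimal
  partner \<open>g\<close>.  Along a subsequence both converge uniformly, and the bracket in the rate function is
  lower semicontinuous jointly in \<open>f\<close> and \<open>g\<close>.\<close>

lemma rate_level_compact: "compactin (mtopology_of C01) {f \<in> mspace C01. rate a b f \<le> ereal w}"
proof -
  interpret Metric_space "mspace C01" "mdist C01" by (rule Metric_space_mspace_mdist)
  have "\<exists>l r. l \<in> {f \<in> mspace C01. rate a b f \<le> ereal w} \<and> strict_mono r \<and> limitin mtopology (s \<circ> r) l sequentially"
    if s: "range s \<subseteq> {f \<in> mspace C01. rate a b f \<le> ereal w}" for s :: "nat \<Rightarrow> real \<Rightarrow> real"
  proof -
    have sw: "rate a b (s n) \<le> ereal w" for n using s by blast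
    have sK: "s n \<in> admissible" for n using sw[of n] rate_infinite[of "s n"] by fastforce
    have "\<exists>g\<in>admissible. path_cost (s n) + path_cost g - interaction a b (s n) g + free_energy a b < w + 1 / real (Suc n)" for n
    proof (rule ccontr)
      assume "\<not> ?thesis"
      then have "ereal (w + 1 / real (Suc n)) \<le> rate a b (s n)"
        by (intro rate_ge sK) (auto simp: not_less)
      then have "ereal (w + 1 / real (Suc n)) \<le> ereal w" using sw order_trans by blast
      then show False by simp
    qed
    then obtain g where gK: "\<And>n. g n \<in> admissible"
      and gw: "\<And>n. path_cost (s n) + path_cost (g n) - interaction a b (s n) (g n) + free_energy a b < w + 1 / real (Suc n)" by metis
    obtain F r1 where F: "F \<in> admissible" and r1: "strict_mono (r1 :: nat \<Rightarrow> nat)"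
      and lim1: "\<And>e. e > 0 \<Longrightarrow> \<exists>n0. \<forall>n\<ge>n0. \<forall>x\<in>{0..1}. \<bar>s (r1 n) x - F x\<bar> \<le> e"
      using admissible_sequentially_compact[where s = s, OF sK] by blast
    obtain G r2 where G: "G \<in> admissible" and r2: "strict_mono (r2 :: nat \<Rightarrow> nat)"
      and lim2: "\<And>e. e > 0 \<Longrightarrow> \<exists>n0. \<forall>n\<ge>n0. \<forall>x\<in>{0..1}. \<bar>g (r1 (r2 n)) x - G x\<bar> \<le> e"
      using admissible_sequentially_compact[where s = "\<lambda>n. g (r1 n)", OF gK] by blast
    define r where "r = r1 \<circ> r2"
    have r: "strict_mono r" unfolding r_def using r1 r2 by (rule strict_mono_o)
    have lims: "\<exists>n0. \<forall>n\<ge>n0. \<forall>x\<in>{0..1}. \<bar>s (r n) x - F x\<bar> \<le> e" if e: "e > 0" for e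
    proof -
      obtain n0 where n0: "\<forall>n\<ge>n0. \<forall>x\<in>{0..1}. \<bar>s (r1 n) x - F x\<bar> \<le> e" using lim1[OF e] by blast
      have "n0 \<le> r2 n" if "n0 \<le> n" for n using seq_suble[OF r2, of n] that by linarith
      then show ?thesis using n0 by (auto simp: r_def)
    qed
    have limg: "\<exists>n0. \<forall>n\<ge>n0. \<forall>x\<in>{0..1}. \<bar>g (r n) x - G x\<bar> \<le> e" if e: "e > 0" for e
      using lim2[OF e] by (simp add: r_def)
    have pointwise: "(\<lambda>n. u n x) \<longlonglongrightarrow> U x"
      if u: "\<And>e. e > 0 \<Longrightarrow> \<exists>n0. \<forall>n\<ge>n0. \<forall>x\<in>{0..1}. \<bar>u n x - U x\<bar> \<le> e" and x: "x \<in> {0..1}" for u :: "nat \<Rightarrow> real \<Rightarrow> real" and U x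
    proof (rule LIMSEQ_I)
      fix e :: real assume "e > 0"
      then obtain n0 where "\<forall>n\<ge>n0. \<forall>x\<in>{0..1}. \<bar>u n x - U x\<bar> \<le> e / 2" using u[of "e / 2"] by auto
      then show "\<exists>n0. \<forall>n\<ge>n0. norm (u n x - U x) < e"
        using x \<open>e > 0\<close> by (intro exI[of _ n0]) fastforce
    qed
    have int: "(\<lambda>n. interaction a b (s (r n)) (g (r n))) \<longlonglongrightarrow> interaction a b F G"
    proof (rule LIMSEQ_I)
      fix e :: real assume "e > 0"
      define C where "C = (\<bar>ln (a * b)\<bar> + \<bar>ln b\<bar>) * 2 + 1"
      have "C > 0" by (auto simp: C_def intro!: add_nonneg_pos)
      define d where "d = e / C"
      have "d > 0" using \<open>e > 0\<close> \<open>C > 0\<close> by (simp add: d_def)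
      obtain n1 n2 where n1: "\<forall>n\<ge>n1. \<forall>x\<in>{0..1}. \<bar>s (r n) x - F x\<bar> \<le> d" and n2: "\<forall>n\<ge>n2. \<forall>x\<in>{0..1}. \<bar>g (r n) x - G x\<bar> \<le> d"
        using lims[OF \<open>d > 0\<close>] limg[OF \<open>d > 0\<close>] by blast
      have "norm (interaction a b (s (r n)) (g (r n)) - interaction a b F G) < e" if "n \<ge> max n1 n2" for n
      proof -
        have "\<bar>interaction a b (s (r n)) (g (r n)) - interaction a b F G\<bar> \<le> (\<bar>ln (a * b)\<bar> + \<bar>ln b\<bar>) * (2 * d)"
          using n1 n2 that by (intro interaction_diff_le sK gK F G) auto
        also have "\<dots> < C * d" using \<open>d > 0\<close> by (simp add: C_def algebra_simps)
        also have "C * d = e" using \<open>C > 0\<close> by (simp add: d_def)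
        finally show ?thesis by simp
      qed
      then show "\<exists>n0. \<forall>n\<ge>n0. norm (interaction a b (s (r n)) (g (r n)) - interaction a b F G) < e" by blast
    qed
    have "path_cost F + path_cost G \<le> w + interaction a b F G - free_energy a b"
    proof (rule path_cost_lower_semicontinuous[where f = "\<lambda>n. s (r n)" and g = "\<lambda>n. g (r n)"])
      show "path_cost (s (r n)) + path_cost (g (r n)) \<le> w + 1 / real (Suc (r n)) + interaction a b (s (r n)) (g (r n)) - free_energy a b" for n
        using gw[of "r n"] by linarith
      have "(\<lambda>n. 1 / real (Suc (r n))) \<longlonglongrightarrow> 0"
        using LIMSEQ_subseq_LIMSEQ[OF LIMSEQ_inverse_real_of_nat r] by (simp add: o_def inverse_eq_divide)
      then have "(\<lambda>n. w + 1 / real (Suc (r n)) + interaction a b (s (r n)) (g (r n)) - free_energy a b) \<longlonglongrightarrow> w + 0 + interaction a b F G - free_energy a b"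
        by (intro tendsto_intros int)
      then show "(\<lambda>n. w + 1 / real (Suc (r n)) + interaction a b (s (r n)) (g (r n)) - free_energy a b) \<longlonglongrightarrow> w + interaction a b F G - free_energy a b" by simp
    qed (use sK gK F G pointwise[OF lims] pointwise[OF limg] in auto)
    then have "path_cost F + path_cost G - interaction a b F G + free_energy a b \<le> w" by linarith
    then have "rate a b F \<le> ereal w" using rate_le[OF F G] order_trans by fastforce
    moreover have "limitin mtopology (s \<circ> r) F sequentially"
      using limitin_C01[OF admissible_C01[OF F] admissible_C01[OF sK] lims] by (simp add: mtopology_of_def o_def)
    ultimately show ?thesis using admissible_C01[OF F] r by blast
  qed
  then show ?thesis unfolding mtopology_of_def compactin_sequentially by blast
qed

lemma rate_lower_semicontinuous: "lower_semicontinuous_map (mtopology_of C01) (rate a b)"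
  unfolding lower_semicontinuous_map_def
proof (intro ballI allI impI)
  interpret Metric_space "mspace C01" "mdist C01" by (rule Metric_space_mspace_mdist)
  fix f c assume f: "f \<in> topspace (mtopology_of C01)" and c: "c < rate a b f"
  show "\<exists>U. openin (mtopology_of C01) U \<and> f \<in> U \<and> (\<forall>y\<in>U. c < rate a b y)"
  proof (cases c)
    case (real w)
    have "Hausdorff_space (mtopology_of C01)" unfolding mtopology_of_def by (rule Hausdorff_space_mtopology)
    then have "closedin (mtopology_of C01) {f \<in> mspace C01. rate a b f \<le> ereal w}"
      using rate_level_compact by (rule compactin_imp_closedin)
    then have "openin (mtopology_of C01) (topspace (mtopology_of C01) - {f \<in> mspace C01. rate a b f \<le> ereal w})"
      by (rule openin_diff[OF openin_topspace])
    then show ?thesis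
      using f c real by (intro exI[of _ "topspace (mtopology_of C01) - {f \<in> mspace C01. rate a b f \<le> ereal w}"]) (auto simp: not_le)
  next
    case PInf
    then show ?thesis using c by simp
  next
    case MInf
    have "- \<infinity> < rate a b y" for y using rate_nonneg[of y] by (cases "rate a b y") auto
    then show ?thesis using f MInf openin_topspace by blast
  qed
qed

end

section \<open>The two-layer weights as Gibbs weights\<close>

lemma path_min_le: "k \<le> length ds \<Longrightarrow> path_min ds \<le> sum_list (take k ds)"
proof (induction ds arbitrary: k)
  case (Cons d ds)
  then show ?case by (cases k) (auto simp: min_le_iff_disj)
qed simp

lemma path_min_attained: "\<exists>k\<le>length ds. path_min ds = sum_list (take k ds)"
proof (induction ds)
  case (Cons d ds)
  then obtain k where k: "k \<le> length ds" "path_min ds = sum_list (take k ds)" by blast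
  show ?case
  proof (cases "0 \<le> d + path_min ds")
    case True
    then show ?thesis by (intro exI[of _ 0]) simp
  next
    case False
    then show ?thesis using k by (intro exI[of _ "Suc k"]) simp
  qed
qed simp

lemma sum_list_take_map_upt: "k \<le> N \<Longrightarrow> sum_list (take k (map d [1..<Suc N])) = (\<Sum>j=1..k. d j)"
  by (simp add: take_map take_upt interv_sum_list_conv_sum_set_nat atLeastLessThanSuc_atLeastAtMost del: upt_Suc)

text \<open>On each cell the difference of heights is an average of its values at the two adjacent grid points, so the
  infimum is attained on the grid.\<close>

lemma INF_height_difference:
  assumes N: "N > 0"
  shows "(INF x\<in>{0..1}. scaled_height N \<tau> x - scaled_height N \<sigma> x)
    = 1 / real N * path_min (map (\<lambda>j. real (\<tau> j) - real (\<sigma> j)) [1..<Suc N])"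
proof -
  define ds where "ds = map (\<lambda>j. real (\<tau> j) - real (\<sigma> j)) [1..<Suc N]"
  define D where "D k = (\<Sum>j=1..k. real (\<tau> j) - real (\<sigma> j))" for k
  have len: "length ds = N" by (simp add: ds_def)
  have take: "sum_list (take k ds) = D k" if "k \<le> N" for k
    unfolding ds_def D_def using that by (rule sum_list_take_map_upt)
  have D_ge: "path_min ds \<le> D k" if "k \<le> N" for k
    using path_min_le[of k ds] take[OF that] that len by simp
  obtain k where k: "k \<le> N" "path_min ds = D k"
    using path_min_attained[of ds] take len by auto
  have grid: "scaled_height N \<tau> (real k / N) - scaled_height N \<sigma> (real k / N) = 1 / real N * D k"
    unfolding scaled_height_eq_linear_path linear_path_grid[OF N k(1)] D_def
    by (simp add: sum_subtractf right_diff_distrib)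
  have ge: "1 / real N * path_min ds \<le> scaled_height N \<tau> x - scaled_height N \<sigma> x" if x: "x \<in> {0..1}" for x
  proof -
    define i where "i = min (N - 1) (nat \<lfloor>real N * x\<rfloor>)"
    have iN: "i < N" using N by (simp add: i_def)
    have Nx: "0 \<le> real N * x" "real N * x \<le> real N" using x by (simp_all add: mult_left_le)
    have fl: "real (nat \<lfloor>real N * x\<rfloor>) \<le> real N * x" "real N * x < real (nat \<lfloor>real N * x\<rfloor>) + 1"
      using Nx(1) by (auto simp: of_nat_nat)
    have lo: "real i \<le> real N * x" using fl(1) by (simp add: i_def min_def)
    have hi: "real N * x \<le> real (Suc i)"
    proof (cases "nat \<lfloor>real N * x\<rfloor> \<le> N - 1")
      case True
      then show ?thesis using fl(2) by (simp add: i_def)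
    next
      case False
      then have "Suc i = N" using N by (simp add: i_def)
      then show ?thesis using Nx(2) by simp
    qed
    have cell: "real i / N \<le> x" "x \<le> real (Suc i) / N"
      using lo hi N by (simp_all add: pos_divide_le_eq pos_le_divide_eq mult.commute del: of_nat_Suc)
    define t where "t = real N * x - real i"
    have t: "0 \<le> t" "t \<le> 1" using lo hi by (simp_all add: t_def)
    have "scaled_height N \<tau> x - scaled_height N \<sigma> x = 1 / real N * (D i + t * (real (\<tau> (Suc i)) - real (\<sigma> (Suc i))))"
      unfolding scaled_height_eq_linear_path linear_path_cell[OF N iN cell] D_def t_def
      by (simp add: sum_subtractf algebra_simps diff_divide_distrib)
    also have "D i + t * (real (\<tau> (Suc i)) - real (\<sigma> (Suc i))) = (1 - t) * D i + t * D (Suc i)"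
      by (simp add: D_def algebra_simps)
    finally have eq: "scaled_height N \<tau> x - scaled_height N \<sigma> x = 1 / real N * ((1 - t) * D i + t * D (Suc i))" .
    have "path_min ds = (1 - t) * path_min ds + t * path_min ds" by (simp add: algebra_simps)
    also have "\<dots> \<le> (1 - t) * D i + t * D (Suc i)"
      using t iN by (intro add_mono mult_left_mono D_ge) auto
    finally show ?thesis unfolding eq by (intro mult_left_mono) auto
  qed
  show ?thesis
    unfolding ds_def[symmetric]
  proof (rule cInf_eq_minimum)
    have "real k / N \<in> {0..1}" using k(1) N by (simp add: divide_le_eq_1)
    then show "1 / real N * path_min ds \<in> (\<lambda>x. scaled_height N \<tau> x - scaled_height N \<sigma> x) ` {0..1}"
      using grid k(2) by (intro image_eqI[of _ _ "real k / N"]) simp_all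
  qed (use ge in auto)
qed

lemma pair_weight_eq_exp:
  assumes N: "N > 0" and a: "a > 0" and b: "b > 0"
  shows "pair_weight a b N \<tau> \<sigma> = exp (real N * interaction a b (scaled_height N \<tau>) (scaled_height N \<sigma>))"
proof -
  define ds where "ds = map (\<lambda>j. real (\<tau> j) - real (\<sigma> j)) [1..<Suc N]"
  have "sum_list ds = (\<Sum>j=1..N. real (\<tau> j) - real (\<sigma> j))"
    using sum_list_take_map_upt[of N N "\<lambda>j. real (\<tau> j) - real (\<sigma> j)"] by (simp add: ds_def del: upt_Suc)
  also have "\<dots> = real N * (scaled_height N \<tau> 1 - scaled_height N \<sigma> 1)"
    using linear_path_grid[OF N order.refl] N
    by (simp add: scaled_height_eq_linear_path sum_subtractf right_diff_distrib)
  finally have s: "sum_list ds = real N * (scaled_height N \<tau> 1 - scaled_height N \<sigma> 1)" .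
  have m: "path_min ds = real N * (INF x\<in>{0..1}. scaled_height N \<tau> x - scaled_height N \<sigma> x)"
    unfolding INF_height_difference[OF N] ds_def[symmetric] using N by simp
  have "a * b > 0" using a b by simp
  then have "pair_weight a b N \<tau> \<sigma> = exp (- path_min ds * ln (a * b) + sum_list ds * ln b)"
    unfolding pair_weight_def ds_def[symmetric] path_weight_def using a b by (simp add: powr_def flip: exp_add)
  also have "- path_min ds * ln (a * b) + sum_list ds * ln b
      = real N * interaction a b (scaled_height N \<tau>) (scaled_height N \<sigma>)"
    unfolding m s interaction_def by (simp add: algebra_simps)
  finally show ?thesis .
qed

section \<open>The large deviation principle\<close>

lemma expectation_tasep_stationary:
  assumes a: "a > 0" and b: "b > 0" and N: "N \<ge> 1"
  shows "(\<integral>\<tau>. exp (real N * \<Phi> (scaled_height N \<tau>)) \<partial>measure_pmf (tasep_stationary (1 / (1 + a)) (1 / (1 + b)) N))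
    = (\<Sum>\<tau>\<in>configs N. \<Sum>\<sigma>\<in>configs N. exp (real N * (\<Phi> (scaled_height N \<tau>) + interaction a b (scaled_height N \<tau>) (scaled_height N \<sigma>))))
    / (\<Sum>\<tau>\<in>configs N. \<Sum>\<sigma>\<in>configs N. exp (real N * interaction a b (scaled_height N \<tau>) (scaled_height N \<sigma>)))"
proof -
  have "N > 0" using N by simp
  note p = pmf_tasep_stationary[OF a b N, unfolded pair_weight_eq_exp[OF \<open>N > 0\<close> a b]]
  have "(\<integral>\<tau>. exp (real N * \<Phi> (scaled_height N \<tau>)) \<partial>measure_pmf (tasep_stationary (1 / (1 + a)) (1 / (1 + b)) N))
    = (\<Sum>\<tau>\<in>configs N. exp (real N * \<Phi> (scaled_height N \<tau>)) * pmf (tasep_stationary (1 / (1 + a)) (1 / (1 + b)) N) \<tau>)"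
  proof (rule integral_measure_pmf_real)
    show "\<tau> \<in> configs N" if "\<tau> \<in> set_pmf (tasep_stationary (1 / (1 + a)) (1 / (1 + b)) N)" for \<tau>
      using that p[of \<tau>] by (auto simp: set_pmf_iff split: if_splits)
  qed (rule finite_configs)
  also have "\<dots> = (\<Sum>\<tau>\<in>configs N. (\<Sum>\<sigma>\<in>configs N. exp (real N * (\<Phi> (scaled_height N \<tau>) + interaction a b (scaled_height N \<tau>) (scaled_height N \<sigma>))))
     / (\<Sum>\<tau>\<in>configs N. \<Sum>\<sigma>\<in>configs N. exp (real N * interaction a b (scaled_height N \<tau>) (scaled_height N \<sigma>))))"
    by (intro sum.cong refl) (simp add: p sum_distrib_left distrib_left exp_add)
  finally show ?thesis by (simp only: sum_divide_distrib)
qed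

lemma scaled_height_C01: "N > 0 \<Longrightarrow> scaled_height N \<tau> \<in> mspace C01"
proof -
  assume N: "N > 0"
  have "continuous_on {0..1} (\<lambda>x. 1 / real N * interpolate N (height \<tau>) x)"
    by (intro continuous_intros continuous_on_interpolate N)
  then have "continuous_on {0..1} (scaled_height N \<tau>)"
    by (rule iffD1[OF continuous_on_cong[OF refl], rotated]) (simp add: scaled_height_def)
  then show ?thesis unfolding mspace_C01 by (simp add: scaled_height_def)
qed

lemma scaled_height_measurable:
  assumes "N > 0"
  shows "scaled_height N \<in> measurable (measure_pmf p) (borel_metric C01)"
proof -
  have sp: "space (borel_metric C01) = mspace C01"
    unfolding borel_metric_def by (simp add: space_measure_of_conv)
  show ?thesis
    unfolding measurable_def sp using scaled_height_C01[OF assms] by simp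
qed

text \<open>The numerator and the denominator of the expectation both grow exponentially, at rates given by
  \<open>Laplace_limit\<close>.  The supremum over pairs of paths becomes the supremum over \<open>f\<close> of \<open>\<Phi> f - rate f\<close>
  when the supremum over \<open>g\<close> is taken first.\<close>

lemma Laplace_principle:
  assumes a: "a > 0" and b: "b > 0"
    and \<Phi>: "continuous_map (mtopology_of C01) euclideanreal \<Phi>" and bdd: "bounded (\<Phi> ` mspace C01)"
  shows "(\<lambda>N. ereal (1 / real N * ln (\<integral>\<tau>. exp (real N * \<Phi> (scaled_height N \<tau>))
        \<partial>measure_pmf (tasep_stationary (1 / (1 + a)) (1 / (1 + b)) N))))
      \<longlonglongrightarrow> (SUP f\<in>mspace C01. ereal (\<Phi> f) - rate a b f)"
proof -
  define \<Psi> where "\<Psi> f g = \<Phi> f + interaction a b f g - path_cost f - path_cost g" for f g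
  define S where "S = (SUP (f, g)\<in>admissible \<times> admissible. \<Psi> f g)"
  obtain B where B: "\<And>f. f \<in> mspace C01 \<Longrightarrow> \<bar>\<Phi> f\<bar> \<le> B" using bdd unfolding bounded_iff by auto
  have le: "\<Psi> f g \<le> B + free_energy a b" if "f \<in> admissible" "g \<in> admissible" for f g
    using B[OF admissible_C01[OF that(1)]] free_energy_upper[OF a b that] unfolding \<Psi>_def free_energy_eq[OF a b] by linarith
  have bdd_above: "bdd_above ((\<lambda>(f, g). \<Psi> f g) ` (admissible \<times> admissible))"
    using le by (intro bdd_aboveI2[of _ _ "B + free_energy a b"]) auto
  obtain f0 g0 where fg0: "f0 \<in> admissible" "g0 \<in> admissible" "interaction a b f0 g0 - path_cost f0 - path_cost g0 = layer_pressure (max 1 (max a b))"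
    using free_energy_attained[OF a b] by blast
  have S_ge: "\<Psi> f g \<le> S" if "f \<in> admissible" "g \<in> admissible" for f g
    unfolding S_def using that cSUP_upper[OF _ bdd_above, of "(f, g)"] by simp
  have S_attained: "\<exists>f\<in>admissible. \<exists>g\<in>admissible. \<Psi> f g \<ge> S - \<epsilon>" if "\<epsilon> > 0" for \<epsilon>
  proof (rule ccontr)
    assume "\<not> ?thesis"
    then have "S \<le> S - \<epsilon>"
      unfolding S_def using fg0(1,2) by (intro cSUP_least) (auto simp: not_le less_imp_le)
    then show False using that by simp
  qed
  have lim: "(\<lambda>N. 1 / real N * ln (\<integral>\<tau>. exp (real N * \<Phi> (scaled_height N \<tau>))
        \<partial>measure_pmf (tasep_stationary (1 / (1 + a)) (1 / (1 + b)) N))) \<longlonglongrightarrow> S - free_energy a b"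
  proof -
    let ?A = "\<lambda>N. \<Sum>\<tau>\<in>configs N. \<Sum>\<sigma>\<in>configs N.
      exp (real N * (\<Phi> (scaled_height N \<tau>) + interaction a b (scaled_height N \<tau>) (scaled_height N \<sigma>)))"
    let ?Z = "\<lambda>N. \<Sum>\<tau>\<in>configs N. \<Sum>\<sigma>\<in>configs N.
      exp (real N * interaction a b (scaled_height N \<tau>) (scaled_height N \<sigma>))"
    have "(\<lambda>N. 1 / real N * ln (?A N)) \<longlonglongrightarrow> S"
      using path_continuous_interaction[OF \<Phi> bdd] S_ge S_attained unfolding \<Psi>_def by (rule Laplace_limit)
    moreover have "(\<lambda>N. 1 / real N * ln (?Z N)) \<longlonglongrightarrow> free_energy a b"
    proof (rule Laplace_limit)
      show "path_continuous (interaction a b)"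
        using path_continuous_interaction[of "\<lambda>_. 0" a b] by (simp add: image_constant_conv)
      show "interaction a b f g - path_cost f - path_cost g \<le> free_energy a b" if "f \<in> admissible" "g \<in> admissible" for f g
        unfolding free_energy_eq[OF a b] by (rule free_energy_upper[OF a b that])
      show "\<exists>f\<in>admissible. \<exists>g\<in>admissible. interaction a b f g - path_cost f - path_cost g \<ge> free_energy a b - \<epsilon>" if "\<epsilon> > 0" for \<epsilon>
        using fg0 that unfolding free_energy_eq[OF a b] by (intro bexI[of _ f0] bexI[of _ g0]) auto
    qed
    ultimately have "(\<lambda>N. 1 / real N * ln (?A N) - 1 / real N * ln (?Z N)) \<longlonglongrightarrow> S - free_energy a b"
      by (rule tendsto_diff)
    moreover have "\<forall>\<^sub>F N in sequentially. 1 / real N * ln (?A N) - 1 / real N * ln (?Z N)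
      = 1 / real N * ln (\<integral>\<tau>. exp (real N * \<Phi> (scaled_height N \<tau>))
        \<partial>measure_pmf (tasep_stationary (1 / (1 + a)) (1 / (1 + b)) N))"
      unfolding eventually_sequentially
    proof (intro exI[of _ 1] allI impI)
      fix N :: nat assume N: "1 \<le> N"
      have "?A N > 0" "?Z N > 0" using finite_configs configs_nonempty by (intro sum_pos; simp)+
      then show "1 / real N * ln (?A N) - 1 / real N * ln (?Z N)
        = 1 / real N * ln (\<integral>\<tau>. exp (real N * \<Phi> (scaled_height N \<tau>))
        \<partial>measure_pmf (tasep_stationary (1 / (1 + a)) (1 / (1 + b)) N))"
        unfolding expectation_tasep_stationary[OF a b N] by (simp only: ln_divide_pos right_diff_distrib)
    qed
    ultimately show ?thesis by (rule Lim_transform_eventually)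
  qed
  have "(SUP f\<in>mspace C01. ereal (\<Phi> f) - rate a b f) = ereal (S - free_energy a b)"
  proof (rule antisym)
    show "(SUP f\<in>mspace C01. ereal (\<Phi> f) - rate a b f) \<le> ereal (S - free_energy a b)"
    proof (rule SUP_least)
      fix f assume "f \<in> mspace C01"
      show "ereal (\<Phi> f) - rate a b f \<le> ereal (S - free_energy a b)"
      proof (cases "f \<in> admissible")
        case True
        have "ereal (\<Phi> f - S + free_energy a b) \<le> rate a b f"
          using S_ge[OF True] unfolding \<Psi>_def by (intro rate_ge[OF a b True]) (auto simp: algebra_simps)
        then have "ereal (\<Phi> f) - rate a b f \<le> ereal (\<Phi> f) - ereal (\<Phi> f - S + free_energy a b)"
          by (rule ereal_minus_mono[OF order.refl])
        then show ?thesis by simp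
      next
        case False
        then show ?thesis using rate_infinite[OF a b False] by simp
      qed
    qed
    show "ereal (S - free_energy a b) \<le> (SUP f\<in>mspace C01. ereal (\<Phi> f) - rate a b f)"
    proof (rule ereal_le_epsilon2)
      fix \<epsilon> :: real assume "0 < \<epsilon>"
      then obtain f g where fg: "f \<in> admissible" "g \<in> admissible" "\<Psi> f g \<ge> S - \<epsilon>" using S_attained by blast
      have "ereal (\<Phi> f) - ereal (path_cost f + path_cost g - interaction a b f g + free_energy a b) \<le> ereal (\<Phi> f) - rate a b f"
        by (intro ereal_minus_mono order.refl rate_le[OF a b fg(1,2)])
      also have "\<dots> \<le> (SUP f\<in>mspace C01. ereal (\<Phi> f) - rate a b f)"
        using admissible_C01[OF fg(1)] by (rule SUP_upper)
      finally have le: "ereal (\<Psi> f g - free_energy a b) \<le> (SUP f\<in>mspace C01. ereal (\<Phi> f) - rate a b f)"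
        by (simp add: \<Psi>_def algebra_simps)
      have "ereal (S - free_energy a b) \<le> ereal (\<Psi> f g - free_energy a b) + ereal \<epsilon>" using fg(3) by simp
      also have "\<dots> \<le> (SUP f\<in>mspace C01. ereal (\<Phi> f) - rate a b f) + ereal \<epsilon>"
        using le by (rule add_right_mono)
      finally show "ereal (S - free_energy a b) \<le> (SUP f\<in>mspace C01. ereal (\<Phi> f) - rate a b f) + ereal \<epsilon>" .
    qed
  qed
  then show ?thesis using lim by (simp add: lim_ereal)
qed

theorem theorem3p3:
  fixes a b :: real
  assumes "a > 0" and "b > 0"
  shows "LDP C01 (\<lambda>N. measure_pmf (tasep_stationary (1 / (1 + a)) (1 / (1 + b)) N))
           scaled_height (rate a b)"
  unfolding LDP_def
proof (intro conjI allI impI ballI; (elim conjE)?)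
  show "prob_space (measure_pmf (tasep_stationary (1 / (1 + a)) (1 / (1 + b)) N))" for N
    by (rule measure_pmf.prob_space_axioms)
  show "scaled_height N \<in> measurable (measure_pmf (tasep_stationary (1 / (1 + a)) (1 / (1 + b)) N)) (borel_metric C01)"
    if "1 \<le> N" for N
    using that by (intro scaled_height_measurable) simp
  show "0 \<le> rate a b f" for f by (rule rate_nonneg[OF assms])
  show "lower_semicontinuous_map (mtopology_of C01) (rate a b)"
    by (rule rate_lower_semicontinuous[OF assms])
  show "compactin (mtopology_of C01) {f \<in> mspace C01. rate a b f \<le> ereal w}" for w
    by (rule rate_level_compact[OF assms])
  show "(\<lambda>N. ereal (1 / real N * ln (\<integral>\<tau>. exp (real N * \<Phi> (scaled_height N \<tau>))
        \<partial>measure_pmf (tasep_stationary (1 / (1 + a)) (1 / (1 + b)) N))))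
      \<longlonglongrightarrow> (SUP f\<in>mspace C01. ereal (\<Phi> f) - rate a b f)"
    if "continuous_map (mtopology_of C01) euclideanreal \<Phi>" "bounded (\<Phi> ` mspace C01)" for \<Phi>
    using assms that by (rule Laplace_principle)
qed

end
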